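(* The algebra $A_n=(\bigwedge M_n^*\otimes M_n)^G$ is a free left module over the subalgebra $AT_{n-1}$ (the exterior algebra generated by $T_0,\dots,T_{n-2}$), with basis $1,X,X^2,\dots,X^{2n-1}$. Moreover, the kernel of the canonical homomorphism $\mathcal{TA}_n\to A_n$ is the ideal generated by $X^{2n}$ and $O_n=nX^{2n-1}-\sum_{i=0}^{n-1}X^{2i}\wedge T_{n-i-1}$.
   Context: Let $F$ be a field of characteristic $0$, $n\ge1$, $M_n=M_n(F)$, $G=PGL_n(F)$ acting by conjugation. $\bigwedge M_n^*\otimes M_n$ is identified with the algebra of multilinear antisymmetric functions $M_n^k\to M_n$ ($k\ge0$) under the product $(f\wedge h)(v_1,\dots,v_{a+b})=\frac1{a!b!}\sum_{\sigma\in S_{a+b}}\epsilon_\sigma f(v_{\sigma(1)},\dots,v_{\sigma(a)})h(v_{\sigma(a+1)},\dots,v_{\sigma(a+b)})$; $G$ acts by automorphisms, and $A_n$ is the invariant subalgebra ($G$-equivariant such functions). $X\in A_n$ is the identity map $M_n\to M_n$, so $X^a=X^{\wedge a}$ equals the standard polynomial $S_a$. $T_h:=\mathrm{tr}(S_{2h+1}(x_1,\dots,x_{2h+1}))\in(\bigwedge^{2h+1}M_n^* )^G$ (viewed in $A_n$ as scalar-valued). $\mathcal{TA}_n$ is the formal graded algebra generated by $T_0,\dots,T_{n-1}$ ($\deg T_h=2h+1$) and $X$ ($\deg 1$), where the $T_h$ generate an exterior algebra, $X$ anticommutes with all $T_h$, and everything of degree $>n^2$ is zero; the canonical homomorphism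 $\mathcal{TA}_n\to A_n$ sends the formal $T_h$, $X$ to the functions of the same name. *)

theory Defs
  imports "HOL-Analysis.Analysis"
begin

text \<open>M_n = 'a^'n^'n with n = CARD('n). An element of the (graded) algebra
  of multilinear antisymmetric functions is a family w indexed by the degree k,
  where w k takes a sequence of matrices (only the first k entries matter).\<close>

type_synonym ('a,'n) mform = "nat \<Rightarrow> (nat \<Rightarrow> 'a^'n^'n) \<Rightarrow> 'a^'n^'n"

definition kform :: "nat \<Rightarrow> ((nat \<Rightarrow> ('a::field)^'n^'n) \<Rightarrow> 'a^'n^'n) \<Rightarrow> bool" where
  "kform k f \<longleftrightarrow>
     (\<forall>v v'. (\<forall>i<k. v i = v' i) \<longrightarrow> f v = f v') \<and>
     (\<forall>i<k. \<forall>v x y (c::'a). f (v(i := mat c ** x + y)) = mat c ** f (v(i := x)) + f (v(i := y))) \<and>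
     (\<forall>i j v. i < j \<and> j < k \<longrightarrow> f (v \<circ> Transposition.transpose i j) = - f v)"

text \<open>The full algebra of antisymmetric multilinear functions (the exterior algebra
  tensor M_n): degree-k components are k-forms; nothing above degree n^2.\<close>
definition forms :: "('a::field,'n::finite) mform set" where
  "forms = {w. \<forall>k. kform k (w k) \<and> (CARD('n)^2 < k \<longrightarrow> w k = (\<lambda>_. 0))}"

definition wedge :: "('a::field,'n::finite) mform \<Rightarrow> ('a,'n) mform \<Rightarrow> ('a,'n) mform"
  (infixl "\<and>\<^sub>w" 70) where
  "wedge f h = (\<lambda>m v. \<Sum>a\<le>m.
      mat (1 / of_nat (fact a * fact (m - a))) **
      (\<Sum>\<sigma>\<in>{\<sigma>. \<sigma> permutes {..<m}}.
          mat (of_int (sign \<sigma>)) ** (f a (\<lambda>i. v (\<sigma> i)) ** h (m - a) (\<lambda>i. v (\<sigma> (i + a))))))"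

definition fadd :: "('a::field,'n::finite) mform \<Rightarrow> ('a,'n) mform \<Rightarrow> ('a,'n) mform" where
  "fadd f h = (\<lambda>k v. f k v + h k v)"

definition fscale :: "'a::field \<Rightarrow> ('a,'n::finite) mform \<Rightarrow> ('a,'n) mform" where
  "fscale c f = (\<lambda>k v. mat c ** f k v)"

definition fzero :: "('a::field,'n::finite) mform" where
  "fzero = (\<lambda>k v. 0)"

definition fone :: "('a::field,'n::finite) mform" where
  "fone = (\<lambda>k v. if k = 0 then mat 1 else 0)"

definition Xf :: "('a::field,'n::finite) mform" where
  "Xf = (\<lambda>k v. if k = 1 then v 0 else 0)"

definition fpow :: "('a::field,'n::finite) mform \<Rightarrow> nat \<Rightarrow> ('a,'n) mform" where
  "fpow f k = ((\<lambda>g. f \<and>\<^sub>w g) ^^ k) fone"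

definition mtrace :: "('a::field)^'n^'n \<Rightarrow> 'a" where
  "mtrace A = (\<Sum>i\<in>UNIV. A $ i $ i)"

definition stdpoly :: "nat \<Rightarrow> (nat \<Rightarrow> ('a::field)^'n^'n) \<Rightarrow> 'a^'n^'n" where
  "stdpoly k v = (\<Sum>\<sigma>\<in>{\<sigma>. \<sigma> permutes {..<k}}.
      mat (of_int (sign \<sigma>)) ** foldr (\<lambda>i acc. v (\<sigma> i) ** acc) [0..<k] (mat 1))"

definition Tf :: "nat \<Rightarrow> ('a::field,'n::finite) mform" where
  "Tf h = (\<lambda>k v. if k = 2*h+1 then mat (mtrace (stdpoly (2*h+1) v)) else 0)"

text \<open>G-invariance: equivariance under conjugation (GL_n and PGL_n give the same action).\<close>
definition invariant :: "('a::field,'n::finite) mform \<Rightarrow> bool" where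
  "invariant w \<longleftrightarrow> (\<forall>g g' :: 'a^'n^'n. g ** g' = mat 1 \<and> g' ** g = mat 1 \<longrightarrow>
      (\<forall>k v. w k (\<lambda>i. g ** v i ** g') = g ** w k v ** g'))"

definition A_alg :: "('a::field,'n::finite) mform set" where
  "A_alg = {w \<in> forms. invariant w}"

inductive_set AT_sub :: "('a::field,'n::finite) mform set" where
  one: "fone \<in> AT_sub"
| gen: "Suc h < CARD('n) \<Longrightarrow> Tf h \<in> AT_sub"
| add: "f \<in> AT_sub \<Longrightarrow> g \<in> AT_sub \<Longrightarrow> fadd f g \<in> AT_sub"
| scale: "f \<in> AT_sub \<Longrightarrow> fscale c f \<in> AT_sub"
| mult: "f \<in> AT_sub \<Longrightarrow> g \<in> AT_sub \<Longrightarrow> f \<and>\<^sub>w g \<in> AT_sub"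

text \<open>Elements are coefficient functions c S k on the monomial basis
  T_S X^k (T_S = T_{s1} ... T_{sr}, s1 < ... < sr, S a subset of {0..n-1}),
  with degree sum_{h in S}(2h+1) + k at most n^2.\<close>

type_synonym 'a ta = "nat set \<Rightarrow> nat \<Rightarrow> 'a"

definition tdeg :: "nat set \<Rightarrow> nat \<Rightarrow> nat" where
  "tdeg S k = (\<Sum>h\<in>S. 2*h+1) + k"

definition ta_ok :: "nat \<Rightarrow> nat set \<Rightarrow> nat \<Rightarrow> bool" where
  "ta_ok n S k \<longleftrightarrow> S \<subseteq> {..<n} \<and> tdeg S k \<le> n^2"

definition TA :: "nat \<Rightarrow> ('a::field) ta set" where
  "TA n = {c. \<forall>S k. \<not> ta_ok n S k \<longrightarrow> c S k = 0}"

text \<open>Sign of (T_S X^k)(T_R X^l) = sign * T_{S \<union> R} X^{k+l} for disjoint S, R.\<close>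
definition tsign :: "nat set \<Rightarrow> nat set \<Rightarrow> nat \<Rightarrow> int" where
  "tsign S R k = (-1) ^ (k * card R + card {(s,r). s \<in> S \<and> r \<in> R \<and> r < s})"

definition ta_mult :: "nat \<Rightarrow> ('a::field) ta \<Rightarrow> 'a ta \<Rightarrow> 'a ta" where
  "ta_mult n c d = (\<lambda>U m. if ta_ok n U m then
      (\<Sum>S\<in>Pow U. \<Sum>k\<le>m. of_int (tsign S (U - S) k) * c S k * d (U - S) (m - k))
    else 0)"

definition ta_basis :: "nat \<Rightarrow> nat set \<Rightarrow> nat \<Rightarrow> ('a::field) ta" where
  "ta_basis n S k = (\<lambda>U m. if U = S \<and> m = k \<and> ta_ok n S k then 1 else 0)"

definition ta_one :: "nat \<Rightarrow> ('a::field) ta" where "ta_one n = ta_basis n {} 0"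
definition ta_X :: "nat \<Rightarrow> ('a::field) ta" where "ta_X n = ta_basis n {} 1"
definition ta_T :: "nat \<Rightarrow> nat \<Rightarrow> ('a::field) ta" where "ta_T n h = ta_basis n {h} 0"

definition ta_pow :: "nat \<Rightarrow> ('a::field) ta \<Rightarrow> nat \<Rightarrow> 'a ta" where
  "ta_pow n c k = (ta_mult n c ^^ k) (ta_one n)"

definition ta_O :: "nat \<Rightarrow> ('a::field) ta" where
  "ta_O n = (\<lambda>U m. of_nat n * ta_pow n (ta_X n) (2*n - 1) U m
      - (\<Sum>i<n. ta_mult n (ta_pow n (ta_X n) (2*i)) (ta_T n (n - i - 1)) U m))"

inductive_set ta_ideal :: "nat \<Rightarrow> ('a::field) ta set \<Rightarrow> 'a ta set" for n B where
  zero: "(\<lambda>U m. 0) \<in> ta_ideal n B"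
| base: "b \<in> B \<Longrightarrow> b \<in> ta_ideal n B"
| add: "a \<in> ta_ideal n B \<Longrightarrow> b \<in> ta_ideal n B \<Longrightarrow> (\<lambda>U m. a U m + b U m) \<in> ta_ideal n B"
| lmult: "a \<in> ta_ideal n B \<Longrightarrow> c \<in> TA n \<Longrightarrow> ta_mult n c a \<in> ta_ideal n B"
| rmult: "a \<in> ta_ideal n B \<Longrightarrow> c \<in> TA n \<Longrightarrow> ta_mult n a c \<in> ta_ideal n B"

definition Tprod :: "nat set \<Rightarrow> ('a::field,'n::finite) mform" where
  "Tprod S = foldr (\<lambda>h acc. Tf h \<and>\<^sub>w acc) (sorted_list_of_set S) fone"

definition canon :: "('a::field) ta \<Rightarrow> ('a,'n::finite) mform" where
  "canon c = (\<lambda>k v. \<Sum>S\<in>Pow {..<CARD('n)}. \<Sum>j\<le>CARD('n)^2.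
      mat (c S j) ** (Tprod S \<and>\<^sub>w fpow Xf j) k v)"

end

theory Submission
  imports Defs "HOL-Library.Function_Algebras"
begin

text \<open>
  Write \<open>n\<close> for the matrix size. An equivariant alternating form of degree \<open>k\<close> amounts to an invariant
  multilinear function of \<open>k + 1\<close> matrices. Such a function is a combination of products of traces of
  words, because the commutant of \<open>GL\<^sub>n\<close> on a tensor power is spanned by permutations (double centralizer
  theorem; the projection onto the span of the permutations is averaged as in Maschke's theorem).
  Alternation kills the traces of even words, so \<open>A\<^sub>n\<close> is spanned by the products \<open>T\<^sub>S X\<^sup>k\<close>.

  Substituting \<open>X\<^sup>2\<close> into all slots but one of the multilinear Cayley-Hamilton identity and alternating gives
  \<open>X\<^sup>2\<^sup>n = 0\<close> (Rosset's proof of the Amitsur-Levitzki theorem); with \<open>X\<close> itself in one further slot it gives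
  \<open>O\<^sub>n = 0\<close>. These two relations reduce every product to one with \<open>S \<subseteq> {0..n-2}\<close> and \<open>k < 2n\<close>.

  Linear independence comes from the top degree \<open>n\<^sup>2\<close>: the volume form of the space of matrices is invariant,
  hence a combination of reduced products, and only \<open>T\<^sub>0 \<dots> T\<^sub>n\<^sub>-\<^sub>2 X\<^sup>2\<^sup>n\<^sup>-\<^sup>1\<close> has that degree. So this product is
  nonzero, and multiplying a linear relation by a complementary product isolates a single coefficient.
\<close>

section \<open>Alternation\<close>

text \<open>Both halves of the theorem rest on one fact: \<open>canon\<close> maps the formal
  elements with \<open>S\<close> inside \<open>{..<n - 1}\<close> and \<open>k < 2 * n\<close>
  bijectively onto the invariants. Surjectivity says that the powers of X generate, injectivity that
  they are independent. Since every formal element is congruent to such a reduced one modulo the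
  ideal, injectivity also shows that the kernel is no larger than the ideal. No dimension of a space
  of invariants is computed: because (n-1)^2 + (2n-1) = n^2, one nonzero invariant of top degree is
  enough.

  The obstacle in the computations is the sum over permutations with its factor 1/(a! b!). Forms are
  therefore represented by functions that need not alternate yet, multiplied by concatenating their
  arguments, and alternated once. Slots are kept in lists, so that signs become signs of rearranged
  lists. The alternation is scalar valued and is applied to matrices entry by entry; traces against
  matrix units express the entries.\<close>

definition alt :: "nat \<Rightarrow> ((nat \<Rightarrow> 'v) \<Rightarrow> 'a::comm_ring_1) \<Rightarrow> (nat \<Rightarrow> 'v) \<Rightarrow> 'a" where
  "alt m P v = (\<Sum>\<sigma> | \<sigma> permutes {..<m}. of_int (sign \<sigma>) * P (v \<circ> \<sigma>))"

definition local_on :: "nat \<Rightarrow> ((nat \<Rightarrow> 'v) \<Rightarrow> 'b) \<Rightarrow> bool" where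
  "local_on m P \<longleftrightarrow> (\<forall>v v'. (\<forall>i<m. v i = v' i) \<longrightarrow> P v = P v')"

definition shift :: "nat \<Rightarrow> (nat \<Rightarrow> 'v) \<Rightarrow> nat \<Rightarrow> 'v" where
  "shift a v = (\<lambda>i. v (i + a))"

lemma shift_0 [simp]: "shift 0 v = v"
  by (simp add: shift_def)

lemma shift_shift [simp]: "shift a (shift b v) = shift (a + b) v"
  by (simp add: shift_def add.assoc)

lemma shift_apply: "shift a v i = v (i + a)"
  by (simp add: shift_def)

lemma finite_perms [simp]: "finite {\<sigma>. \<sigma> permutes {..<m::nat}}"
  by (simp add: finite_permutations)

lemma permutes_lessThan_permutation: "\<sigma> permutes {..<m::nat} \<Longrightarrow> permutation \<sigma>"
  using permutation_permutes by blast

lemma of_int_sign_square [simp]: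
  "of_int (sign \<sigma>) * (of_int (sign \<sigma>) * x) = (x :: 'a::comm_ring_1)"
proof -
  have "of_int (sign \<sigma>) * (of_int (sign \<sigma>) :: 'a) = 1"
    by (simp add: sign_def)
  then show ?thesis by (simp add: mult.assoc[symmetric])
qed

lemma alt_0: "alt 0 P v = P v"
  by (simp add: alt_def)

lemma alt_1: "alt (Suc 0) P v = P v"
proof -
  have "{\<sigma>. \<sigma> permutes {..<Suc 0}} = {id}"
    by (auto simp: lessThan_Suc)
  then show ?thesis by (simp add: alt_def)
qed

lemma alt_add: "alt m (\<lambda>v. P v + Q v) v = alt m P v + alt m Q v"
  by (simp add: alt_def sum.distrib distrib_left)

lemma alt_diff: "alt m (\<lambda>v. P v - Q v) v = alt m P v - alt m Q v"
  by (simp add: alt_def sum_subtractf right_diff_distrib)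

lemma alt_mult_const: "alt m (\<lambda>v. c * P v) v = c * alt m P v"
  by (simp add: alt_def sum_distrib_left mult.left_commute)

lemma alt_zero [simp]: "alt m (\<lambda>v. 0) v = 0"
  by (simp add: alt_def)

lemma alt_sum: "alt m (\<lambda>v. \<Sum>x\<in>A. P x v) v = (\<Sum>x\<in>A. alt m (P x) v)"
  by (simp add: alt_def sum_distrib_left) (rule sum.swap)

lemma alt_cong: "(\<And>v. P v = Q v) \<Longrightarrow> alt m P v = alt m Q v"
  by (simp add: alt_def)

lemma alt_comp_perm:
  assumes "\<pi> permutes {..<m}"
  shows "alt m (\<lambda>v. P (v \<circ> \<pi>)) v = of_int (sign \<pi>) * alt m P v"
proof -
  have "alt m P v = (\<Sum>\<sigma> | \<sigma> permutes {..<m}. of_int (sign (\<sigma> \<circ> \<pi>)) * P (v \<circ> (\<sigma> \<circ> \<pi>)))"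
    unfolding alt_def by (rule sum_permutations_compose_right[OF assms])
  also have "\<dots> = (\<Sum>\<sigma> | \<sigma> permutes {..<m}. of_int (sign \<pi>) * (of_int (sign \<sigma>) * P (v \<circ> \<sigma> \<circ> \<pi>)))"
    by (intro sum.cong refl)
      (use assms in \<open>auto simp: sign_compose permutes_lessThan_permutation comp_assoc mult_ac\<close>)
  finally show ?thesis
    unfolding alt_def by (simp add: sum_distrib_left)
qed

lemma alt_at_perm:
  assumes "\<pi> permutes {..<m}"
  shows "alt m P (v \<circ> \<pi>) = of_int (sign \<pi>) * alt m P v"
proof -
  have "alt m P v = (\<Sum>\<sigma> | \<sigma> permutes {..<m}. of_int (sign (\<pi> \<circ> \<sigma>)) * P (v \<circ> (\<pi> \<circ> \<sigma>)))"
    unfolding alt_def by (rule setum_permutations_compose_left[OF assms])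
  also have "\<dots> = (\<Sum>\<sigma> | \<sigma> permutes {..<m}. of_int (sign \<pi>) * (of_int (sign \<sigma>) * P (v \<circ> \<pi> \<circ> \<sigma>)))"
    by (intro sum.cong refl)
      (use assms in \<open>auto simp: sign_compose permutes_lessThan_permutation comp_assoc mult_ac\<close>)
  finally show ?thesis
    unfolding alt_def by (simp add: sum_distrib_left)
qed

lemma alt_alternating_fixed:
  assumes "\<And>v \<pi>. \<pi> permutes {..<m} \<Longrightarrow> P (v \<circ> \<pi>) = of_int (sign \<pi>) * P v"
  shows "alt m P v = of_nat (fact m) * P v"
proof -
  have "alt m P v = (\<Sum>\<sigma> | \<sigma> permutes {..<m}. P v)"
    unfolding alt_def by (intro sum.cong refl) (use assms in auto)
  then show ?thesis
    using card_permutations[of "{..<m}" m] by simp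
qed

lemma alt_local:
  assumes "local_on m P" shows "local_on m (alt m P)"
  unfolding local_on_def alt_def
proof (intro allI impI sum.cong refl)
  fix v v' :: "nat \<Rightarrow> 'a" and \<sigma>
  assume v: "\<forall>i<m. v i = v' i" and "\<sigma> \<in> {\<sigma>. \<sigma> permutes {..<m}}"
  then have "P (v \<circ> \<sigma>) = P (v' \<circ> \<sigma>)"
    using assms permutes_in_image[of \<sigma> "{..<m}"] unfolding local_on_def by (metis (full_types) comp_apply lessThan_iff mem_Collect_eq)
  then show "of_int (sign \<sigma>) * P (v \<circ> \<sigma>) = of_int (sign \<sigma>) * P (v' \<circ> \<sigma>)" by simp
qed

text \<open>A permutation of the first \<open>a\<close> slots is also one of all
  \<open>a + b\<close> slots and leaves the second block alone. The outer alternation absorbs it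
  together with its sign, so the \<open>a!\<close> inner terms agree.\<close>

lemma alt_alt_left:
  fixes P :: "(nat \<Rightarrow> 'b) \<Rightarrow> 'a::comm_ring_1"
  shows
  "alt (a + b) (\<lambda>v. alt a P v * Q (shift a v)) v = of_nat (fact a) * alt (a + b) (\<lambda>v. P v * Q (shift a v)) v"
proof -
  have "alt (a + b) (\<lambda>v. alt a P v * Q (shift a v)) v
      = alt (a + b) (\<lambda>v. \<Sum>\<tau> | \<tau> permutes {..<a}. of_int (sign \<tau>) * (P (v \<circ> \<tau>) * Q (shift a (v \<circ> \<tau>)))) v"
  proof (rule alt_cong)
    fix v :: "nat \<Rightarrow> 'b"
    have "shift a (v \<circ> \<tau>) = shift a v" if "\<tau> permutes {..<a}" for \<tau>
      using that by (auto simp: shift_def permutes_def)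
    then show "alt a P v * Q (shift a v) = (\<Sum>\<tau> | \<tau> permutes {..<a}. of_int (sign \<tau>) * (P (v \<circ> \<tau>) * Q (shift a (v \<circ> \<tau>))))"
      unfolding alt_def by (simp add: sum_distrib_right mult.assoc)
  qed
  also have "\<dots> = (\<Sum>\<tau> | \<tau> permutes {..<a}. alt (a + b) (\<lambda>v. P v * Q (shift a v)) v)"
    unfolding alt_sum alt_mult_const
  proof (intro sum.cong refl)
    fix \<tau> assume "\<tau> \<in> {\<tau>. \<tau> permutes {..<a}}"
    then have "\<tau> permutes {..<a + b}"
      by (auto intro: permutes_subset)
    from alt_comp_perm[OF this, of "\<lambda>v. P v * Q (shift a v)"]
    show "of_int (sign \<tau>) * alt (a + b) (\<lambda>v. P (v \<circ> \<tau>) * Q (shift a (v \<circ> \<tau>))) v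
        = alt (a + b) (\<lambda>v. P v * Q (shift a v)) v"
      by simp
  qed
  also have "\<dots> = of_nat (fact a) * alt (a + b) (\<lambda>v. P v * Q (shift a v)) v"
    using card_permutations[of "{..<a}" a] by simp
  finally show ?thesis .
qed

text \<open>Carries a permutation to the second block of slots, where it acts without touching the
  first \<open>a\<close>. The transport along a shift does not change the cycle type, hence not the
  sign.\<close>

lemma shifted_perm:
  assumes "\<tau> permutes {..<b::nat}"
  obtains \<tau>' where "\<tau>' permutes {..<a + b}" "sign \<tau>' = sign \<tau>" "\<And>i. i < a \<Longrightarrow> \<tau>' i = i" "\<And>i. \<tau>' (i + a) = \<tau> i + a"
proof
  let ?f = "\<lambda>i. i + a"
  let ?t = "map_permutation {..<b} ?f \<tau>"
  have bij: "bij_betw ?f {..<b} {a..<a+b}"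
    by (rule bij_betwI[where g = "\<lambda>i. i - a"]) auto
  have p: "?t permutes {a..<a+b}"
    by (rule map_permutation_permutes[OF bij assms])
  then show "?t permutes {..<a + b}" by (rule permutes_subset) auto
  show "sign ?t = sign \<tau>"
    by (rule sign_map_permutation) (use assms in auto)
  show "?t i = i" if "i < a" for i
    using p that by (auto simp: permutes_def)
  show "?t (i + a) = \<tau> i + a" for i
  proof (cases "i < b")
    case True
    then show ?thesis using map_permutation_apply[of ?f "{..<b}" i \<tau>] by simp
  next
    case False
    then show ?thesis using p assms by (auto simp: permutes_def)
  qed
qed

text \<open>As for the first block, with the permutations moved up by \<open>a\<close>. Locality of
  \<open>P\<close> ensures that it does not see them.\<close>

lemma alt_alt_right:
  fixes P :: "(nat \<Rightarrow> 'b) \<Rightarrow> 'a::comm_ring_1"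
  assumes "local_on a P"
  shows "alt (a + b) (\<lambda>v. P v * alt b Q (shift a v)) v = of_nat (fact b) * alt (a + b) (\<lambda>v. P v * Q (shift a v)) v"
proof -
  have ex: "\<exists>\<tau>'. \<tau>' permutes {..<a + b} \<and> sign \<tau>' = sign \<tau> \<and> (\<forall>i<a. \<tau>' i = i) \<and> (\<forall>i. \<tau>' (i + a) = \<tau> i + a)"
    if "\<tau> permutes {..<b}" for \<tau>
    using shifted_perm[OF that] by metis
  define s where "s \<tau> = (SOME \<tau>'. \<tau>' permutes {..<a + b} \<and> sign \<tau>' = sign \<tau> \<and> (\<forall>i<a. \<tau>' i = i) \<and> (\<forall>i. \<tau>' (i + a) = \<tau> i + a))" for \<tau>
  have s: "s \<tau> permutes {..<a + b} \<and> sign (s \<tau>) = sign \<tau> \<and> (\<forall>i<a. s \<tau> i = i) \<and> (\<forall>i. s \<tau> (i + a) = \<tau> i + a)"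
    if "\<tau> permutes {..<b}" for \<tau>
    unfolding s_def by (rule someI_ex[OF ex[OF that]])
  have "alt (a + b) (\<lambda>v. P v * alt b Q (shift a v)) v
      = alt (a + b) (\<lambda>v. \<Sum>\<tau> | \<tau> permutes {..<b}. of_int (sign \<tau>) * (P (v \<circ> s \<tau>) * Q (shift a (v \<circ> s \<tau>)))) v"
  proof (rule alt_cong)
    fix v :: "nat \<Rightarrow> 'b"
    have "shift a (v \<circ> s \<tau>) = shift a v \<circ> \<tau>" if "\<tau> permutes {..<b}" for \<tau>
      using s[OF that] by (auto simp: shift_def)
    moreover have "P (v \<circ> s \<tau>) = P v" if "\<tau> permutes {..<b}" for \<tau>
      using s[OF that] assms by (auto simp: local_on_def)
    ultimately show "P v * alt b Q (shift a v) = (\<Sum>\<tau> | \<tau> permutes {..<b}. of_int (sign \<tau>) * (P (v \<circ> s \<tau>) * Q (shift a (v \<circ> s \<tau>))))"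
      unfolding alt_def by (simp add: sum_distrib_left mult_ac)
  qed
  also have "\<dots> = (\<Sum>\<tau> | \<tau> permutes {..<b}. alt (a + b) (\<lambda>v. P v * Q (shift a v)) v)"
    unfolding alt_sum alt_mult_const
  proof (intro sum.cong refl)
    fix \<tau> assume "\<tau> \<in> {\<tau>. \<tau> permutes {..<b}}"
    then have s': "s \<tau> permutes {..<a + b}" "sign (s \<tau>) = sign \<tau>"
      using s by auto
    from alt_comp_perm[OF s'(1), of "\<lambda>v. P v * Q (shift a v)"]
    show "of_int (sign \<tau>) * alt (a + b) (\<lambda>v. P (v \<circ> s \<tau>) * Q (shift a (v \<circ> s \<tau>))) v
        = alt (a + b) (\<lambda>v. P v * Q (shift a v)) v"
      by (simp add: s'(2))
  qed
  also have "\<dots> = of_nat (fact b) * alt (a + b) (\<lambda>v. P v * Q (shift a v)) v"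
    using card_permutations[of "{..<b}" b] by simp
  finally show ?thesis .
qed

lemma alt_alt_both:
  assumes "local_on a P"
  shows "alt (a + b) (\<lambda>v. alt a P v * alt b Q (shift a v)) v
    = of_nat (fact a * fact b) * alt (a + b) (\<lambda>v. P v * Q (shift a v)) v"
  using alt_alt_left[of a b P "alt b Q" v] alt_alt_right[OF assms, of b Q v]
  by (simp add: mult.assoc)

section \<open>Forms as alternations, and the wedge product\<close>

lemma mat_scale_nth [simp]: "(mat c ** A) $ i $ j = c * (A $ i $ j :: 'a::comm_ring_1)"
  by (simp add: matrix_matrix_mult_def mat_def if_distrib[of "\<lambda>x. x * _"] cong: if_cong)

text \<open>The alternation carries no factor \<open>1/a!\<close>: with this normalization the wedge product of two such forms comes
  from the concatenation of the functions \<open>P\<close> and \<open>Q\<close>.\<close>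

definition hform :: "nat \<Rightarrow> ((nat \<Rightarrow> ('a::field)^'n^'n) \<Rightarrow> 'a^'n^'n) \<Rightarrow> ('a,'n::finite) mform" where
  "hform a P = (\<lambda>k v. if k = a then \<chi> p q. alt a (\<lambda>v. P v $ p $ q) v else 0)"

lemma hform_nth: "hform a P k v $ p $ q = (if k = a then alt a (\<lambda>v. P v $ p $ q) v else 0)"
  by (simp add: hform_def)

lemma mform_eqI:
  assumes "\<And>k v p q. (f :: ('a::field,'n::finite) mform) k v $ p $ q = h k v $ p $ q"
  shows "f = h"
  using assms by (intro ext) (simp add: vec_eq_iff)

lemma wedge_nth:
  "(f \<and>\<^sub>w h) m v $ p $ q = (\<Sum>a\<le>m. 1 / of_nat (fact a * fact (m - a)) *
     (\<Sum>r\<in>UNIV. alt m (\<lambda>v. f a v $ p $ r * h (m - a) (shift a v) $ r $ q) v))"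
proof -
  have *: "(\<Sum>\<sigma> | \<sigma> permutes {..<m}. of_int (sign \<sigma>) * (\<Sum>k\<in>UNIV. f a (\<lambda>i. v (\<sigma> i)) $ p $ k * h (m - a) (\<lambda>i. v (\<sigma> (i + a))) $ k $ q))
     = (\<Sum>r\<in>UNIV. alt m (\<lambda>v. f a v $ p $ r * h (m - a) (shift a v) $ r $ q) v)" for a
    unfolding alt_def sum_distrib_left by (subst sum.swap) (simp add: shift_def o_def)
  show ?thesis
    unfolding wedge_def
    by (simp add: sum_component * matrix_matrix_mult_def[of "f _ _"])
qed

text \<open>The factor \<open>1 / (a! b!)\<close> of \<open>wedge\<close> cancels exactly what
  \<open>alt_alt_both\<close> produces when the two inner alternations are absorbed by the outer
  one. Identities between products can then be read off from the concatenated
  representatives.\<close>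

lemma wedge_hform:
  assumes "local_on a (P :: (nat \<Rightarrow> ('a::field_char_0)^'n::finite^'n) \<Rightarrow> 'a^'n^'n)"
  shows "hform a P \<and>\<^sub>w hform b Q = hform (a + b) (\<lambda>v. P v ** Q (shift a v))"
proof (rule mform_eqI)
  fix m v p q
  have lP: "local_on a (\<lambda>v. P v $ p $ r)" for r
    using assms unfolding local_on_def by metis
  \<comment> \<open>Both factors live in a single degree, so of all splittings of \<open>m\<close>
    only the one into \<open>a\<close> and \<open>b\<close> contributes.\<close>
  have z: "(\<Sum>r\<in>UNIV. alt m (\<lambda>v. hform a P c v $ p $ r * hform b Q (m - c) (shift c v) $ r $ q) v) = 0"
    if "c \<noteq> a \<or> m - c \<noteq> b" for c
    by (cases "c = a") (use that in \<open>auto simp: hform_nth\<close>)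
  show "(hform a P \<and>\<^sub>w hform b Q) m v $ p $ q = hform (a + b) (\<lambda>v. P v ** Q (shift a v)) m v $ p $ q"
  proof (cases "m = a + b")
    case False
    then have "(hform a P \<and>\<^sub>w hform b Q) m v $ p $ q = 0"
      unfolding wedge_nth by (intro sum.neutral ballI, subst z) auto
    then show ?thesis using False by (simp add: hform_nth)
  next
    case True
    have "(hform a P \<and>\<^sub>w hform b Q) m v $ p $ q = 1 / of_nat (fact a * fact (m - a)) *
     (\<Sum>r\<in>UNIV. alt m (\<lambda>v. hform a P a v $ p $ r * hform b Q (m - a) (shift a v) $ r $ q) v)"
      unfolding wedge_nth
      by (subst sum.remove[of _ a]) (use True z in \<open>auto intro!: sum.neutral\<close>)
    also have "\<dots> = 1 / of_nat (fact a * fact b) *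
     (\<Sum>r\<in>UNIV. alt (a + b) (\<lambda>v. alt a (\<lambda>v. P v $ p $ r) v * alt b (\<lambda>v. Q v $ r $ q) (shift a v)) v)"
      using True by (simp add: hform_nth)
    also have "\<dots> = (\<Sum>r\<in>UNIV. alt (a + b) (\<lambda>v. P v $ p $ r * Q (shift a v) $ r $ q) v)"
      by (simp add: alt_alt_both[OF lP] sum_distrib_left[symmetric])
    also have "\<dots> = alt (a + b) (\<lambda>v. (P v ** Q (shift a v)) $ p $ q) v"
      by (simp add: matrix_matrix_mult_def alt_sum)
    finally show ?thesis using True by (simp add: hform_nth)
  qed
qed

lemmas fun_apply = zero_fun_apply plus_fun_apply uminus_apply minus_apply

text \<open>As simplification rules, these would unfold sums of forms as soon as unification has eta-expanded them.\<close>

declare fun_apply [simp del]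

lemma fadd_eq: "fadd f g = f + g"
  by (simp add: fadd_def fun_eq_iff fun_apply)

lemma fzero_eq: "fzero = 0"
  by (simp add: fzero_def fun_eq_iff fun_apply)

lemma fscale_nth [simp]: "fscale c f k v $ p $ q = c * f k v $ p $ q"
  by (simp add: fscale_def)

lemma sum_fun_apply: "(\<Sum>x\<in>A. F x) y = (\<Sum>x\<in>A. F x y)" for F :: "'x \<Rightarrow> 'y \<Rightarrow> 'z::comm_monoid_add"
  by (induction A rule: infinite_finite_induct) (auto simp: fun_apply)

interpretation mf: vector_space "fscale :: 'a::field \<Rightarrow> ('a,'n::finite) mform \<Rightarrow> _"
  by unfold_locales (auto intro!: mform_eqI simp: algebra_simps fun_apply)

lemma wedge_add_left: "(f + g) \<and>\<^sub>w h = f \<and>\<^sub>w h + g \<and>\<^sub>w h"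
  by (rule mform_eqI) (simp add: fun_apply wedge_nth distrib_right alt_add sum.distrib distrib_left)

lemma wedge_add_right: "f \<and>\<^sub>w (g + h) = f \<and>\<^sub>w g + f \<and>\<^sub>w h"
  by (rule mform_eqI) (simp add: fun_apply wedge_nth distrib_left alt_add sum.distrib)

lemma wedge_scale_left: "fscale c f \<and>\<^sub>w h = fscale c (f \<and>\<^sub>w h)"
  by (rule mform_eqI) (simp add: wedge_nth mult.assoc alt_mult_const sum_distrib_left mult.left_commute)

lemma wedge_scale_right: "f \<and>\<^sub>w fscale c h = fscale c (f \<and>\<^sub>w h)"
  by (rule mform_eqI)
    (simp add: wedge_nth mult.left_commute[of _ c] alt_mult_const sum_distrib_left)

lemma wedge_zero_left [simp]: "0 \<and>\<^sub>w h = 0"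
  using wedge_scale_left[of 0 0 h] by simp

lemma wedge_zero_right [simp]: "h \<and>\<^sub>w 0 = 0"
  using wedge_scale_right[of h 0 0] by simp

lemma wedge_minus_left: "(- f) \<and>\<^sub>w h = - (f \<and>\<^sub>w h)"
  using wedge_scale_left[of "-1" f h] by simp

lemma wedge_sum_left: "(\<Sum>x\<in>A. f x) \<and>\<^sub>w h = (\<Sum>x\<in>A. f x \<and>\<^sub>w h)" for f :: "'x \<Rightarrow> ('a::field,'n::finite) mform"
  by (induction A rule: infinite_finite_induct) (simp_all add: wedge_add_left)

lemma wedge_sum_right: "h \<and>\<^sub>w (\<Sum>x\<in>A. f x) = (\<Sum>x\<in>A. h \<and>\<^sub>w f x)" for f :: "'x \<Rightarrow> ('a::field,'n::finite) mform"
  by (induction A rule: infinite_finite_induct) (simp_all add: wedge_add_right)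

text \<open>A form in one degree with a representative that reads only the first \<open>d\<close>
  slots, which is what associativity and the sign rules refer to. Multilinearity and equivariance
  enter later with \<open>inv_form\<close>.\<close>

definition hom_form :: "nat \<Rightarrow> ('a::field,'n::finite) mform \<Rightarrow> bool" where
  "hom_form d f \<longleftrightarrow> (\<exists>P. local_on d P \<and> f = hform d P)"

lemma hom_formI: "local_on d P \<Longrightarrow> hom_form d (hform d P)"
  by (auto simp: hom_form_def)

lemma local_on_tensor:
  assumes "local_on a P" "local_on b Q"
  shows "local_on (a + b) (\<lambda>v. F (P v) (Q (shift a v)))"
  unfolding local_on_def
proof (intro allI impI)
  fix v v' :: "nat \<Rightarrow> 'a" assume v: "\<forall>i<a + b. v i = v' i"
  have "P v = P v'" using assms(1) v by (simp add: local_on_def)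
  moreover have "Q (shift a v) = Q (shift a v')"
    using assms(2) v by (simp add: local_on_def shift_apply)
  ultimately show "F (P v) (Q (shift a v)) = F (P v') (Q (shift a v'))" by simp
qed

lemma hom_form_wedge:
  assumes "hom_form a f" "hom_form b (g :: ('a::field_char_0,'n::finite) mform)"
  shows "hom_form (a + b) (f \<and>\<^sub>w g)"
proof -
  obtain P Q where PQ: "local_on a P" "f = hform a P" "local_on b Q" "g = hform b Q"
    using assms by (auto simp: hom_form_def)
  then show ?thesis
    unfolding hom_form_def using local_on_tensor[OF PQ(1,3), of "(**)"] wedge_hform[OF PQ(1), of b Q] by blast
qed

text \<open>Both sides alternate the product of the three representatives placed on consecutive
  blocks of slots.\<close>

lemma wedge_assoc:
  assumes "hom_form a f" "hom_form b g" "hom_form c (h :: ('a::field_char_0,'n::finite) mform)"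
  shows "(f \<and>\<^sub>w g) \<and>\<^sub>w h = f \<and>\<^sub>w (g \<and>\<^sub>w h)"
proof -
  obtain P Q R where PQ: "local_on a P" "f = hform a P" "local_on b Q" "g = hform b Q" "h = hform c R"
    using assms by (auto simp: hom_form_def)
  then show ?thesis
    using local_on_tensor[OF PQ(1,3), of "(**)"]
    by (simp add: wedge_hform matrix_mul_assoc add.assoc add.commute[of b a])
qed

section \<open>Words in the slots, powers of X and trace forms\<close>

definition wd :: "nat list \<Rightarrow> (nat \<Rightarrow> ('a::comm_ring_1)^'n::finite^'n) \<Rightarrow> 'a^'n^'n" where
  "wd l v = foldr (\<lambda>i acc. v i ** acc) l (mat 1)"

lemma wd_Nil [simp]: "wd [] v = mat 1"
  by (simp add: wd_def)

lemma wd_Cons [simp]: "wd (i # l) v = v i ** wd l v"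
  by (simp add: wd_def)

lemma wd_append [simp]: "wd (l @ l') v = wd l v ** wd l' v"
  by (induction l) (auto simp: matrix_mul_assoc)

lemma wd_map: "wd (map \<pi> l) v = wd l (v \<circ> \<pi>)"
  by (induction l) auto

lemma wd_cong: "(\<And>i. i \<in> set l \<Longrightarrow> v i = v' i) \<Longrightarrow> wd l v = wd l v'"
  by (induction l) auto

lemma wd_shift: "wd [a..<a+b] v = wd [0..<b] (shift a v)"
proof -
  have "[a..<a+b] = map (\<lambda>i. i + a) [0..<b]"
    by (simp add: map_add_upt add.commute)
  then show ?thesis by (simp only: wd_map) (simp add: shift_def o_def)
qed

lemma local_on_wd: "set l \<subseteq> {..<k} \<Longrightarrow> local_on k (wd l)"
  by (auto simp: local_on_def intro!: wd_cong)

lemma fone_hform: "fone = hform 0 (\<lambda>v. mat 1)"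
  by (rule mform_eqI) (simp add: fone_def hform_nth alt_0)

lemma Xf_hform: "Xf = hform 1 (\<lambda>v. v 0)"
  by (rule mform_eqI) (simp add: Xf_def hform_nth alt_1)

lemma fpow_Suc: "fpow f (Suc k) = f \<and>\<^sub>w fpow f k"
  by (simp add: fpow_def)

lemma fpow_0: "fpow f 0 = fone"
  by (simp add: fpow_def)

text \<open>Each multiplication by X prepends one slot to the word, so the power is the alternation
  of a single monomial, the standard polynomial.\<close>

lemma fpow_Xf: "fpow Xf k = (hform k (wd [0..<k]) :: ('a::field_char_0,'n::finite) mform)"
proof (induction k)
  case 0
  show ?case by (simp add: fpow_0 fone_hform)
next
  case (Suc k)
  have l: "local_on 1 (\<lambda>v :: nat \<Rightarrow> 'a^'n^'n. v 0)" by (simp add: local_on_def)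
  have "wd [0..<Suc k] v = v 0 ** wd [0..<k] (shift 1 v)" for v :: "nat \<Rightarrow> 'a^'n^'n"
    using wd_shift[of 1 k v] by (simp add: upt_conv_Cons del: upt_Suc)
  then have w: "wd [0..<Suc k] = (\<lambda>v :: nat \<Rightarrow> 'a^'n^'n. v 0 ** wd [0..<k] (shift 1 v))"
    by (rule ext)
  show ?case
    unfolding fpow_Suc Suc w by (subst Xf_hform, subst wedge_hform[OF l]) simp
qed

lemma hom_form_fone: "hom_form 0 fone"
  unfolding fone_hform by (rule hom_formI) (simp add: local_on_def)

lemma hom_form_pow: "hom_form k (fpow Xf k :: ('a::field_char_0,'n::finite) mform)"
  unfolding fpow_Xf by (rule hom_formI, rule local_on_wd) auto

lemma wedge_fone_left:
  assumes "hom_form d (f :: ('a::field_char_0,'n::finite) mform)"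
  shows "fone \<and>\<^sub>w f = f"
  using assms by (auto simp: hom_form_def fone_hform wedge_hform local_on_def)

lemma wedge_fone_right:
  assumes "hom_form d (f :: ('a::field_char_0,'n::finite) mform)"
  shows "f \<and>\<^sub>w fone = f"
  using assms by (auto simp: hom_form_def fone_hform wedge_hform)

lemma fpow_add: "fpow Xf (a + b) = (fpow Xf a \<and>\<^sub>w fpow Xf b :: ('a::field_char_0,'n::finite) mform)"
proof -
  have l: "local_on a (wd [0..<a] :: _ \<Rightarrow> 'a^'n^'n)" by (rule local_on_wd) auto
  have "wd [0..<a+b] v = wd [0..<a] v ** wd [0..<b] (shift a v)" for v :: "nat \<Rightarrow> 'a^'n^'n"
    by (simp add: upt_add_eq_append[of 0 a b, simplified] wd_shift[symmetric])
  then have w: "wd [0..<a+b] = (\<lambda>v :: nat \<Rightarrow> 'a^'n^'n. wd [0..<a] v ** wd [0..<b] (shift a v))"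
    by (rule ext)
  show ?thesis
    unfolding fpow_Xf w wedge_hform[OF l] by simp
qed

lemma mtrace_mat_scale: "mtrace (mat c ** A) = c * mtrace A"
  by (simp add: mtrace_def sum_distrib_left)

lemma mtrace_add: "mtrace (A + B) = mtrace A + mtrace B"
  by (simp add: mtrace_def sum.distrib)

lemma mtrace_mult_commute: "mtrace (A ** B) = mtrace (B ** A)"
proof -
  have "mtrace (A ** B) = (\<Sum>i\<in>UNIV. \<Sum>j\<in>UNIV. A $ i $ j * B $ j $ i)"
    by (simp add: mtrace_def matrix_matrix_mult_def)
  also have "\<dots> = (\<Sum>j\<in>UNIV. \<Sum>i\<in>UNIV. B $ j $ i * A $ i $ j)"
    by (subst sum.swap) (simp only: mult.commute)
  also have "\<dots> = mtrace (B ** A)"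
    by (simp add: mtrace_def matrix_matrix_mult_def)
  finally show ?thesis .
qed

lemma stdpoly_nth: "stdpoly k v $ p $ q = alt k (\<lambda>v. wd [0..<k] v $ p $ q) v"
  unfolding stdpoly_def alt_def sum_component mat_scale_nth wd_def o_def ..

definition trw :: "nat \<Rightarrow> (nat \<Rightarrow> ('a::field)^'n::finite^'n) \<Rightarrow> 'a" where
  "trw k v = mtrace (wd [0..<k] v)"

lemma local_on_comp: "local_on k P \<Longrightarrow> local_on k (\<lambda>v. F (P v))"
  unfolding local_on_def by metis

lemma local_on_trw: "local_on k (trw k)"
proof -
  have "trw k = (\<lambda>v :: nat \<Rightarrow> 'a^'b^'b. mtrace (wd [0..<k] v))"
    by (rule ext) (rule trw_def)
  then show ?thesis by (simp only:) (rule local_on_comp[OF local_on_wd], auto)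
qed

definition sform :: "nat \<Rightarrow> ((nat \<Rightarrow> ('a::field)^'n::finite^'n) \<Rightarrow> 'a) \<Rightarrow> ('a,'n) mform" where
  "sform d s = hform d (\<lambda>v. mat (s v))"

lemma sform_nth: "sform d s k v $ p $ q = (if k = d \<and> p = q then alt d s v else 0)"
  by (auto simp: sform_def hform_nth mat_def)

lemma Tf_sform: "Tf h = sform (2 * h + 1) (trw (2 * h + 1))"
proof -
  have "mtrace (stdpoly k v) = alt k (trw k) v" for k and v :: "nat \<Rightarrow> 'a^'b^'b"
    unfolding mtrace_def stdpoly_nth trw_def alt_sum by simp
  then show ?thesis
    by (intro mform_eqI) (auto simp: Tf_def sform_nth mat_def)
qed

lemma hom_form_sform: "local_on d s \<Longrightarrow> hom_form d (sform d s)"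
  unfolding sform_def by (rule hom_formI) (erule local_on_comp)

lemma hom_form_Tf: "hom_form (2 * h + 1) (Tf h)"
  unfolding Tf_sform by (rule hom_form_sform[OF local_on_trw])

lemma mat_mult_mat: "mat a ** mat b = (mat (a * b) :: ('a::comm_ring_1)^'n::finite^'n)"
  by (simp add: vec_eq_iff) (simp add: mat_def)

section \<open>Signs of rearranged lists of slots\<close>

definition lperm :: "nat list \<Rightarrow> nat \<Rightarrow> nat" where
  "lperm l i = (if i < length l then l ! i else i)"

definition lsgn :: "nat list \<Rightarrow> int" where
  "lsgn l = sign (lperm l)"

definition perm_list :: "nat list \<Rightarrow> bool" where
  "perm_list l \<longleftrightarrow> distinct l \<and> set l = {..<length l}"

lemma perm_list_upt: "perm_list [0..<m]"
  by (simp add: perm_list_def atLeast0LessThan)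

lemma perm_list_permute: "perm_list l \<Longrightarrow> mset l' = mset l \<Longrightarrow> perm_list l'"
  unfolding perm_list_def by (metis mset_eq_imp_distinct_iff mset_eq_length mset_eq_setD)

lemma lperm_permutes: "perm_list l \<Longrightarrow> lperm l permutes {..<length l}"
proof -
  assume l: "perm_list l"
  have "bij_betw ((!) l) {..<length l} {..<length l}"
    by (rule bij_betw_nth) (use l in \<open>simp_all add: perm_list_def\<close>)
  then have "bij_betw (lperm l) {..<length l} {..<length l}"
    by (rule bij_betw_cong[THEN iffD1, rotated]) (simp add: lperm_def)
  then show ?thesis by (rule bij_imp_permutes) (simp add: lperm_def)
qed

lemma lsgn_upt [simp]: "lsgn [0..<m] = 1"
proof -
  have "lperm [0..<m] = id" by (auto simp: lperm_def fun_eq_iff)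
  then show ?thesis by (simp add: lsgn_def)
qed

text \<open>A list is the one-line notation of a permutation, and reading the matrices in the order
  \<open>l\<close> is composition with it. Writing an expression as a function \<Psi> of the list of
  matrices that it reads thus reduces every reordering of factors to the sign of a list.\<close>

lemma alt_perm_list:
  fixes \<Psi> :: "'b list \<Rightarrow> 'a::comm_ring_1"
  assumes "perm_list l" "length l = m"
  shows "alt m (\<lambda>v. \<Psi> (map v l)) v = of_int (lsgn l) * alt m (\<lambda>v. \<Psi> (map v [0..<m])) v"
proof -
  have p: "lperm l permutes {..<m}" using lperm_permutes[OF assms(1)] assms(2) by simp
  have mp: "map w l = map (w \<circ> lperm l) [0..<m]" for w :: "nat \<Rightarrow> 'b"
    by (rule nth_equalityI) (simp_all add: assms(2) lperm_def)
  show ?thesis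
    unfolding mp lsgn_def by (rule alt_comp_perm[OF p, of "\<lambda>v. \<Psi> (map v [0..<m])"])
qed

lemma lsgn_swap_adjacent:
  assumes "perm_list (l @ a # b # r)"
  shows "lsgn (l @ b # a # r) = - lsgn (l @ a # b # r)"
proof -
  let ?t = "Transposition.transpose a b"
  have ab: "a \<noteq> b" "distinct (l @ a # b # r)" using assms by (auto simp: perm_list_def)
  \<comment> \<open>Exchanging two neighbouring positions is the same as exchanging the two values,
    and the latter is composition with a transposition on the left.\<close>
  have "map ?t (l @ a # b # r) = l @ b # a # r"
    using ab by (auto simp: Transposition.transpose_def intro!: map_idI)
  then have "lperm (l @ b # a # r) = lperm (map ?t (l @ a # b # r))" by (simp only:)
  also have "\<dots> = ?t \<circ> lperm (l @ a # b # r)"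
  proof
    fix i
    have "a \<in> set (l @ a # b # r)" "b \<in> set (l @ a # b # r)" by simp_all
    then have "a < length (l @ a # b # r)" "b < length (l @ a # b # r)"
      using assms unfolding perm_list_def by blast+
    then show "lperm (map ?t (l @ a # b # r)) i = (?t \<circ> lperm (l @ a # b # r)) i"
      by (cases "i < length (l @ a # b # r)")
        (simp_all only: lperm_def length_map nth_map o_def if_True if_False, metis transpose_apply_other)
  qed
  finally have "lperm (l @ b # a # r) = ?t \<circ> lperm (l @ a # b # r)" .
  moreover have "permutation (lperm (l @ a # b # r))"
    using lperm_permutes[OF assms] permutation_permutes by blast
  ultimately show ?thesis
    using ab by (simp add: lsgn_def sign_compose permutation_swap_id sign_swap_id)
qed

lemma lsgn_move_one:
  assumes "perm_list (l @ a # ys @ r)"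
  shows "lsgn (l @ ys @ a # r) = (-1) ^ length ys * lsgn (l @ a # ys @ r)"
  using assms
proof (induction ys arbitrary: l)
  case (Cons y ys)
  have "lsgn (l @ y # a # (ys @ r)) = - lsgn (l @ a # y # (ys @ r))"
    by (rule lsgn_swap_adjacent) (use Cons.prems in auto)
  moreover have "perm_list ((l @ [y]) @ a # ys @ r)"
    using Cons.prems by (rule perm_list_permute) simp
  then have "lsgn ((l @ [y]) @ ys @ a # r) = (-1) ^ length ys * lsgn ((l @ [y]) @ a # ys @ r)"
    by (rule Cons.IH)
  ultimately show ?case by simp
qed simp

lemma lsgn_move_block:
  assumes "perm_list (l @ xs @ ys @ r)"
  shows "lsgn (l @ ys @ xs @ r) = (-1) ^ (length xs * length ys) * lsgn (l @ xs @ ys @ r)"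
  using assms
proof (induction xs arbitrary: l)
  case (Cons x xs)
  have "lsgn ((l @ [x]) @ ys @ xs @ r) = (-1) ^ (length xs * length ys) * lsgn ((l @ [x]) @ xs @ ys @ r)"
    by (rule Cons.IH) (use Cons.prems in auto)
  moreover have "perm_list (l @ x # ys @ (xs @ r))"
    using Cons.prems by (rule perm_list_permute) simp
  then have "lsgn (l @ ys @ x # (xs @ r)) = (-1) ^ length ys * lsgn (l @ x # ys @ (xs @ r))"
    by (rule lsgn_move_one)
  ultimately show ?case by (simp add: power_add mult_ac)
qed simp

text \<open>Exchanging adjacent blocks of lengths \<open>a\<close> and \<open>b\<close> takes
  \<open>a * b\<close> transpositions of neighbours. This is the graded commutativity of scalar
  forms.\<close>

lemma alt_block_commute:
  assumes "local_on a P" "local_on b Q"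
  shows "alt (a + b) (\<lambda>v. P v * Q (shift a v)) v = (-1) ^ (a * b) * alt (a + b) (\<lambda>v. Q v * P (shift b v)) v"
proof -
  \<comment> \<open>Both factors become functions of the list of matrices they read. By locality the
    value of \<open>!\<close> beyond the end of the list never enters.\<close>
  let ?\<Psi> = "\<lambda>L. P (\<lambda>i. L ! i) * Q (\<lambda>i. L ! (i + a))"
  let ?l = "[b..<a+b] @ [0..<b]"
  have up: "[0..<b] @ [b..<a+b] = [0..<a+b]"
    using upt_add_eq_append[of 0 b a] by (simp add: add.commute)
  have std: "P (\<lambda>i. map v [0..<a+b] ! i) = P v" "Q (\<lambda>i. map v [0..<a+b] ! (i + a)) = Q (shift a v)" for v
    using assms by (auto simp: local_on_def shift_def)
  have swapped: "P (\<lambda>i. map v ?l ! i) = P (shift b v)" "Q (\<lambda>i. map v ?l ! (i + a)) = Q v" for v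
    using assms by (auto simp: local_on_def shift_def nth_append add.commute)
  have p: "perm_list ([] @ [0..<b] @ [b..<a+b] @ [])"
    using perm_list_upt[of "a + b"] up by simp
  then have "perm_list ?l" by (rule perm_list_permute) simp
  moreover have "lsgn ?l = (-1) ^ (a * b)"
    using lsgn_move_block[OF p] up by (simp add: mult.commute)
  ultimately have "alt (a + b) (\<lambda>v. ?\<Psi> (map v ?l)) v = (-1) ^ (a * b) * alt (a + b) (\<lambda>v. ?\<Psi> (map v [0..<a+b])) v"
    using alt_perm_list[of ?l "a + b" ?\<Psi> v] by simp
  then have "alt (a + b) (\<lambda>v. Q v * P (shift b v)) v = (-1) ^ (a * b) * alt (a + b) (\<lambda>v. P v * Q (shift a v)) v"
    unfolding std swapped by (simp add: mult.commute)
  then show ?thesis by (simp add: mult.assoc[symmetric] power_add[symmetric])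
qed

text \<open>Scalar matrices commute with every value of \<open>f\<close>, so only the sign of the
  exchange of blocks is left.\<close>

lemma sform_commute:
  assumes s: "local_on a (s :: (nat \<Rightarrow> ('a::field_char_0)^'n::finite^'n) \<Rightarrow> 'a)" and f: "hom_form b f"
  shows "sform a s \<and>\<^sub>w f = fscale ((-1) ^ (a * b)) (f \<and>\<^sub>w sform a s)"
proof -
  obtain Q where Q: "local_on b Q" "f = hform b Q" using f by (auto simp: hom_form_def)
  show ?thesis
  proof (rule mform_eqI)
    fix k v p q
    have Qpq: "local_on b (\<lambda>v. Q v $ p $ q)" using Q(1) unfolding local_on_def by metis
    have r: "(M ** mat c) $ p $ q = M $ p $ q * c" for M :: "'a^'n^'n" and c
      by (simp add: matrix_matrix_mult_def mat_def if_distrib cong: if_cong)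
    show "(sform a s \<and>\<^sub>w f) k v $ p $ q = fscale ((-1) ^ (a * b)) (f \<and>\<^sub>w sform a s) k v $ p $ q"
      unfolding sform_def Q(2) wedge_hform[OF Q(1)] wedge_hform[OF local_on_comp[OF s]]
      using alt_block_commute[OF s Qpq, of v]
      by (simp add: hform_nth r add.commute)
  qed
qed

section \<open>Products of the trace forms\<close>

lemma Tf_commute:
  assumes "hom_form b (f :: ('a::field_char_0,'n::finite) mform)"
  shows "Tf h \<and>\<^sub>w f = fscale ((-1) ^ b) (f \<and>\<^sub>w Tf h)"
  unfolding Tf_sform sform_commute[OF local_on_trw assms]
  by (simp add: power_add power_mult)

lemma Tf_anticommute: "Tf h \<and>\<^sub>w Tf h' = - (Tf h' \<and>\<^sub>w Tf h :: ('a::field_char_0,'n::finite) mform)"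
  using Tf_commute[OF hom_form_Tf, of h h'] by (simp add: power_add power_mult)

lemma mform_eq_neg_self: "f = - f \<Longrightarrow> f = (0 :: ('a::field_char_0,'n::finite) mform)"
proof (rule mform_eqI)
  fix k v p q assume "f = - f"
  then have "f k v $ p $ q = (- f) k v $ p $ q"
    by (rule arg_cong[where f = "\<lambda>h. h k v $ p $ q"])
  then have "2 * f k v $ p $ q = 0"
    by (simp only: fun_apply vector_uminus_component eq_neg_iff_add_eq_0 mult_2)
  then show "f k v $ p $ q = (0 :: ('a,'n) mform) k v $ p $ q" by (simp add: fun_apply)
qed

lemma Tf_square: "Tf h \<and>\<^sub>w Tf h = (0 :: ('a::field_char_0,'n::finite) mform)"
  using Tf_anticommute mform_eq_neg_self by blast

lemma Tprod_empty: "Tprod {} = fone"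
  by (simp add: Tprod_def)

text \<open>\<open>Tprod\<close> multiplies in increasing order, so a new smallest index becomes the
  leftmost factor. This is why the inductions over index sets add minima.\<close>

lemma Tprod_insert_min:
  assumes "finite S" "\<And>s. s \<in> S \<Longrightarrow> m < s"
  shows "Tprod (insert m S) = Tf m \<and>\<^sub>w Tprod S"
proof -
  have "Min (insert m S) = m"
    by (rule Min_eqI) (use assms in \<open>auto dest: less_imp_le\<close>)
  moreover have "insert m S - {m} = S" using assms by auto
  ultimately have "sorted_list_of_set (insert m S) = m # sorted_list_of_set S"
    using sorted_list_of_set_nonempty[of "insert m S"] assms(1) by simp
  then show ?thesis by (simp add: Tprod_def)
qed

lemma hom_form_Tprod:
  "finite S \<Longrightarrow> hom_form (\<Sum>h\<in>S. 2 * h + 1) (Tprod S :: ('a::field_char_0,'n::finite) mform)"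
proof (induction S rule: finite_linorder_min_induct)
  case empty
  then show ?case by (simp add: Tprod_empty hom_form_fone)
next
  case (insert b A)
  then have "b \<notin> A" by auto
  then show ?case
    using hom_form_wedge[OF hom_form_Tf[of b] insert.IH] insert
    by (simp add: Tprod_insert_min)
qed

text \<open>The new factor has to pass every \<open>T_s\<close> with \<open>s < h\<close> to reach
  its place, with one sign for each. If \<open>h\<close> occurs already, the square of
  \<open>T_h\<close> appears.\<close>

lemma Tf_wedge_Tprod:
  assumes "finite S"
  shows "Tf h \<and>\<^sub>w Tprod S = (if h \<in> S then 0 else
    fscale ((-1) ^ card {s\<in>S. s < h}) (Tprod (insert h S)) :: ('a::field_char_0,'n::finite) mform)"
  using assms
proof (induction S rule: finite_linorder_min_induct)
  case empty
  have "Tprod {h} = (Tf h \<and>\<^sub>w Tprod {} :: ('a,'n) mform)" by (rule Tprod_insert_min) auto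
  then show ?case by simp
next
  case (insert b A)
  have T: "Tprod (insert b A) = (Tf b \<and>\<^sub>w Tprod A :: ('a,'n) mform)"
    by (rule Tprod_insert_min) (use insert in auto)
  have bA: "b \<notin> A" using insert by auto
  have as: "Tf x \<and>\<^sub>w (Tf y \<and>\<^sub>w Tprod A) = ((Tf x \<and>\<^sub>w Tf y) \<and>\<^sub>w Tprod A :: ('a,'n) mform)" for x y
    by (rule wedge_assoc[symmetric, OF hom_form_Tf hom_form_Tf hom_form_Tprod]) (use insert in auto)
  consider "h < b" | "h = b" | "b < h" by linarith
  then show ?case
  proof cases
    case 1
    then have "{s \<in> insert b A. s < h} = {}" "h \<notin> insert b A" using insert by (auto dest: less_trans)
    moreover have "Tprod (insert h (insert b A)) = (Tf h \<and>\<^sub>w Tprod (insert b A) :: ('a,'n) mform)"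
      by (rule Tprod_insert_min) (use insert 1 in \<open>auto dest: less_trans\<close>)
    ultimately show ?thesis by (simp only: card.empty power_0 mf.scale_one if_False)
  next
    case 2
    then show ?thesis by (simp add: T as Tf_square)
  next
    case 3
    have *: "Tf h \<and>\<^sub>w Tprod (insert b A) = - (Tf b \<and>\<^sub>w (Tf h \<and>\<^sub>w Tprod A) :: ('a,'n) mform)"
      unfolding T as Tf_anticommute[of h b] wedge_minus_left ..
    show ?thesis
    proof (cases "h \<in> A")
      case True
      then show ?thesis unfolding * insert.IH by simp
    next
      case False
      have "{s \<in> insert b A. s < h} = insert b {s \<in> A. s < h}" using 3 by auto
      then have c: "card {s \<in> insert b A. s < h} = Suc (card {s \<in> A. s < h})"
        using bA insert by simp
      have "Tprod (insert b (insert h A)) = (Tf b \<and>\<^sub>w Tprod (insert h A) :: ('a,'n) mform)"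
        by (rule Tprod_insert_min) (use insert 3 in auto)
      then show ?thesis unfolding * insert.IH using False 3 c
        by (simp add: wedge_scale_right insert_commute[of b h])
    qed
  qed
qed

lemma Tprod_wedge_Tprod:
  assumes "finite S" "finite R"
  shows "Tprod S \<and>\<^sub>w Tprod R = (if S \<inter> R \<noteq> {} then 0 else
    fscale ((-1) ^ card {(s,r). s \<in> S \<and> r \<in> R \<and> r < s}) (Tprod (S \<union> R)) :: ('a::field_char_0,'n::finite) mform)"
  using assms
proof (induction S rule: finite_linorder_min_induct)
  case empty
  then show ?case by (simp add: Tprod_empty wedge_fone_left[OF hom_form_Tprod])
next
  case (insert b A)
  have bA: "b \<notin> A" using insert by auto
  have T: "Tprod (insert b A) = (Tf b \<and>\<^sub>w Tprod A :: ('a,'n) mform)"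
    by (rule Tprod_insert_min) (use insert in auto)
  have *: "Tprod (insert b A) \<and>\<^sub>w Tprod R = (Tf b \<and>\<^sub>w (Tprod A \<and>\<^sub>w Tprod R) :: ('a,'n) mform)"
    unfolding T by (rule wedge_assoc[OF hom_form_Tf hom_form_Tprod hom_form_Tprod]) (use insert in auto)
  show ?case
  proof (cases "A \<inter> R = {}")
    case False
    then show ?thesis unfolding * using insert.IH insert.prems by auto
  next
    case AR: True
    show ?thesis
    proof (cases "b \<in> R")
      case True
      then show ?thesis unfolding * using insert AR
        by (simp add: wedge_scale_right Tf_wedge_Tprod)
    next
      case False
      have s: "{s \<in> A \<union> R. s < b} = {r \<in> R. r < b}" using insert by auto
      \<comment> \<open>The new inversions are the pairs starting with \<open>b\<close>. Since
        \<open>b\<close> lies below all of \<open>A\<close>, there are as many of them as elements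
        of \<open>A \<union> R\<close> below \<open>b\<close>, which is the exponent in
        \<open>Tf_wedge_Tprod\<close>.\<close>
      have "{(s,r). s \<in> insert b A \<and> r \<in> R \<and> r < s} = Pair b ` {r \<in> R. r < b} \<union> {(s,r). s \<in> A \<and> r \<in> R \<and> r < s}"
        by auto
      moreover have "finite {(s,r). s \<in> A \<and> r \<in> R \<and> r < s}"
        by (rule finite_subset[of _ "A \<times> R"]) (use insert in auto)
      moreover have "card (Pair b ` {r \<in> R. r < b}) = card {r \<in> R. r < b}"
        by (rule card_image) (auto simp: inj_on_def)
      ultimately have "card {(s,r). s \<in> insert b A \<and> r \<in> R \<and> r < s} = card {r \<in> R. r < b} + card {(s,r). s \<in> A \<and> r \<in> R \<and> r < s}"
        using bA insert by (simp, subst card_Un_disjoint) auto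
      then have c: "(-1 :: 'a) ^ card {(s,r). s \<in> insert b A \<and> r \<in> R \<and> r < s}
          = (-1) ^ card {(s,r). s \<in> A \<and> r \<in> R \<and> r < s} * (-1) ^ card {s \<in> A \<union> R. s < b}"
        by (simp only: s power_add mult.commute)
      have "Tf b \<and>\<^sub>w Tprod (A \<union> R) = (fscale ((-1) ^ card {s \<in> A \<union> R. s < b}) (Tprod (insert b (A \<union> R))) :: ('a,'n) mform)"
        using Tf_wedge_Tprod[of "A \<union> R" b, where 'a='a and 'n='n] insert AR False bA by auto
      then show ?thesis unfolding * c using insert AR False bA
        by (simp add: wedge_scale_right del: Un_iff)
    qed
  qed
qed

lemma pow_wedge_Tf: "fpow Xf k \<and>\<^sub>w Tf h = fscale ((-1) ^ k) (Tf h \<and>\<^sub>w fpow Xf k :: ('a::field_char_0,'n::finite) mform)"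
  unfolding Tf_commute[OF hom_form_pow, of h k] by (simp add: power_mult_distrib[symmetric])

lemma pow_wedge_Tprod:
  assumes "finite R"
  shows "fpow Xf k \<and>\<^sub>w Tprod R = fscale ((-1) ^ (k * card R)) (Tprod R \<and>\<^sub>w fpow Xf k :: ('a::field_char_0,'n::finite) mform)"
  using assms
proof (induction R rule: finite_linorder_min_induct)
  case empty
  then show ?case by (simp add: Tprod_empty wedge_fone_left[OF hom_form_pow] wedge_fone_right[OF hom_form_pow])
next
  case (insert b A)
  have bA: "b \<notin> A" using insert by auto
  have T: "Tprod (insert b A) = (Tf b \<and>\<^sub>w Tprod A :: ('a,'n) mform)"
    by (rule Tprod_insert_min) (use insert in auto)
  note h = hom_form_Tf hom_form_Tprod hom_form_pow
  have "fpow Xf k \<and>\<^sub>w Tprod (insert b A) = ((fpow Xf k \<and>\<^sub>w Tf b) \<and>\<^sub>w Tprod A :: ('a,'n) mform)"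
    unfolding T by (rule wedge_assoc[symmetric, OF h(3,1,2)]) (use insert in auto)
  also have "\<dots> = fscale ((-1) ^ k) (Tf b \<and>\<^sub>w (fpow Xf k \<and>\<^sub>w Tprod A))"
    unfolding pow_wedge_Tf wedge_scale_left by (subst wedge_assoc[OF h(1,3,2)]) (use insert in auto)
  also have "\<dots> = fscale ((-1) ^ k * (-1) ^ (k * card A)) (Tf b \<and>\<^sub>w (Tprod A \<and>\<^sub>w fpow Xf k))"
    unfolding insert.IH wedge_scale_right by simp
  also have "Tf b \<and>\<^sub>w (Tprod A \<and>\<^sub>w fpow Xf k) = (Tprod (insert b A) \<and>\<^sub>w fpow Xf k :: ('a,'n) mform)"
    unfolding T by (rule wedge_assoc[symmetric, OF h(1,2,3)]) (use insert in auto)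
  finally show ?case using bA insert by (simp add: power_add)
qed

definition TX :: "nat set \<Rightarrow> nat \<Rightarrow> ('a::field,'n::finite) mform" where
  "TX S k = Tprod S \<and>\<^sub>w fpow Xf k"

lemma hom_form_TX: "finite S \<Longrightarrow> hom_form (tdeg S k) (TX S k :: ('a::field_char_0,'n::finite) mform)"
  unfolding TX_def tdeg_def by (intro hom_form_wedge hom_form_Tprod hom_form_pow)

text \<open>Moving \<open>X^k\<close> past \<open>T_R\<close> costs \<open>k * card R\<close> signs,
  and sorting \<open>T_S T_R\<close> one sign per inversion. Together this is the exponent of
  \<open>tsign\<close>, so the forms obey the rule that defines \<open>ta_mult\<close>.\<close>

lemma TX_wedge_TX:
  assumes "finite S" "finite R"
  shows "TX S k \<and>\<^sub>w TX R l = (if S \<inter> R \<noteq> {} then 0 else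
    fscale (of_int (tsign S R k)) (TX (S \<union> R) (k + l)) :: ('a::field_char_0,'n::finite) mform)"
proof -
  note h = hom_form_Tprod hom_form_pow
  have "TX S k \<and>\<^sub>w TX R l = ((Tprod S \<and>\<^sub>w fpow Xf k) \<and>\<^sub>w Tprod R) \<and>\<^sub>w (fpow Xf l :: ('a,'n) mform)"
    unfolding TX_def
    by (rule wedge_assoc[symmetric, OF hom_form_wedge[OF h(1,2)] h(1,2)]) (use assms in auto)
  also have "(Tprod S \<and>\<^sub>w fpow Xf k) \<and>\<^sub>w Tprod R = (Tprod S \<and>\<^sub>w (fpow Xf k \<and>\<^sub>w Tprod R) :: ('a,'n) mform)"
    by (rule wedge_assoc[OF h(1,2,1)]) (use assms in auto)
  also have "\<dots> = fscale ((-1) ^ (k * card R)) (Tprod S \<and>\<^sub>w (Tprod R \<and>\<^sub>w fpow Xf k))"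
    unfolding pow_wedge_Tprod[OF assms(2)] wedge_scale_right ..
  also have "Tprod S \<and>\<^sub>w (Tprod R \<and>\<^sub>w fpow Xf k) = ((Tprod S \<and>\<^sub>w Tprod R) \<and>\<^sub>w fpow Xf k :: ('a,'n) mform)"
    by (rule wedge_assoc[symmetric, OF h(1,1,2)]) (use assms in auto)
  also have "fscale ((-1) ^ (k * card R)) ((Tprod S \<and>\<^sub>w Tprod R) \<and>\<^sub>w fpow Xf k) \<and>\<^sub>w (fpow Xf l :: ('a,'n) mform)
     = fscale ((-1) ^ (k * card R)) ((Tprod S \<and>\<^sub>w Tprod R) \<and>\<^sub>w fpow Xf (k + l))"
    unfolding wedge_scale_left
    by (subst wedge_assoc[OF hom_form_wedge[OF h(1,1)] h(2) h(2)]) (use assms in \<open>auto simp: fpow_add\<close>)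
  finally show ?thesis
    unfolding Tprod_wedge_Tprod[OF assms]
    by (simp add: TX_def tsign_def wedge_scale_left power_add)
qed

section \<open>Multilinear and equivariant forms\<close>

definition mlin :: "nat \<Rightarrow> ((nat \<Rightarrow> ('a::field)^'n::finite^'n) \<Rightarrow> 'a) \<Rightarrow> bool" where
  "mlin K P \<longleftrightarrow> (\<forall>i<K. \<forall>v x y c. P (v(i := mat c ** x + y)) = c * P (v(i := x)) + P (v(i := y)))"

definition munit :: "'n \<times> 'n \<Rightarrow> ('a::field)^'n::finite^'n" where
  "munit e = (\<chi> i j. if i = fst e \<and> j = snd e then 1 else 0)"

lemma mlin_zero:
  assumes "mlin K P" "i < K" shows "P (v(i := 0)) = 0"
proof -
  have "P (v(i := mat 1 ** 0 + 0)) = 1 * P (v(i := 0)) + P (v(i := 0))"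
    using assms unfolding mlin_def by blast
  then have "P (v(i := 0)) = P (v(i := 0)) + P (v(i := 0))" by (simp only: matrix_mul_lid add_0 mult_1)
  then show ?thesis by (metis add_cancel_right_right)
qed

lemma mlin_sum:
  assumes "mlin K P" "i < K" "finite S"
  shows "P (v(i := (\<Sum>s\<in>S. mat (c s) ** A s))) = (\<Sum>s\<in>S. c s * P (v(i := A s)))"
  using assms(3)
proof (induction S rule: finite_induct)
  case empty
  show ?case unfolding sum.empty by (rule mlin_zero[OF assms(1,2)])
next
  case (insert s S)
  have "P (v(i := mat (c s) ** A s + (\<Sum>s\<in>S. mat (c s) ** A s)))
    = c s * P (v(i := A s)) + P (v(i := (\<Sum>s\<in>S. mat (c s) ** A s)))"
    using assms unfolding mlin_def by blast
  then show ?case unfolding sum.insert[OF insert.hyps] insert.IH .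
qed

lemma matrix_unit_expansion: "x = (\<Sum>e\<in>UNIV. mat (x $ fst e $ snd e) ** munit e)"
proof -
  have "(\<Sum>e\<in>UNIV. mat (x $ fst e $ snd e) ** munit e) $ i $ j = x $ i $ j" for i j
  proof -
    have "(\<Sum>e\<in>UNIV. mat (x $ fst e $ snd e) ** munit e) $ i $ j
      = (\<Sum>e\<in>UNIV. if e = (i, j) then x $ i $ j else 0)"
      unfolding sum_component mat_scale_nth munit_def by (intro sum.cong) auto
    then show ?thesis by simp
  qed
  then show ?thesis by (simp add: vec_eq_iff)
qed

lemma sum_PiE_insert:
  assumes "a \<notin> A"
  shows "(\<Sum>e\<in>PiE (insert a A) B. g e) = (\<Sum>e\<in>PiE A B. \<Sum>y\<in>B a. g (e(a := y)))"
proof -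
  have inj: "inj_on (\<lambda>(y, e). e(a := y)) (B a \<times> PiE A B)"
  proof (rule inj_onI, clarify)
    fix y e y' e' assume e: "e \<in> PiE A B" "e' \<in> PiE A B" and eq: "e(a := y) = e'(a := y')"
    have "e x = e' x" for x
      using fun_cong[OF eq, of x] e assms by (cases "x = a") (auto simp: PiE_def extensional_def)
    then show "y = y' \<and> e = e'" using fun_cong[OF eq, of a] by auto
  qed
  have "(\<Sum>e\<in>PiE (insert a A) B. g e) = (\<Sum>(y, e)\<in>B a \<times> PiE A B. g (e(a := y)))"
    unfolding PiE_insert_eq by (subst sum.reindex[OF inj]) (simp add: case_prod_unfold)
  also have "\<dots> = (\<Sum>y\<in>B a. \<Sum>e\<in>PiE A B. g (e(a := y)))"
    by (simp add: sum.cartesian_product)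
  also have "\<dots> = (\<Sum>e\<in>PiE A B. \<Sum>y\<in>B a. g (e(a := y)))" by (rule sum.swap)
  finally show ?thesis .
qed

lemma mlin_expand_partial:
  fixes P :: "(nat \<Rightarrow> ('a::field)^'n::finite^'n) \<Rightarrow> 'a"
  assumes "mlin K P" "m \<le> K"
  shows "P v = (\<Sum>e\<in>{..<m} \<rightarrow>\<^sub>E UNIV. (\<Prod>l<m. v l $ fst (e l) $ snd (e l)) * P (\<lambda>l. if l < m then munit (e l) else v l))"
  using assms(2)
proof (induction m)
  case 0
  then show ?case by simp
next
  case (Suc m)
  have step: "P w = (\<Sum>y\<in>UNIV. w m $ fst y $ snd y * P (w(m := munit y)))" for w
  proof -
    have "P w = P (w(m := (\<Sum>e\<in>UNIV. mat (w m $ fst e $ snd e) ** munit e)))"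
      using matrix_unit_expansion[of "w m"] by simp
    also have "\<dots> = (\<Sum>y\<in>UNIV. w m $ fst y $ snd y * P (w(m := munit y)))"
      by (rule mlin_sum[OF assms(1)]) (use Suc.prems in auto)
    finally show ?thesis .
  qed
  let ?g = "\<lambda>e. (\<Prod>l<Suc m. v l $ fst (e l) $ snd (e l)) * P (\<lambda>l. if l < Suc m then munit (e l) else v l)"
  have "P v = (\<Sum>e\<in>{..<m} \<rightarrow>\<^sub>E UNIV. (\<Prod>l<m. v l $ fst (e l) $ snd (e l)) * P (\<lambda>l. if l < m then munit (e l) else v l))"
    using Suc by simp
  also have "\<dots> = (\<Sum>e\<in>{..<m} \<rightarrow>\<^sub>E UNIV. \<Sum>y\<in>UNIV. ?g (e(m := y)))"
  proof (intro sum.cong refl)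
    fix e :: "nat \<Rightarrow> 'n \<times> 'n"
    have eq: "(\<lambda>l. if l < m then munit (e l) else v l)(m := munit y)
        = (\<lambda>l. if l < Suc m then munit ((e(m := y)) l) else v l)" for y
      by (auto simp: fun_eq_iff less_Suc_eq)
    have pr: "(\<Prod>l<m. v l $ fst (e l) $ snd (e l)) * v m $ fst y $ snd y
       = (\<Prod>l<Suc m. v l $ fst ((e(m := y)) l) $ snd ((e(m := y)) l))" for y
      by simp
    show "(\<Prod>l<m. v l $ fst (e l) $ snd (e l)) * P (\<lambda>l. if l < m then munit (e l) else v l) = (\<Sum>y\<in>UNIV. ?g (e(m := y)))"
      unfolding step[of "\<lambda>l. if l < m then munit (e l) else v l"] eq sum_distrib_left
        mult.assoc[symmetric] pr[symmetric]
      by simp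
  qed
  also have "\<dots> = (\<Sum>e\<in>{..<Suc m} \<rightarrow>\<^sub>E UNIV. ?g e)"
    unfolding lessThan_Suc by (subst sum_PiE_insert) auto
  finally show ?case .
qed

lemma mlin_expand:
  fixes P :: "(nat \<Rightarrow> ('a::field)^'n::finite^'n) \<Rightarrow> 'a"
  assumes "mlin K P" "local_on K P"
  shows "P v = (\<Sum>e\<in>{..<K} \<rightarrow>\<^sub>E UNIV. (\<Prod>l<K. v l $ fst (e l) $ snd (e l)) * P (\<lambda>l. munit (e l)))"
proof -
  have "P (\<lambda>l. if l < K then munit (e l) else v l) = P (\<lambda>l. munit (e l))" for e
    using assms(2) by (auto simp: local_on_def)
  then show ?thesis using mlin_expand_partial[OF assms(1) order_refl, of v] by simp
qed

lemma alternating_repeated: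
  fixes P :: "(nat \<Rightarrow> 'v) \<Rightarrow> 'a::field_char_0"
  assumes "P (v \<circ> Transposition.transpose i j) = - P v" "v i = v j"
  shows "P v = 0"
proof -
  have "v \<circ> Transposition.transpose i j = v"
    using assms(2) by (auto simp: fun_eq_iff Transposition.transpose_def)
  then have "P v + P v = 0" using assms(1) by (simp add: eq_neg_iff_add_eq_0)
  then show ?thesis by (simp add: mult_2[symmetric] del: mult_2)
qed

lemma kform_nth:
  assumes "kform k f"
  shows "local_on k (\<lambda>v. f v $ p $ q)" "mlin k (\<lambda>v. f v $ p $ q)"
    "i < j \<Longrightarrow> j < k \<Longrightarrow> f (v \<circ> Transposition.transpose i j) $ p $ q = - f v $ p $ q"
proof -
  show "local_on k (\<lambda>v. f v $ p $ q)"
    using assms unfolding kform_def local_on_def by metis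
  show "mlin k (\<lambda>v. f v $ p $ q)"
    using assms unfolding kform_def mlin_def by simp
  show "i < j \<Longrightarrow> j < k \<Longrightarrow> f (v \<circ> Transposition.transpose i j) $ p $ q = - f v $ p $ q"
    using assms unfolding kform_def by simp
qed

text \<open>There are only \<open>n^2\<close> matrix units, so more than \<open>n^2\<close> slots
  filled with them contain a repetition, and an alternating function vanishes there.\<close>

lemma kform_vanish:
  assumes "kform k (f :: (nat \<Rightarrow> ('a::field_char_0)^'n::finite^'n) \<Rightarrow> 'a^'n^'n)" "CARD('n)^2 < k"
  shows "f v = 0"
proof -
  have "f v $ p $ q = 0" for p q
  proof -
    have "f (\<lambda>l. munit (e l)) $ p $ q = 0" if e: "e \<in> {..<k} \<rightarrow>\<^sub>E (UNIV :: ('n \<times> 'n) set)" for e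
    proof -
      have "\<not> inj_on e {..<k}"
      proof
        assume "inj_on e {..<k}"
        then have "card (e ` {..<k}) = k" by (simp add: card_image)
        moreover have "card (e ` {..<k}) \<le> CARD('n \<times> 'n)" by (rule card_mono) auto
        ultimately show False using assms(2) by (simp add: power2_eq_square)
      qed
      then obtain i j where "i < k" "j < k" "i < j" "e i = e j"
        unfolding inj_on_def by (metis lessThan_iff linorder_neqE_nat)
      then show ?thesis
        using kform_nth(3)[OF assms(1), of i j "\<lambda>l. munit (e l)" p q]
        by (intro alternating_repeated[where P = "\<lambda>v. f v $ p $ q" and i = i and j = j]) auto
    qed
    then show ?thesis
      unfolding mlin_expand[OF kform_nth(2)[OF assms(1), of p q] kform_nth(1)[OF assms(1), of p q], of v] by (intro sum.neutral) auto
  qed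
  then show ?thesis by (simp add: vec_eq_iff)
qed

definition equivariant :: "((nat \<Rightarrow> ('a::field)^'n::finite^'n) \<Rightarrow> 'a^'n^'n) \<Rightarrow> bool" where
  "equivariant P \<longleftrightarrow> (\<forall>g g'. g ** g' = mat 1 \<and> g' ** g = mat 1 \<longrightarrow> (\<forall>v. P (\<lambda>i. g ** v i ** g') = g ** P v ** g'))"

text \<open>Multilinearity and equivariance are required of the representative, before alternation.
  They pass to wedge products by inspecting a single concatenated product instead of a sum over
  permutations.\<close>

definition inv_form :: "nat \<Rightarrow> ('a::field,'n::finite) mform \<Rightarrow> bool" where
  "inv_form d f \<longleftrightarrow> (\<exists>P. local_on d P \<and> (\<forall>p q. mlin d (\<lambda>v. P v $ p $ q)) \<and> equivariant P \<and> f = hform d P)"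

lemma mlin_alt:
  fixes P :: "(nat \<Rightarrow> ('a::field)^'n::finite^'n) \<Rightarrow> 'a"
  assumes "mlin d P" shows "mlin d (alt d P)"
  unfolding mlin_def
proof (intro allI impI)
  fix i c and v :: "nat \<Rightarrow> 'a^'n^'n" and x y :: "'a^'n^'n" assume i: "i < d"
  \<comment> \<open>Slot \<open>i\<close> of \<open>v\<close> is read by
    \<open>v \<circ> \<sigma>\<close> in position \<open>inv \<sigma> i\<close>.\<close>
  have upd: "v(i := z) \<circ> \<sigma> = (v \<circ> \<sigma>)(inv \<sigma> i := z)" if "\<sigma> permutes {..<d}" for \<sigma> z
    using that by (auto simp: fun_eq_iff permutes_inverses)
  have "P (v(i := mat c ** x + y) \<circ> \<sigma>) = c * P (v(i := x) \<circ> \<sigma>) + P (v(i := y) \<circ> \<sigma>)" if "\<sigma> permutes {..<d}" for \<sigma>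
  proof -
    have "inv \<sigma> i < d" using permutes_in_image[OF permutes_inv[OF that], of i] i by simp
    then show ?thesis unfolding upd[OF that] using assms unfolding mlin_def by blast
  qed
  then show "alt d P (v(i := mat c ** x + y)) = c * alt d P (v(i := x)) + alt d P (v(i := y))"
    unfolding alt_def sum_distrib_left by (simp add: sum.distrib[symmetric] algebra_simps)
qed

lemma inv_form_kform:
  assumes "inv_form d f" shows "kform k (f k)"
proof -
  obtain P where P: "local_on d P" "\<And>p q. mlin d (\<lambda>v. P v $ p $ q)" "f = hform d P"
    using assms by (auto simp: inv_form_def)
  show ?thesis
  proof (cases "k = d")
    case False
    then show ?thesis using P(3) by (simp add: kform_def hform_def)
  next
    case True
    have l: "local_on d (alt d (\<lambda>v. P v $ p $ q))" for p q
      using P(1) by (intro alt_local) (auto simp: local_on_def, metis)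
    have m: "mlin d (alt d (\<lambda>v. P v $ p $ q))" for p q
      by (rule mlin_alt[OF P(2)])
    have a: "alt d (\<lambda>v. P v $ p $ q) (v \<circ> Transposition.transpose i j) = - alt d (\<lambda>v. P v $ p $ q) v"
      if "i < j" "j < d" for p q v i j
      using that by (subst alt_at_perm) (auto simp: sign_swap_id intro!: permutes_swap_id)
    show ?thesis
      unfolding kform_def True P(3)
      using l m a by (auto simp: hform_def vec_eq_iff local_on_def mlin_def)
  qed
qed

lemma inv_form_A_alg:
  assumes "inv_form d (f :: ('a::field_char_0,'n::finite) mform)" shows "f \<in> A_alg"
proof -
  obtain P where P: "local_on d P" "\<And>p q. mlin d (\<lambda>v. P v $ p $ q)" "equivariant P" "f = hform d P"
    using assms by (auto simp: inv_form_def)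
  have "f k = (\<lambda>_. 0)" if "CARD('n)^2 < k" for k
    using kform_vanish[OF inv_form_kform[OF assms] that] by auto
  then have "f \<in> forms" using inv_form_kform[OF assms] by (simp add: forms_def)
  moreover have "invariant f"
    unfolding invariant_def
  proof (intro allI impI)
    fix g g' :: "'a^'n^'n" and k v assume g: "g ** g' = mat 1 \<and> g' ** g = mat 1"
    \<comment> \<open>The entries of a conjugate are fixed linear combinations of the entries, so
      conjugation can be pulled out of the entrywise alternation.\<close>
    have conj_nth: "(g ** M ** g') $ p $ q = (\<Sum>r\<in>UNIV. \<Sum>s\<in>UNIV. g $ p $ s * M $ s $ r * g' $ r $ q)" for M p q
      by (simp add: matrix_matrix_mult_def sum_distrib_right)
    have "alt d (\<lambda>v. P v $ p $ q) (\<lambda>i. g ** v i ** g') = (\<Sum>r\<in>UNIV. \<Sum>s\<in>UNIV. g $ p $ s * alt d (\<lambda>v. P v $ s $ r) v * g' $ r $ q)" for p q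
    proof -
      have "alt d (\<lambda>v. P v $ p $ q) (\<lambda>i. g ** v i ** g') = alt d (\<lambda>v. (g ** P v ** g') $ p $ q) v"
        unfolding alt_def using P(3) g by (auto simp: equivariant_def o_def intro!: sum.cong)
      also have "\<dots> = (\<Sum>r\<in>UNIV. \<Sum>s\<in>UNIV. g $ p $ s * alt d (\<lambda>v. P v $ s $ r) v * g' $ r $ q)"
        unfolding conj_nth alt_sum by (simp add: mult.commute[of _ "g' $ _ $ _"] alt_mult_const)
      finally show ?thesis .
    qed
    then show "f k (\<lambda>i. g ** v i ** g') = g ** f k v ** g'"
      unfolding P(4) by (cases "k = d") (simp_all add: vec_eq_iff conj_nth hform_nth)
  qed
  ultimately show ?thesis by (simp add: A_alg_def)
qed

lemma inv_form_wedge: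
  assumes "inv_form a f" "inv_form b (g :: ('a::field_char_0,'n::finite) mform)"
  shows "inv_form (a + b) (f \<and>\<^sub>w g)"
proof -
  obtain P where P: "local_on a P" "\<And>p q. mlin a (\<lambda>v. P v $ p $ q)" "equivariant P" "f = hform a P"
    using assms(1) by (auto simp: inv_form_def)
  obtain Q where Q: "local_on b Q" "\<And>p q. mlin b (\<lambda>v. Q v $ p $ q)" "equivariant Q" "g = hform b Q"
    using assms(2) by (auto simp: inv_form_def)
  let ?R = "\<lambda>v. P v ** Q (shift a v)"
  have "mlin (a + b) (\<lambda>v. ?R v $ p $ q)" for p q
    unfolding mlin_def
  proof (intro allI impI)
    fix i v x y c assume i: "i < a + b"
    show "?R (v(i := mat c ** x + y)) $ p $ q = c * ?R (v(i := x)) $ p $ q + ?R (v(i := y)) $ p $ q"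
    \<comment> \<open>Each slot belongs to one of the two blocks, and the other factor does not
      change when it is modified.\<close>
    proof (cases "i < a")
      case True
      have s: "shift a (v(i := z)) = shift a v" for z using True by (auto simp: shift_def)
      have "P (v(i := mat c ** x + y)) $ p $ r = c * P (v(i := x)) $ p $ r + P (v(i := y)) $ p $ r" for r
        using P(2) True unfolding mlin_def by blast
      then show ?thesis unfolding s
        by (simp add: matrix_matrix_mult_def sum_distrib_left sum.distrib[symmetric] algebra_simps)
    next
      case False
      have s: "shift a (v(i := z)) = (shift a v)(i - a := z)" for z
        using False by (auto simp: shift_def fun_eq_iff)
      have p: "P (v(i := z)) = P v" for z using P(1) False by (simp add: local_on_def)
      have "Q ((shift a v)(i - a := mat c ** x + y)) $ r $ q
          = c * Q ((shift a v)(i - a := x)) $ r $ q + Q ((shift a v)(i - a := y)) $ r $ q" for r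
        using Q(2) False i unfolding mlin_def by (metis less_diff_conv2 add.commute not_less)
      then show ?thesis unfolding s p
        by (simp add: matrix_matrix_mult_def sum_distrib_left sum.distrib[symmetric] algebra_simps)
    qed
  qed
  moreover have "equivariant ?R"
    unfolding equivariant_def
  proof (intro allI impI)
    fix g g' :: "'a^'n^'n" and v assume g: "g ** g' = mat 1 \<and> g' ** g = mat 1"
    have "?R (\<lambda>i. g ** v i ** g') = (g ** P v ** g') ** (g ** Q (shift a v) ** g')"
      using P(3) Q(3) g unfolding equivariant_def by (simp add: shift_def)
    also have "\<dots> = g ** P v ** (g' ** g) ** Q (shift a v) ** g'"
      by (simp only: matrix_mul_assoc)
    finally show "?R (\<lambda>i. g ** v i ** g') = g ** ?R v ** g'"
      using g by (simp add: matrix_mul_assoc)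
  qed
  moreover have "local_on (a + b) ?R" by (rule local_on_tensor[OF P(1) Q(1)])
  ultimately show ?thesis
    unfolding inv_form_def P(4) Q(4) using wedge_hform[OF P(1), of b Q] by blast
qed

lemma inv_form_fone: "inv_form 0 fone"
  unfolding inv_form_def fone_hform
  by (intro exI[of _ "\<lambda>v. mat 1"]) (auto simp: local_on_def mlin_def equivariant_def)

lemma inv_form_Xf: "inv_form 1 Xf"
  unfolding inv_form_def Xf_hform
  by (intro exI[of _ "\<lambda>v. v 0"]) (auto simp: local_on_def mlin_def equivariant_def)

lemma inv_form_pow: "inv_form k (fpow Xf k :: ('a::field_char_0,'n::finite) mform)"
proof (induction k)
  case 0
  then show ?case by (simp add: fpow_0 inv_form_fone)
next
  case (Suc k)
  then show ?case using inv_form_wedge[OF inv_form_Xf Suc] by (simp add: fpow_Suc)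
qed

lemma wd_conj:
  assumes "g' ** g = mat 1" "g ** g' = mat 1"
  shows "wd l (\<lambda>i. g ** v i ** g') = g ** wd l v ** g'"
proof (induction l)
  case Nil
  then show ?case using assms by simp
next
  case (Cons i l)
  have "wd (i # l) (\<lambda>i. g ** v i ** g') = g ** v i ** (g' ** g) ** wd l v ** g'"
    by (simp add: Cons matrix_mul_assoc)
  then show ?case using assms by (simp add: matrix_mul_assoc)
qed

lemma matrix_add_rdistr: "(A + B) ** C = A ** C + B ** (C :: ('a::comm_ring_1)^'n::finite^'n)"
  by (simp add: matrix_matrix_mult_def vec_eq_iff distrib_right sum.distrib)

lemma mat_nth: "mat c $ p $ q = (if p = q then c else 0)"
  by (simp add: mat_def)

lemma mlin_wd:
  assumes "distinct l" "set l = {..<k}"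
  shows "mlin k (\<lambda>v :: nat \<Rightarrow> ('a::field)^'n::finite^'n. wd l v $ p $ q)"
proof -
  have "wd l (v(i := mat c ** x + y)) $ p $ q = c * wd l (v(i := x)) $ p $ q + wd l (v(i := y)) $ p $ q"
    if "i \<in> set l" for i c p q and v :: "nat \<Rightarrow> 'a^'n^'n" and x y :: "'a^'n^'n"
  proof -
    from that obtain l1 l2 where l: "l = l1 @ i # l2" by (meson split_list)
    have d: "i \<notin> set l1" "i \<notin> set l2" using assms l by auto
    have w: "wd l (v(i := z)) = wd l1 v ** z ** wd l2 v" for z
    proof -
      have "wd l1 (v(i := z)) = wd l1 v" "wd l2 (v(i := z)) = wd l2 v"
        using d by (auto intro!: wd_cong)
      then show ?thesis unfolding l by (simp add: matrix_mul_assoc)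
    qed
    have "A ** (mat c ** x + y) ** B = mat c ** (A ** x ** B) + A ** y ** B" for A B :: "'a^'n^'n"
    proof -
      have "A ** mat c = mat c ** A"
        by (simp add: vec_eq_iff) (simp add: matrix_matrix_mult_def mat_def if_distrib mult.commute cong: if_cong)
      then show ?thesis
        by (simp add: matrix_add_ldistrib matrix_add_rdistr matrix_mul_assoc)
    qed
    then show ?thesis unfolding w by simp
  qed
  then show ?thesis unfolding mlin_def using assms by auto
qed

lemma inv_form_Tf: "inv_form (2 * h + 1) (Tf h :: ('a::field_char_0,'n::finite) mform)"
proof -
  let ?k = "2 * h + 1"
  have m: "mlin ?k (\<lambda>v :: nat \<Rightarrow> 'a^'n^'n. wd [0..<?k] v $ p $ q)" for p q by (rule mlin_wd) (simp_all only: distinct_upt set_upt atLeast0LessThan)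
  have t: "trw ?k (v(j := mat c ** x + y)) = c * trw ?k (v(j := x)) + trw ?k (v(j := y))"
    if "j < ?k" for j c x y and v :: "nat \<Rightarrow> 'a^'n^'n"
  proof -
    have "wd [0..<?k] (v(j := mat c ** x + y)) $ i $ i
      = c * wd [0..<?k] (v(j := x)) $ i $ i + wd [0..<?k] (v(j := y)) $ i $ i" for i
      using m that unfolding mlin_def by blast
    then show ?thesis
      unfolding trw_def mtrace_def by (simp only: sum.distrib sum_distrib_left)
  qed
  have "mlin ?k (\<lambda>v :: nat \<Rightarrow> 'a^'n^'n. mat (trw ?k v) $ p $ q)" for p q
    unfolding mlin_def
    by (cases "p = q") (use t in \<open>simp_all add: mat_nth\<close>)
  moreover have "equivariant (\<lambda>v :: nat \<Rightarrow> 'a^'n^'n. mat (trw ?k v))"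
    unfolding equivariant_def
  proof (intro allI impI)
    fix g g' :: "'a^'n^'n" and v assume g: "g ** g' = mat 1 \<and> g' ** g = mat 1"
    have "trw ?k (\<lambda>i. g ** v i ** g') = mtrace ((g ** wd [0..<?k] v) ** g')"
      unfolding trw_def using wd_conj[of g' g "[0..<?k]" v] g by simp
    also have "\<dots> = trw ?k v"
      by (subst mtrace_mult_commute) (use g in \<open>simp add: matrix_mul_assoc trw_def\<close>)
    finally have t: "trw ?k (\<lambda>i. g ** v i ** g') = trw ?k v" .
    have "g ** mat c ** g' = mat c" for c
    proof -
      have "g ** mat c = mat c ** g"
        by (simp add: vec_eq_iff) (simp add: matrix_matrix_mult_def mat_def if_distrib mult.commute cong: if_cong)
      then show ?thesis using g by (simp add: matrix_mul_assoc[symmetric])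
    qed
    then show "mat (trw ?k (\<lambda>i. g ** v i ** g')) = g ** mat (trw ?k v) ** g'"
      unfolding t by simp
  qed
  moreover have "local_on ?k (\<lambda>v :: nat \<Rightarrow> 'a^'n^'n. mat (trw ?k v) :: 'a^'n^'n)"
    by (rule local_on_comp[OF local_on_trw])
  ultimately show ?thesis unfolding inv_form_def Tf_sform sform_def by blast
qed

lemma inv_form_Tprod:
  "finite S \<Longrightarrow> inv_form (\<Sum>h\<in>S. 2 * h + 1) (Tprod S :: ('a::field_char_0,'n::finite) mform)"
proof (induction S rule: finite_linorder_min_induct)
  case empty
  then show ?case by (simp add: Tprod_empty inv_form_fone)
next
  case (insert b A)
  then have "b \<notin> A" by auto
  then show ?case
    using inv_form_wedge[OF inv_form_Tf[of b] insert.IH] insert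
    by (simp add: Tprod_insert_min)
qed

lemma inv_form_TX: "finite S \<Longrightarrow> inv_form (tdeg S k) (TX S k :: ('a::field_char_0,'n::finite) mform)"
  unfolding TX_def tdeg_def by (intro inv_form_wedge inv_form_Tprod inv_form_pow)

lemma TX_nondeg:
  assumes "finite S" "k \<noteq> tdeg S j"
  shows "TX S j k = (\<lambda>v. 0 :: ('a::field_char_0)^'n::finite^'n)"
  using hom_form_TX[OF assms(1), of j, where 'a='a and 'n='n] assms(2)
  by (auto simp: hom_form_def hform_def)

text \<open>Reconciles the truncation in \<open>ta_ok\<close> with the forms: a formal monomial that
  is declared zero corresponds to a product of forms that vanishes anyway.\<close>

lemma TX_high_degree:
  assumes "finite S" "CARD('n)^2 < tdeg S j"
  shows "TX S j = (0 :: ('a::field_char_0,'n::finite) mform)"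
proof (intro ext)
  fix k and v :: "nat \<Rightarrow> 'a^'n^'n"
  show "TX S j k v = (0 :: ('a,'n) mform) k v"
  proof (cases "k = tdeg S j")
    case True
    then show ?thesis
      using kform_vanish[OF inv_form_kform[OF inv_form_TX[OF assms(1), of j, where 'a='a and 'n='n], of k]] assms(2)
      by (simp add: fun_apply)
  next
    case False
    then show ?thesis using TX_nondeg[OF assms(1), of k j, where 'a='a and 'n='n] by (simp add: fun_apply)
  qed
qed

section \<open>The canonical homomorphism\<close>

lemma canon_eq:
  "canon c = (\<Sum>x\<in>Pow {..<CARD('n)} \<times> {..CARD('n)^2}. fscale (c (fst x) (snd x)) (TX (fst x) (snd x)) :: ('a::field,'n::finite) mform)"
  unfolding canon_def
  by (intro ext) (simp add: sum_fun_apply sum.cartesian_product case_prod_unfold fscale_def TX_def)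

lemma canon_add: "canon (\<lambda>U m. a U m + b U m) = (canon a + canon b :: ('a::field,'n::finite) mform)"
  unfolding canon_eq by (simp add: mf.scale_left_distrib sum.distrib)

lemma canon_scale: "canon (\<lambda>U m. t * a U m) = (fscale t (canon a) :: ('a::field,'n::finite) mform)"
  unfolding canon_eq by (simp add: mf.scale_sum_right)

lemma canon_zero: "canon (\<lambda>U m. 0) = (0 :: ('a::field,'n::finite) mform)"
  unfolding canon_eq by simp

lemma canon_sum:
  "canon (\<lambda>U m. \<Sum>i\<in>I. a i U m) = (\<Sum>i\<in>I. canon (a i) :: ('a::field,'n::finite) mform)"
  by (induction I rule: infinite_finite_induct) (simp_all add: canon_zero canon_add)

lemma canon_basis:
  assumes "S \<subseteq> {..<CARD('n)}"
  shows "canon (ta_basis CARD('n) S k) = (TX S k :: ('a::field_char_0,'n::finite) mform)"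
proof (cases "ta_ok CARD('n) S k")
  case True
  let ?B = "Pow {..<CARD('n)} \<times> {..CARD('n)^2}"
  have "(S, k) \<in> ?B" using True by (auto simp: ta_ok_def tdeg_def)
  moreover have "fscale (ta_basis CARD('n) S k (fst x) (snd x)) (TX (fst x) (snd x))
      = (if x = (S, k) then TX S k else (0 :: ('a,'n) mform))" for x
    using True by (cases x) (auto simp: ta_basis_def)
  ultimately show ?thesis
    unfolding canon_eq by (simp add: sum.delta)
next
  case False
  have "finite S" using assms finite_subset by blast
  moreover have "CARD('n)^2 < tdeg S k" using False assms by (simp add: ta_ok_def)
  moreover have "ta_basis CARD('n) S k = (\<lambda>U m. 0 :: 'a)" using False by (simp add: ta_basis_def fun_eq_iff)
  ultimately show ?thesis by (simp add: canon_zero TX_high_degree)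
qed

text \<open>The images multiply by the same sign rule as the formal monomials, and what the formal
  product cuts off has degree above \<open>n^2\<close>, where the forms vanish.\<close>

lemma canon_mult:
  "canon (ta_mult CARD('n) c d) = (canon c \<and>\<^sub>w canon d :: ('a::field_char_0,'n::finite) mform)"
proof -
  let ?n = "CARD('n)"
  let ?B = "Pow {..<?n} \<times> {..?n^2}"
  let ?F = "\<lambda>S k R l. fscale (of_int (tsign S R k) * c S k * d R l) (TX (S \<union> R) (k + l)) :: ('a,'n) mform"
  have fin: "finite S" if "S \<subseteq> {..<?n}" for S using that finite_subset by blast
  have "canon (ta_mult ?n c d) = (\<Sum>x\<in>?B. \<Sum>y\<in>Pow (fst x) \<times> {..snd x}.
      ?F (fst y) (snd y) (fst x - fst y) (snd x - snd y))"
    unfolding canon_eq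
  proof (intro sum.cong refl)
    fix x assume x: "x \<in> ?B"
    obtain U m where [simp]: "x = (U, m)" by (cases x)
    have U: "U \<subseteq> {..<?n}" using x by simp
    have e: "?F (fst y) (snd y) (U - fst y) (m - snd y)
       = fscale (of_int (tsign (fst y) (U - fst y) (snd y)) * c (fst y) (snd y) * d (U - fst y) (m - snd y)) (TX U m)"
      if "y \<in> Pow U \<times> {..m}" for y
    proof -
      have "fst y \<union> (U - fst y) = U" "snd y + (m - snd y) = m" using that by auto
      then show ?thesis by simp
    qed
    have "fscale (ta_mult ?n c d U m) (TX U m)
        = fscale (\<Sum>S\<in>Pow U. \<Sum>k\<le>m. of_int (tsign S (U - S) k) * c S k * d (U - S) (m - k)) (TX U m :: ('a,'n) mform)"
    proof (cases "ta_ok ?n U m")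
      case False
      then have "TX U m = (0 :: ('a,'n) mform)"
        using U by (intro TX_high_degree fin) (simp_all add: ta_ok_def)
      then show ?thesis by simp
    qed (simp add: ta_mult_def)
    also have "\<dots> = (\<Sum>y\<in>Pow U \<times> {..m}. ?F (fst y) (snd y) (U - fst y) (m - snd y))"
      unfolding sum.cartesian_product mf.scale_sum_left
      by (rule sum.cong[OF refl]) (simp only: e case_prod_unfold)
    finally show "fscale (ta_mult ?n c d (fst x) (snd x)) (TX (fst x) (snd x))
       = (\<Sum>y\<in>Pow (fst x) \<times> {..snd x}. ?F (fst y) (snd y) (fst x - fst y) (snd x - snd y))" by simp
  qed
  also have "\<dots> = (\<Sum>z\<in>(SIGMA x:?B. Pow (fst x) \<times> {..snd x}).
      ?F (fst (snd z)) (snd (snd z)) (fst (fst z) - fst (snd z)) (snd (fst z) - snd (snd z)))"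
    by (subst sum.Sigma) (auto simp: case_prod_unfold intro: fin)
  \<comment> \<open>A monomial \<open>(U, m)\<close> with a splitting of it corresponds to a pair of
    monomials with disjoint index sets and exponents adding up to at most
    \<open>n^2\<close>.\<close>
  also have "\<dots> = (\<Sum>z\<in>{z\<in>?B \<times> ?B. fst (fst z) \<inter> fst (snd z) = {} \<and> snd (fst z) + snd (snd z) \<le> ?n^2}.
      ?F (fst (fst z)) (snd (fst z)) (fst (snd z)) (snd (snd z)))"
    by (rule sum.reindex_bij_witness[where
        i = "\<lambda>z. ((fst (fst z) \<union> fst (snd z), snd (fst z) + snd (snd z)), fst z)" and
        j = "\<lambda>z. (snd z, (fst (fst z) - fst (snd z), snd (fst z) - snd (snd z)))"])
      (auto)
  \<comment> \<open>The pairs added here either overlap and are zero by the \<open>if\<close>, or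
    have \<open>k + l > n^2\<close> and are zero by degree.\<close>
  also have "\<dots> = (\<Sum>z\<in>?B \<times> ?B. if fst (fst z) \<inter> fst (snd z) = {} then
      ?F (fst (fst z)) (snd (fst z)) (fst (snd z)) (snd (snd z)) else 0)"
  proof (rule sum.mono_neutral_cong_left)
    show "\<forall>z\<in>?B \<times> ?B - {z\<in>?B \<times> ?B. fst (fst z) \<inter> fst (snd z) = {} \<and> snd (fst z) + snd (snd z) \<le> ?n^2}.
       (if fst (fst z) \<inter> fst (snd z) = {} then ?F (fst (fst z)) (snd (fst z)) (fst (snd z)) (snd (snd z)) else 0) = 0"
    proof
      fix z assume z: "z \<in> ?B \<times> ?B - {z\<in>?B \<times> ?B. fst (fst z) \<inter> fst (snd z) = {} \<and> snd (fst z) + snd (snd z) \<le> ?n^2}"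
      obtain S k R l where [simp]: "z = ((S,k),(R,l))" by (metis surj_pair)
      show "(if fst (fst z) \<inter> fst (snd z) = {} then ?F (fst (fst z)) (snd (fst z)) (fst (snd z)) (snd (snd z)) else 0) = 0"
      proof (cases "S \<inter> R = {}")
        case True
        then have "?n^2 < k + l" using z by auto
        then have "TX (S \<union> R) (k + l) = (0 :: ('a,'n) mform)"
          using z by (intro TX_high_degree) (auto simp: tdeg_def intro: fin)
        then show ?thesis by simp
      qed simp
    qed
  qed auto
  also have "\<dots> = (\<Sum>z\<in>?B \<times> ?B. fscale (c (fst (fst z)) (snd (fst z)) * d (fst (snd z)) (snd (snd z)))
      (TX (fst (fst z)) (snd (fst z)) \<and>\<^sub>w TX (fst (snd z)) (snd (snd z))))"
  proof (rule sum.cong[OF refl])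
    fix z assume "z \<in> ?B \<times> ?B"
    then have "finite (fst (fst z))" "finite (fst (snd z))" using fin by auto
    then show "(if fst (fst z) \<inter> fst (snd z) = {} then
        ?F (fst (fst z)) (snd (fst z)) (fst (snd z)) (snd (snd z)) else 0)
      = fscale (c (fst (fst z)) (snd (fst z)) * d (fst (snd z)) (snd (snd z)))
      (TX (fst (fst z)) (snd (fst z)) \<and>\<^sub>w TX (fst (snd z)) (snd (snd z)))"
      by (simp add: TX_wedge_TX mult_ac)
  qed
  also have "\<dots> = canon c \<and>\<^sub>w canon d"
  proof -
    have "canon c \<and>\<^sub>w canon d = (\<Sum>x\<in>?B. \<Sum>y\<in>?B. fscale (c (fst x) (snd x) * d (fst y) (snd y))
        (TX (fst x) (snd x) \<and>\<^sub>w TX (fst y) (snd y)) :: ('a,'n) mform)"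
      unfolding canon_eq
      by (subst wedge_sum_left, subst wedge_sum_right)
        (simp add: wedge_scale_left wedge_scale_right mult.commute)
    then show ?thesis by (simp add: sum.cartesian_product case_prod_unfold)
  qed
  finally show ?thesis .
qed

lemma tdeg_union: "finite S \<Longrightarrow> finite R \<Longrightarrow> S \<inter> R = {} \<Longrightarrow> tdeg (S \<union> R) (k + l) = tdeg S k + tdeg R l"
  by (simp add: tdeg_def sum.union_disjoint)

text \<open>Valid beyond the degree bound as well, since \<open>ta_basis\<close> was given the value
  zero there.\<close>

lemma ta_basis_mult:
  assumes "finite S" "finite R" "S \<inter> R = {}"
  shows "ta_mult n (ta_basis n S k) (ta_basis n R l)
    = (\<lambda>U m. of_int (tsign S R k) * ta_basis n (S \<union> R) (k + l) U m :: 'a::field)"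
proof (intro ext)
  fix U m
  show "ta_mult n (ta_basis n S k) (ta_basis n R l) U m
    = (of_int (tsign S R k) * ta_basis n (S \<union> R) (k + l) U m :: 'a)"
  proof (cases "ta_ok n U m")
    case False
    then show ?thesis by (auto simp: ta_mult_def ta_basis_def)
  next
    case True
    then have "finite U" using finite_subset by (auto simp: ta_ok_def)
    have "ta_mult n (ta_basis n S k) (ta_basis n R l) U m = (\<Sum>y\<in>Pow U \<times> {..m}.
        of_int (tsign (fst y) (U - fst y) (snd y)) * ta_basis n S k (fst y) (snd y) * (ta_basis n R l (U - fst y) (m - snd y) :: 'a))"
      using True by (simp add: ta_mult_def sum.cartesian_product case_prod_unfold)
    also have "\<dots> = (\<Sum>y\<in>Pow U \<times> {..m}. if y = (S, k) then
        (if U = S \<union> R \<and> m = k + l then of_int (tsign S R k) else 0) else 0)"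
    proof (rule sum.cong[OF refl])
      fix y assume y: "y \<in> Pow U \<times> {..m}"
      show "of_int (tsign (fst y) (U - fst y) (snd y)) * ta_basis n S k (fst y) (snd y) * (ta_basis n R l (U - fst y) (m - snd y) :: 'a)
        = (if y = (S, k) then (if U = S \<union> R \<and> m = k + l then of_int (tsign S R k) else 0) else 0)"
      proof (cases "y = (S, k)")
        case yS: True
        then have "(U - S = R \<and> m - k = l) \<longleftrightarrow> (U = S \<union> R \<and> m = k + l)"
          using y assms by auto
        \<comment> \<open>Degrees add, so the factors of an admissible product are
          admissible.\<close>
        moreover have "ta_ok n S k \<and> ta_ok n R l" if "U = S \<union> R" "m = k + l"
          using True tdeg_union[OF assms, of k l] that by (auto simp: ta_ok_def)
        ultimately show ?thesis using yS by (auto simp: ta_basis_def)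
      next
        case False
        then show ?thesis by (cases y) (auto simp: ta_basis_def)
      qed
    qed
    also have "\<dots> = (if U = S \<union> R \<and> m = k + l then of_int (tsign S R k) else 0)"
      using \<open>finite U\<close> by (subst sum.delta) auto
    finally show ?thesis using True by (auto simp: ta_basis_def[of n "S \<union> R"])
  qed
qed

lemma ta_pow_X: "n \<ge> 1 \<Longrightarrow> ta_pow n (ta_X n) k = (ta_basis n {} k :: 'a::field ta)"
proof (induction k)
  case 0
  then show ?case by (simp add: ta_pow_def ta_one_def)
next
  case (Suc k)
  then have "ta_pow n (ta_X n) (Suc k) = (ta_mult n (ta_basis n {} 1) (ta_basis n {} k) :: 'a ta)"
    by (simp add: ta_pow_def ta_X_def)
  then show ?case by (simp add: ta_basis_mult tsign_def)
qed

section \<open>The fundamental trace identity\<close>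

text \<open>The product, over the cycles of \<open>\<sigma>\<close>, of the traces of the matrices multiplied along the cycle.\<close>

definition psum :: "nat set \<Rightarrow> (nat \<Rightarrow> nat) \<Rightarrow> (nat \<Rightarrow> ('a::field)^'n::finite^'n) \<Rightarrow> 'a" where
  "psum A \<sigma> M = (\<Sum>i\<in>A \<rightarrow>\<^sub>E UNIV. \<Prod>a\<in>A. M a $ i a $ i (\<sigma> a))"

lemma psum_empty [simp]: "psum {} \<sigma> M = 1"
  by (simp add: psum_def)

text \<open>The index attached to \<open>b\<close> occurs in the factor of \<open>b\<close> alone,
  so its sum splits off as a trace.\<close>

lemma psum_fixed_point:
  assumes "finite A" "b \<in> A" "\<sigma> permutes A" "\<sigma> b = b"
  shows "psum A \<sigma> M = mtrace (M b) * psum (A - {b}) \<sigma> M"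
proof -
  let ?B = "A - {b}"
  have A: "A = insert b ?B" using assms by auto
  have ne: "\<sigma> a \<noteq> b" if "a \<in> ?B" for a
    using that assms inj_eq[OF permutes_inj[OF assms(3)], of a b] by auto
  have "psum A \<sigma> M = (\<Sum>e\<in>?B \<rightarrow>\<^sub>E UNIV. \<Sum>y\<in>UNIV. \<Prod>a\<in>insert b ?B. M a $ (e(b := y)) a $ (e(b := y)) (\<sigma> a))"
    unfolding psum_def by (subst A, subst (2) A, subst sum_PiE_insert) auto
  also have "\<dots> = (\<Sum>e\<in>?B \<rightarrow>\<^sub>E UNIV. \<Sum>y\<in>UNIV. M b $ y $ y * (\<Prod>a\<in>?B. M a $ e a $ e (\<sigma> a)))"
  proof (intro sum.cong refl)
    fix e y
    have "(\<Prod>a\<in>?B. M a $ (e(b := y)) a $ (e(b := y)) (\<sigma> a)) = (\<Prod>a\<in>?B. M a $ e a $ e (\<sigma> a))"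
      by (rule prod.cong[OF refl]) (use ne in auto)
    then show "(\<Prod>a\<in>insert b ?B. M a $ (e(b := y)) a $ (e(b := y)) (\<sigma> a)) = M b $ y $ y * (\<Prod>a\<in>?B. M a $ e a $ e (\<sigma> a))"
      using assms by (subst prod.insert) auto
  qed
  also have "\<dots> = mtrace (M b) * psum ?B \<sigma> M"
    unfolding psum_def mtrace_def sum_distrib_right[symmetric] sum_distrib_left[symmetric] ..
  finally show ?thesis .
qed

text \<open>Removes the point \<open>c\<close> from its cycle.\<close>

definition bypass :: "nat \<Rightarrow> (nat \<Rightarrow> nat) \<Rightarrow> nat \<Rightarrow> nat" where
  "bypass c \<sigma> = Transposition.transpose c (\<sigma> c) \<circ> \<sigma>"

lemma bypass_permutes:
  assumes "\<sigma> permutes A" "c \<in> A" shows "bypass c \<sigma> permutes (A - {c})"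
proof -
  have "\<sigma> c \<in> A" using assms permutes_in_image by metis
  then have p: "bypass c \<sigma> permutes A"
    unfolding bypass_def using assms by (intro permutes_compose permutes_swap_id) auto
  have "bypass c \<sigma> c = c" by (simp add: bypass_def)
  then show ?thesis using p by (intro permutes_superset[OF p]) auto
qed

text \<open>The index attached to \<open>c\<close> occurs only in the factors of \<open>b\<close>
  and \<open>c\<close>. Summing over it multiplies the two matrices, and \<open>c\<close> disappears
  from its cycle.\<close>

lemma psum_merge:
  assumes "finite A" "b \<in> A" "\<sigma> permutes A" "\<sigma> b = c" "c \<noteq> b"
  shows "psum A \<sigma> M = psum (A - {c}) (bypass c \<sigma>) (M(b := M b ** M c))"
proof -
  let ?B = "A - {c}" and ?C = "A - {c} - {b}"
  have cA: "c \<in> A" using assms permutes_in_image by metis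
  have A: "A = insert c ?B" using cA by auto
  have B: "?B = insert b ?C" using assms by auto
  have inj: "\<sigma> x = \<sigma> y \<longleftrightarrow> x = y" for x y using permutes_inj[OF assms(3)] by (rule inj_eq)
  have cc: "\<sigma> c \<noteq> c" using inj[of c b] assms by auto
  have ne: "\<sigma> a \<noteq> c" if "a \<in> ?C" for a
    using inj[of a b] assms that by auto
  have by1: "bypass c \<sigma> a = \<sigma> a" if "a \<in> ?C" for a
    using inj[of a c] ne[OF that] that by (auto simp: bypass_def Transposition.transpose_def)
  have by2: "bypass c \<sigma> b = \<sigma> c" using assms by (simp add: bypass_def)
  have "psum A \<sigma> M = (\<Sum>e\<in>?B \<rightarrow>\<^sub>E UNIV. \<Sum>y\<in>UNIV. \<Prod>a\<in>insert c ?B. M a $ (e(c := y)) a $ (e(c := y)) (\<sigma> a))"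
    unfolding psum_def by (subst A, subst (2) A, subst sum_PiE_insert) auto
  also have "\<dots> = (\<Sum>e\<in>?B \<rightarrow>\<^sub>E UNIV. \<Sum>y\<in>UNIV. (M b $ e b $ y * M c $ y $ e (\<sigma> c)) * (\<Prod>a\<in>?C. M a $ e a $ e (\<sigma> a)))"
  proof (intro sum.cong refl)
    fix e y
    have pC: "(\<Prod>a\<in>?C. M a $ (e(c := y)) a $ (e(c := y)) (\<sigma> a)) = (\<Prod>a\<in>?C. M a $ e a $ e (\<sigma> a))"
      by (rule prod.cong[OF refl]) (use ne in auto)
    have "(\<Prod>a\<in>insert c ?B. M a $ (e(c := y)) a $ (e(c := y)) (\<sigma> a))
      = M c $ y $ e (\<sigma> c) * (\<Prod>a\<in>insert b ?C. M a $ (e(c := y)) a $ (e(c := y)) (\<sigma> a))"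
      using assms cc B by (subst prod.insert) auto
    also have "\<dots> = M c $ y $ e (\<sigma> c) * (M b $ e b $ y * (\<Prod>a\<in>?C. M a $ e a $ e (\<sigma> a)))"
      using assms pC by (subst prod.insert) auto
    finally show "(\<Prod>a\<in>insert c ?B. M a $ (e(c := y)) a $ (e(c := y)) (\<sigma> a))
      = (M b $ e b $ y * M c $ y $ e (\<sigma> c)) * (\<Prod>a\<in>?C. M a $ e a $ e (\<sigma> a))"
      by (simp add: mult_ac)
  qed
  also have "\<dots> = (\<Sum>e\<in>?B \<rightarrow>\<^sub>E UNIV. (M b ** M c) $ e b $ e (\<sigma> c) * (\<Prod>a\<in>?C. M a $ e a $ e (\<sigma> a)))"
    by (simp add: matrix_matrix_mult_def sum_distrib_right)
  also have "\<dots> = psum ?B (bypass c \<sigma>) (M(b := M b ** M c))"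
    unfolding psum_def
  proof (intro sum.cong refl)
    fix e
    have "(\<Prod>a\<in>?C. (M(b := M b ** M c)) a $ e a $ e (bypass c \<sigma> a)) = (\<Prod>a\<in>?C. M a $ e a $ e (\<sigma> a))"
      by (rule prod.cong[OF refl]) (use by1 in auto)
    then show "(M b ** M c) $ e b $ e (\<sigma> c) * (\<Prod>a\<in>?C. M a $ e a $ e (\<sigma> a))
      = (\<Prod>a\<in>?B. (M(b := M b ** M c)) a $ e a $ e (bypass c \<sigma> a))"
      using assms by2 by (subst B, subst prod.insert) auto
  qed
  finally show ?thesis .
qed

text \<open>The left-hand side of the fundamental trace identity, the multilinear form of the Cayley-Hamilton theorem.\<close>

definition fti :: "nat set \<Rightarrow> (nat \<Rightarrow> ('a::field)^'n::finite^'n) \<Rightarrow> 'a" where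
  "fti A M = (\<Sum>\<sigma> | \<sigma> permutes A. of_int (sign \<sigma>) * psum A \<sigma> M)"

lemma fti_empty [simp]: "fti {} M = 1"
  by (simp add: fti_def)

lemma sign_bypass:
  assumes "finite A" "\<sigma> permutes A" "c \<in> A" "\<sigma> c \<noteq> c"
  shows "sign (bypass c \<sigma>) = - sign \<sigma>"
proof -
  have "permutation \<sigma>" using assms permutation_permutes by blast
  then show ?thesis unfolding bypass_def using assms
    by (subst sign_compose) (auto simp: sign_swap_id permutation_swap_id)
qed

text \<open>Permutations are sorted by the image of \<open>b\<close>. A fixed point splits off a
  trace; if \<open>b\<close> goes to \<open>c\<close>, the matrix of \<open>c\<close> is merged into
  that of \<open>b\<close>, and shortening the cycle reverses the sign. Iterating this eliminates
  the slots one by one, which is how the alternations below are evaluated.\<close>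

lemma fti_rec:
  assumes "finite A" "b \<in> A"
  shows "fti A M = mtrace (M b) * fti (A - {b}) M - (\<Sum>c\<in>A - {b}. fti (A - {c}) (M(b := M b ** M c)))"
proof -
  let ?g = "\<lambda>\<sigma>. of_int (sign \<sigma>) * psum A \<sigma> M"
  have fp: "finite {\<sigma>. \<sigma> permutes A}" using assms finite_permutations by auto
  have "fti A M = (\<Sum>c\<in>A. \<Sum>\<sigma>\<in>{\<sigma>. \<sigma> permutes A \<and> \<sigma> b = c}. ?g \<sigma>)"
  proof -
    have sub: "(\<lambda>\<sigma>. \<sigma> b) ` {\<sigma>. \<sigma> permutes A} \<subseteq> A" using assms by (auto simp: permutes_in_image)
    show ?thesis unfolding fti_def using sum.group[OF fp assms(1) sub, of ?g] by simp
  qed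
  also have "\<dots> = (\<Sum>\<sigma>\<in>{\<sigma>. \<sigma> permutes A \<and> \<sigma> b = b}. ?g \<sigma>) + (\<Sum>c\<in>A - {b}. \<Sum>\<sigma>\<in>{\<sigma>. \<sigma> permutes A \<and> \<sigma> b = c}. ?g \<sigma>)"
    using assms by (rule sum.remove)
  also have "(\<Sum>\<sigma>\<in>{\<sigma>. \<sigma> permutes A \<and> \<sigma> b = b}. ?g \<sigma>) = mtrace (M b) * fti (A - {b}) M"
  proof -
    have "{\<sigma>. \<sigma> permutes A \<and> \<sigma> b = b} = {\<sigma>. \<sigma> permutes (A - {b})}"
      using permutes_superset[of _ A "A - {b}"] permutes_subset[of _ "A - {b}" A]
      by (auto simp: permutes_def)
    moreover have "(\<Sum>\<sigma>\<in>{\<sigma>. \<sigma> permutes A \<and> \<sigma> b = b}. ?g \<sigma>)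
      = (\<Sum>\<sigma>\<in>{\<sigma>. \<sigma> permutes A \<and> \<sigma> b = b}. mtrace (M b) * (of_int (sign \<sigma>) * psum (A - {b}) \<sigma> M))"
      by (rule sum.cong[OF refl]) (auto simp: psum_fixed_point[OF assms(1,2)])
    ultimately show ?thesis
      by (simp only: fti_def sum_distrib_left)
  qed
  also have "(\<Sum>c\<in>A - {b}. \<Sum>\<sigma>\<in>{\<sigma>. \<sigma> permutes A \<and> \<sigma> b = c}. ?g \<sigma>)
     = (\<Sum>c\<in>A - {b}. - fti (A - {c}) (M(b := M b ** M c)))"
  proof (rule sum.cong[OF refl])
    fix c assume c: "c \<in> A - {b}"
    have "(\<Sum>\<sigma>\<in>{\<sigma>. \<sigma> permutes A \<and> \<sigma> b = c}. ?g \<sigma>)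
       = (\<Sum>\<tau>\<in>{\<tau>. \<tau> permutes (A - {c})}. - (of_int (sign \<tau>) * psum (A - {c}) \<tau> (M(b := M b ** M c))))"
    \<comment> \<open>The inverse of removing \<open>c\<close> puts it back between \<open>b\<close>
      and \<open>\<tau> b\<close>.\<close>
    proof (rule sum.reindex_bij_witness[where j = "bypass c" and i = "\<lambda>\<tau>. Transposition.transpose c (\<tau> b) \<circ> \<tau>"])
      fix \<sigma> assume s: "\<sigma> \<in> {\<sigma>. \<sigma> permutes A \<and> \<sigma> b = c}"
      have cc: "\<sigma> c \<noteq> c" using s c inj_eq[OF permutes_inj[of \<sigma> A], of c b] by auto
      show "Transposition.transpose c (bypass c \<sigma> b) \<circ> bypass c \<sigma> = \<sigma>"
        using s by (auto simp: bypass_def fun_eq_iff)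
      show "bypass c \<sigma> \<in> {\<tau>. \<tau> permutes (A - {c})}"
        using bypass_permutes s c by auto
      show "- (of_int (sign (bypass c \<sigma>)) * psum (A - {c}) (bypass c \<sigma>) (M(b := M b ** M c))) = ?g \<sigma>"
        using s c cc psum_merge[OF assms, of \<sigma> c M] sign_bypass[OF assms(1), of \<sigma> c] by auto
    next
      fix \<tau> assume t: "\<tau> \<in> {\<tau>. \<tau> permutes (A - {c})}"
      let ?s = "Transposition.transpose c (\<tau> b) \<circ> \<tau>"
      have tc: "\<tau> c = c" using t by (auto simp: permutes_def)
      have "\<tau> b \<in> A - {c}" using t c assms permutes_in_image[of \<tau> "A - {c}" b] by auto
      then have "?s permutes A"
        using t c by (intro permutes_compose permutes_swap_id) (auto intro: permutes_subset)
      then show "?s \<in> {\<sigma>. \<sigma> permutes A \<and> \<sigma> b = c}" by auto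
      show "bypass c ?s = \<tau>"
        by (auto simp: bypass_def tc fun_eq_iff)
    qed
    then show "(\<Sum>\<sigma>\<in>{\<sigma>. \<sigma> permutes A \<and> \<sigma> b = c}. ?g \<sigma>) = - fti (A - {c}) (M(b := M b ** M c))"
      by (simp add: fti_def sum_negf)
  qed
  finally show ?thesis by (simp add: sum_negf)
qed

text \<open>When indices are assigned to more than \<open>n\<close> slots, two slots share an index.
  The transposition of these two preserves the product of entries and reverses the sign, so the
  signed sum cancels for each assignment.\<close>

lemma fundamental_trace_identity:
  assumes "finite A" "card A > CARD('n)"
  shows "fti A (M :: nat \<Rightarrow> ('a::field_char_0)^'n::finite^'n) = 0"
proof -
  have "(\<Sum>\<sigma> | \<sigma> permutes A. of_int (sign \<sigma>) * (\<Prod>a\<in>A. M a $ i a $ i (\<sigma> a))) = 0" (is "?S = 0") for i :: "nat \<Rightarrow> 'n"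
  proof -
    have "\<not> inj_on i A"
      using assms card_inj_on_le[of i A UNIV] by auto
    then obtain p q where pq: "p \<in> A" "q \<in> A" "p \<noteq> q" "i p = i q" by (auto simp: inj_on_def)
    let ?t = "Transposition.transpose p q"
    have t: "?t permutes A" using pq by (intro permutes_swap_id)
    have it: "i (?t x) = i x" for x using pq by (auto simp: Transposition.transpose_def)
    have "?S = (\<Sum>\<sigma> | \<sigma> permutes A. of_int (sign (?t \<circ> \<sigma>)) * (\<Prod>a\<in>A. M a $ i a $ i ((?t \<circ> \<sigma>) a)))"
      by (rule setum_permutations_compose_left[OF t])
    also have "\<dots> = (\<Sum>\<sigma> | \<sigma> permutes A. - (of_int (sign \<sigma>) * (\<Prod>a\<in>A. M a $ i a $ i (\<sigma> a))))"
    proof (rule sum.cong[OF refl])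
      fix \<sigma> assume "\<sigma> \<in> {\<sigma>. \<sigma> permutes A}"
      then have "permutation \<sigma>" using assms permutation_permutes by blast
      then have "sign (?t \<circ> \<sigma>) = - sign \<sigma>"
        using pq by (simp add: sign_compose permutation_swap_id sign_swap_id)
      then show "of_int (sign (?t \<circ> \<sigma>)) * (\<Prod>a\<in>A. M a $ i a $ i ((?t \<circ> \<sigma>) a))
         = - (of_int (sign \<sigma>) * (\<Prod>a\<in>A. M a $ i a $ i (\<sigma> a)))"
        by (simp add: it)
    qed
    finally have "?S + ?S = 0" by (simp add: sum_negf eq_neg_iff_add_eq_0)
    then show ?thesis by (simp add: mult_2[symmetric] del: mult_2)
  qed
  then show ?thesis
    unfolding fti_def psum_def sum_distrib_left by (subst sum.swap) simp
qed

section \<open>Alternating the trace identity with even words in the slots\<close>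

definition mprod :: "(('a::comm_ring_1)^'n::finite^'n) list \<Rightarrow> 'a^'n^'n" where
  "mprod l = foldr (**) l (mat 1)"

lemma mprod_simps [simp]: "mprod [] = mat 1" "mprod (x # l) = x ** mprod l"
  by (simp_all add: mprod_def)

lemma wd_mprod: "wd l v = mprod (map v l)"
  by (induction l) auto

lemma mprod_append: "mprod (l @ l') = mprod l ** mprod l'"
  by (induction l) (auto simp: matrix_mul_assoc)

lemma fti_cong:
  assumes "\<And>a. a \<in> A \<Longrightarrow> M a = M' a" shows "fti A M = fti A M'"
proof -
  have "psum A \<sigma> M = psum A \<sigma> M'" for \<sigma>
    unfolding psum_def by (intro sum.cong refl prod.cong) (use assms in auto)
  then show ?thesis by (simp add: fti_def)
qed

text \<open>Slot \<open>z\<close> carries an additional factor \<open>E\<close>; for \<open>E\<close> a matrix unit, the trace of a product through this slot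
  is a matrix entry.\<close>

definition lslot :: "'a::field^'n::finite^'n \<Rightarrow> nat \<Rightarrow> (nat \<Rightarrow> nat list) \<Rightarrow> (nat \<Rightarrow> 'a^'n^'n) \<Rightarrow> nat \<Rightarrow> 'a^'n^'n" where
  "lslot E z L v = (\<lambda>a. if a = z then E ** wd (L a) v else wd (L a) v)"

lemma lslot_merge:
  "c \<noteq> z \<Longrightarrow> (lslot E z L v)(b := lslot E z L v b ** lslot E z L v c) = lslot E z (L(b := L b @ L c)) v"
  by (auto simp: lslot_def fun_eq_iff matrix_mul_assoc)

text \<open>Moving the first letter of a word to its end leaves the trace unchanged, but for a word
  of even length it is an odd permutation of the slots. \<open>R\<close> stands for the factors that
  accompany the trace.\<close>

lemma alt_even_trace_zero:
  fixes R :: "(('a::field_char_0)^'n::finite^'n) list \<Rightarrow> 'a"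
  assumes "perm_list (r @ l)" "length (r @ l) = m" "even (length l)" "l \<noteq> []"
  shows "alt m (\<lambda>v. R (map v r) * mtrace (wd l v)) v = 0"
proof -
  obtain x xs where l: "l = x # xs" using assms by (cases l) auto
  let ?\<Psi> = "\<lambda>L. R (take (length r) L) * mtrace (mprod (drop (length r) L))"
  have p: "perm_list (r @ x # xs)" using assms l by simp
  then have p': "perm_list (r @ xs @ [x])" by (rule perm_list_permute) simp
  have s: "lsgn (r @ xs @ [x]) = - lsgn (r @ x # xs)"
    using lsgn_move_one[of r x xs "[]"] p assms(3) l by simp
  have "alt m (\<lambda>v. R (map v r) * mtrace (wd l v)) v = alt m (\<lambda>v. ?\<Psi> (map v (r @ x # xs))) v"
    by (simp add: l wd_mprod)
  also have "\<dots> = of_int (lsgn (r @ x # xs)) * alt m (\<lambda>v. ?\<Psi> (map v [0..<m])) v"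
    by (rule alt_perm_list[OF p]) (use assms l in simp)
  finally have 1: "alt m (\<lambda>v. R (map v r) * mtrace (wd l v)) v = of_int (lsgn (r @ x # xs)) * alt m (\<lambda>v. ?\<Psi> (map v [0..<m])) v" .
  have "alt m (\<lambda>v. R (map v r) * mtrace (wd l v)) v = alt m (\<lambda>v. ?\<Psi> (map v (r @ xs @ [x]))) v"
    unfolding l wd_Cons by (subst mtrace_mult_commute) (simp add: wd_mprod mprod_append)
  also have "\<dots> = of_int (lsgn (r @ xs @ [x])) * alt m (\<lambda>v. ?\<Psi> (map v [0..<m])) v"
    by (rule alt_perm_list[OF p']) (use assms l in simp)
  finally have "alt m (\<lambda>v. R (map v r) * mtrace (wd l v)) v = - alt m (\<lambda>v. R (map v r) * mtrace (wd l v)) v"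
    unfolding s 1 by simp
  then have "2 * alt m (\<lambda>v. R (map v r) * mtrace (wd l v)) v = 0"
    by (simp only: eq_neg_iff_add_eq_0 mult_2)
  then show ?thesis by simp
qed

lemma list_remove:
  assumes "distinct bs" "c \<in> set bs"
  obtains b1 b2 where "bs = b1 @ c # b2" "c \<notin> set b1" "c \<notin> set b2" "set (b1 @ b2) = set bs - {c}" "distinct (b1 @ b2)"
proof -
  from split_list[OF assms(2)] obtain b1 b2 where "bs = b1 @ c # b2" by auto
  then show ?thesis using assms by (intro that[of b1 b2]) auto
qed

lemma concat_map_upd: "b \<notin> set bs \<Longrightarrow> concat (map (L(b := x)) bs) = concat (map L bs)"
  by (induction bs) auto

text \<open>In the recursion \<open>fti_rec\<close> every trace that splits off is the trace of an even word.\<close>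

lemma alt_fti_even_zero:
  fixes R :: "(('a::field_char_0)^'n::finite^'n) list \<Rightarrow> 'a"
  assumes "distinct bs" "bs \<noteq> []" "\<And>a. a \<in> set bs \<Longrightarrow> even (length (L a)) \<and> L a \<noteq> []"
    "perm_list (r @ concat (map L bs))" "length (r @ concat (map L bs)) = m"
  shows "alt m (\<lambda>v. R (map v r) * fti (set bs) (\<lambda>a. wd (L a) v)) v = 0"
  using assms
proof (induction "length bs" arbitrary: bs L r R rule: less_induct)
  case less
  obtain b bs' where bs: "bs = b # bs'" using less.prems by (cases bs) auto
  have b: "b \<notin> set bs'" "distinct bs'" using less.prems bs by auto
  have rec: "fti (set bs) (\<lambda>a. wd (L a) v) = mtrace (wd (L b) v) * fti (set bs') (\<lambda>a. wd (L a) v)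
     - (\<Sum>c\<in>set bs'. fti (set bs - {c}) (\<lambda>a. wd ((L(b := L b @ L c)) a) v))" for v :: "nat \<Rightarrow> 'a^'n^'n"
  proof -
    have "(\<lambda>a. wd (L a) v)(b := wd (L b) v ** wd (L c) v) = (\<lambda>a. wd ((L(b := L b @ L c)) a) v)" for c
      by (auto simp: fun_eq_iff)
    moreover have "set bs - {b} = set bs'" using bs b by auto
    ultimately show ?thesis using fti_rec[of "set bs" b "\<lambda>a. wd (L a) v"] bs by simp
  qed
  have 1: "alt m (\<lambda>v. R (map v r) * (mtrace (wd (L b) v) * fti (set bs') (\<lambda>a. wd (L a) v))) v = 0"
  proof (cases "bs' = []")
    case True
    have "alt m (\<lambda>v. R (map v r) * mtrace (wd (L b) v)) v = 0"
      by (rule alt_even_trace_zero) (use less.prems bs True in auto)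
    then show ?thesis using True by simp
  next
    case False
    \<comment> \<open>The trace that split off joins the accompanying factor, which now reads
      \<open>r @ L b\<close>; the induction hypothesis covers the remaining slots.\<close>
    let ?R = "\<lambda>X. R (take (length r) X) * mtrace (mprod (drop (length r) X))"
    have "alt m (\<lambda>v. ?R (map v (r @ L b)) * fti (set bs') (\<lambda>a. wd (L a) v)) v = 0"
      by (rule less.hyps) (use less.prems bs b False in auto)
    then show ?thesis by (simp add: wd_mprod mult.assoc)
  qed
  have 2: "alt m (\<lambda>v. R (map v r) * fti (set bs - {c}) (\<lambda>a. wd ((L(b := L b @ L c)) a) v)) v = 0"
    if c: "c \<in> set bs'" for c
  proof -
    obtain b1 b2 where b12: "bs' = b1 @ c # b2" "c \<notin> set b1" "c \<notin> set b2" "set (b1 @ b2) = set bs' - {c}" "distinct (b1 @ b2)"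
      using list_remove[OF b(2) c] by blast
    have cb: "c \<noteq> b" using c b by auto
    let ?L = "L(b := L b @ L c)"
    have st: "set bs - {c} = set (b # b1 @ b2)" using bs b12 cb by auto
    \<comment> \<open>It suffices to preserve the multiset of slots: the alternation is claimed to
      be zero, whatever the sign of the new order.\<close>
    have ms: "mset (r @ concat (map ?L (b # b1 @ b2))) = mset (r @ concat (map L bs))"
      using b b12 cb by (simp add: bs concat_map_upd)
    show ?thesis
      unfolding st
    proof (rule less.hyps)
      show "perm_list (r @ concat (map ?L (b # b1 @ b2)))"
        by (rule perm_list_permute[OF less.prems(4) ms])
      show "length (r @ concat (map ?L (b # b1 @ b2))) = m"
        using mset_eq_length[OF ms] less.prems(5) by (simp only:)
      show "even (length (?L a)) \<and> ?L a \<noteq> []" if "a \<in> set (b # b1 @ b2)" for a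
        using less.prems(3)[of a] less.prems(3)[of b] less.prems(3)[of c] that bs b12(1) by (cases "a = b") simp_all
      show "distinct (b # b1 @ b2)" using b b12 by simp
    qed (simp_all add: bs b12(1))
  qed
  show ?case
    unfolding rec by (simp add: right_diff_distrib alt_diff sum_distrib_left alt_sum 1 2 del: fun_upd_apply)
qed

text \<open>Only the terms in which all even words are merged into the slot \<open>z\<close> survive the alternation.\<close>

lemma alt_fti_special:
  fixes R :: "(('a::field_char_0)^'n::finite^'n) list \<Rightarrow> 'a"
  assumes "distinct bs" "z \<notin> set bs" "\<And>a. a \<in> set bs \<Longrightarrow> even (length (L a)) \<and> L a \<noteq> []"
    "perm_list (r @ L z @ concat (map L bs))" "length (r @ L z @ concat (map L bs)) = m"
  shows "alt m (\<lambda>v. R (map v r) * fti (insert z (set bs)) (lslot E z L v)) v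
    = (-1) ^ length bs * fact (length bs) * of_int (lsgn (r @ L z @ concat (map L bs)))
      * alt m (\<lambda>v. R (map v [0..<length r]) * mtrace (E ** wd [length r..<m] v)) v"
  using assms
proof (induction "length bs" arbitrary: bs L)
  case 0
  let ?\<Psi> = "\<lambda>X. R (take (length r) X) * mtrace (E ** mprod (drop (length r) X))"
  have "fti {z} (lslot E z L v) = mtrace (E ** wd (L z) v)" for v :: "nat \<Rightarrow> 'a^'n^'n"
    using fti_rec[of "{z}" z "lslot E z L v"] by (simp add: lslot_def)
  then have "alt m (\<lambda>v. R (map v r) * fti (insert z (set bs)) (lslot E z L v)) v
    = alt m (\<lambda>v. ?\<Psi> (map v (r @ L z))) v"
    using 0 by (simp add: wd_mprod)
  also have "\<dots> = of_int (lsgn (r @ L z)) * alt m (\<lambda>v. ?\<Psi> (map v [0..<m])) v"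
    by (rule alt_perm_list) (use 0 in auto)
  also have "(\<lambda>v. ?\<Psi> (map v [0..<m])) = (\<lambda>v. R (map v [0..<length r]) * mtrace (E ** wd [length r..<m] v))"
    using 0 by (auto simp: wd_mprod take_map drop_map)
  finally show ?case using 0 by simp
next
  case (Suc k)
  let ?V = "alt m (\<lambda>v. R (map v [0..<length r]) * mtrace (E ** wd [length r..<m] v)) v"
  let ?s = "lsgn (r @ L z @ concat (map L bs))"
  have rec: "fti (insert z (set bs)) (lslot E z L v) = mtrace (E ** wd (L z) v) * fti (set bs) (\<lambda>a. wd (L a) v)
     - (\<Sum>c\<in>set bs. fti (insert z (set bs - {c})) (lslot E z (L(z := L z @ L c)) v))" for v :: "nat \<Rightarrow> 'a^'n^'n"
  proof -
    have d: "insert z (set bs) - {z} = set bs" using Suc.prems by auto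
    have e: "fti (set bs) (lslot E z L v) = fti (set bs) (\<lambda>a. wd (L a) v)"
      by (rule fti_cong) (use Suc.prems in \<open>auto simp: lslot_def\<close>)
    have "fti (insert z (set bs)) (lslot E z L v) = mtrace (lslot E z L v z) * fti (set bs) (lslot E z L v)
     - (\<Sum>c\<in>set bs. fti (insert z (set bs) - {c}) ((lslot E z L v)(z := lslot E z L v z ** lslot E z L v c)))"
      using fti_rec[of "insert z (set bs)" z "lslot E z L v"] d by simp
    also have "(\<Sum>c\<in>set bs. fti (insert z (set bs) - {c}) ((lslot E z L v)(z := lslot E z L v z ** lslot E z L v c)))
       = (\<Sum>c\<in>set bs. fti (insert z (set bs - {c})) (lslot E z (L(z := L z @ L c)) v))"
    proof (rule sum.cong[OF refl])
      fix c assume "c \<in> set bs"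
      then have cz: "c \<noteq> z" using Suc.prems by auto
      then have "insert z (set bs) - {c} = insert z (set bs - {c})" by auto
      then show "fti (insert z (set bs) - {c}) ((lslot E z L v)(z := lslot E z L v z ** lslot E z L v c))
        = fti (insert z (set bs - {c})) (lslot E z (L(z := L z @ L c)) v)"
        using lslot_merge[OF cz, of E L v z] by simp
    qed
    finally show ?thesis unfolding e by (simp add: lslot_def)
  qed
  have 1: "alt m (\<lambda>v. R (map v r) * (mtrace (E ** wd (L z) v) * fti (set bs) (\<lambda>a. wd (L a) v))) v = 0"
  proof -
    \<comment> \<open>If the cycle of \<open>z\<close> closes while even words are left, these form
      a trace identity expression in even words alone, which alternates to zero.\<close>
    let ?R = "\<lambda>X. R (take (length r) X) * mtrace (E ** mprod (drop (length r) X))"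
    have "alt m (\<lambda>v. ?R (map v (r @ L z)) * fti (set bs) (\<lambda>a. wd (L a) v)) v = 0"
      by (rule alt_fti_even_zero) (use Suc.prems Suc.hyps(2) in auto)
    then show ?thesis by (simp add: wd_mprod mult.assoc)
  qed
  have 2: "alt m (\<lambda>v. R (map v r) * fti (insert z (set bs - {c})) (lslot E z (L(z := L z @ L c)) v)) v
     = (-1) ^ k * fact k * of_int ?s * ?V" if c: "c \<in> set bs" for c
  proof -
    obtain b1 b2 where b12: "bs = b1 @ c # b2" "c \<notin> set b1" "c \<notin> set b2" "set (b1 @ b2) = set bs - {c}" "distinct (b1 @ b2)"
      using list_remove[OF Suc.prems(1) c] by blast
    let ?L = "L(z := L z @ L c)"
    have cc: "concat (map ?L (b1 @ b2)) = concat (map L b1) @ concat (map L b2)"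
      using b12 Suc.prems by (subst concat_map_upd) auto
    have n: "r @ ?L z @ concat (map ?L (b1 @ b2)) = (r @ L z) @ L c @ concat (map L b1) @ concat (map L b2)"
      unfolding cc by simp
    have p0: "perm_list ((r @ L z) @ concat (map L b1) @ L c @ concat (map L b2))"
      using Suc.prems(4) b12 by simp
    then have p1: "perm_list (r @ ?L z @ concat (map ?L (b1 @ b2)))"
      unfolding n by (rule perm_list_permute) simp
    \<comment> \<open>The word that moves next to that of slot \<open>z\<close> has even length and
      passes the others without a sign.\<close>
    have sg: "lsgn (r @ ?L z @ concat (map ?L (b1 @ b2))) = ?s"
      unfolding n using lsgn_move_block[OF p0] Suc.prems(3)[OF c] b12 by simp
    have "alt m (\<lambda>v. R (map v r) * fti (insert z (set (b1 @ b2))) (lslot E z ?L v)) v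
     = (-1) ^ length (b1 @ b2) * fact (length (b1 @ b2)) * of_int (lsgn (r @ ?L z @ concat (map ?L (b1 @ b2)))) * ?V"
    proof (rule Suc.hyps(1))
      show "k = length (b1 @ b2)" using Suc.hyps(2) b12 by simp
      show "length (r @ ?L z @ concat (map ?L (b1 @ b2))) = m"
        unfolding n using Suc.prems(5) b12 by simp
    qed (use p1 b12 Suc.prems in auto)
    then show ?thesis unfolding sg b12(4) using b12(1) Suc.hyps(2) by simp
  qed
  \<comment> \<open>Every choice of \<open>c\<close> contributes the same value. Their number turns
    \<open>k!\<close> into \<open>(k + 1)!\<close>, and the minus sign of the recursion supplies one
    more factor -1.\<close>
  have "alt m (\<lambda>v. R (map v r) * fti (insert z (set bs)) (lslot E z L v)) v
     = - (\<Sum>c\<in>set bs. (-1) ^ k * fact k * of_int ?s * ?V)"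
    unfolding rec by (simp add: right_diff_distrib alt_diff sum_distrib_left alt_sum 1 2)
  also have "\<dots> = (-1) ^ length bs * fact (length bs) * of_int ?s * ?V"
    using distinct_card[OF Suc.prems(1)] Suc.hyps(2)[symmetric] by (simp add: mult_ac)
  finally show ?case .
qed

section \<open>The relations between X and the trace forms\<close>

text \<open>In a permutation that survives the alternation every cycle contains \<open>z\<close> or
  \<open>y\<close>. Let \<open>k\<close> be the number of words of length 2. For each
  \<open>i\<close> there are \<open>k!\<close> permutations with \<open>i\<close> of these words in
  the cycle of \<open>z\<close> and the others in a separate cycle of \<open>y\<close>; a further
  \<open>(k + 1)!\<close> permutations put everything into one cycle and have the opposite sign.
  This is the origin of the common factor \<open>k!\<close> and of the coefficient
  \<open>k + 1\<close>.\<close>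

lemma alt_fti_special_odd:
  fixes E :: "('a::field_char_0)^'n::finite^'n"
  assumes "distinct bs" "z \<notin> set bs" "y \<notin> set bs" "y \<noteq> z" "\<And>a. a \<in> set bs \<Longrightarrow> length (L a) = 2"
    "perm_list (L z @ L y @ concat (map L bs))" "length (L z @ L y @ concat (map L bs)) = m"
  shows "alt m (\<lambda>v. fti (insert z (insert y (set bs))) (lslot E z L v)) v
    = (-1) ^ length bs * fact (length bs) * of_int (lsgn (L z @ L y @ concat (map L bs))) *
      ((\<Sum>i\<le>length bs. alt m (\<lambda>v. mtrace (E ** wd [0..<length (L z) + 2 * i] v) * mtrace (wd [length (L z) + 2 * i..<m] v)) v)
       - of_nat (length bs + 1) * alt m (\<lambda>v. mtrace (E ** wd [0..<m] v)) v)"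
  using assms
proof (induction "length bs" arbitrary: bs L rule: less_induct)
  case (less bs L)
  let ?k = "length bs" and ?q = "length (L z)"
  let ?V = "\<lambda>j. alt m (\<lambda>v. mtrace (E ** wd [0..<j] v) * mtrace (wd [j..<m] v)) v"
  let ?F = "alt m (\<lambda>v. mtrace (E ** wd [0..<m] v)) v"
  let ?s = "of_int (lsgn (L z @ L y @ concat (map L bs))) :: 'a"
  let ?A = "insert z (insert y (set bs))"
  have even: "even (length (L a)) \<and> L a \<noteq> []" if "a \<in> set bs" for a
    using less.prems(5)[OF that] by auto
  have rec: "fti ?A (lslot E z L v) = mtrace (E ** wd (L z) v) * fti (insert y (set bs)) (lslot (mat 1) y L v)
     - (fti (insert z (set bs)) (lslot E z (L(z := L z @ L y)) v)
     + (\<Sum>c\<in>set bs. fti (insert z (insert y (set bs - {c}))) (lslot E z (L(z := L z @ L c)) v)))" for v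
  proof -
    have d: "?A - {z} = insert y (set bs)" using less.prems by auto
    have e: "fti (insert y (set bs)) (lslot E z L v) = fti (insert y (set bs)) (lslot (mat 1) y L v)"
      by (rule fti_cong) (use less.prems in \<open>auto simp: lslot_def\<close>)
    have m: "fti (?A - {c}) ((lslot E z L v)(z := lslot E z L v z ** lslot E z L v c))
        = fti (?A - {c}) (lslot E z (L(z := L z @ L c)) v)" if "c \<in> insert y (set bs)" for c
    proof -
      have "c \<noteq> z" using that less.prems by auto
      then show ?thesis by (subst lslot_merge) auto
    qed
    have "fti ?A (lslot E z L v) = mtrace (lslot E z L v z) * fti (insert y (set bs)) (lslot E z L v)
     - (\<Sum>c\<in>insert y (set bs). fti (?A - {c}) ((lslot E z L v)(z := lslot E z L v z ** lslot E z L v c)))"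
      using fti_rec[of ?A z "lslot E z L v"] d by simp
    also have "(\<Sum>c\<in>insert y (set bs). fti (?A - {c}) ((lslot E z L v)(z := lslot E z L v z ** lslot E z L v c)))
       = (\<Sum>c\<in>insert y (set bs). fti (?A - {c}) (lslot E z (L(z := L z @ L c)) v))"
      by (rule sum.cong[OF refl m])
    also have "\<dots> = fti (?A - {y}) (lslot E z (L(z := L z @ L y)) v)
        + (\<Sum>c\<in>set bs. fti (?A - {c}) (lslot E z (L(z := L z @ L c)) v))"
      by (rule sum.insert) (use less.prems in auto)
    also have "?A - {y} = insert z (set bs)" using less.prems by auto
    also have "(\<Sum>c\<in>set bs. fti (?A - {c}) (lslot E z (L(z := L z @ L c)) v))
       = (\<Sum>c\<in>set bs. fti (insert z (insert y (set bs - {c}))) (lslot E z (L(z := L z @ L c)) v))"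
    proof (rule sum.cong[OF refl])
      fix c assume "c \<in> set bs"
      then have "?A - {c} = insert z (insert y (set bs - {c}))" using less.prems by auto
      then show "fti (?A - {c}) (lslot E z (L(z := L z @ L c)) v)
        = fti (insert z (insert y (set bs - {c}))) (lslot E z (L(z := L z @ L c)) v)" by simp
    qed
    moreover have "lslot E z L v z = E ** wd (L z) v" by (simp add: lslot_def)
    ultimately show ?thesis unfolding e by (simp only:)
  qed
  \<comment> \<open>The cycle of \<open>z\<close> closes. Slot \<open>y\<close> becomes the
    distinguished slot for the remaining words, with factor \<open>mat 1\<close>.\<close>
  have 1: "alt m (\<lambda>v. mtrace (E ** wd (L z) v) * fti (insert y (set bs)) (lslot (mat 1) y L v)) v
     = (-1) ^ ?k * fact ?k * ?s * ?V ?q"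
    using alt_fti_special[of bs y L "L z" m "\<lambda>X. mtrace (E ** mprod X)" "mat 1" v] less.prems even
    by (simp add: wd_mprod)
  \<comment> \<open>Slot \<open>z\<close> absorbs \<open>y\<close>, after which only even words are
    left to be merged into it.\<close>
  have 2: "alt m (\<lambda>v. fti (insert z (set bs)) (lslot E z (L(z := L z @ L y)) v)) v
     = (-1) ^ ?k * fact ?k * ?s * ?F"
  proof -
    have c: "concat (map (L(z := L z @ L y)) bs) = concat (map L bs)"
      using less.prems by (intro concat_map_upd)
    have ev: "even (length ((L(z := L z @ L y)) a)) \<and> (L(z := L z @ L y)) a \<noteq> []" if "a \<in> set bs" for a
      using even[OF that] less.prems(2) that by auto
    show ?thesis
      using alt_fti_special[of bs z "L(z := L z @ L y)" "[]" m "\<lambda>X. 1" E v, OF _ _ ev, unfolded c] less.prems(1,2,6,7)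
      by simp
  qed
  \<comment> \<open>Slot \<open>z\<close> absorbs a word of length 2, which moves the cut between
    the two traces by 2. This accounts for \<open>Suc i\<close>.\<close>
  have 3: "alt m (\<lambda>v. fti (insert z (insert y (set bs - {c}))) (lslot E z (L(z := L z @ L c)) v)) v
     = (-1) ^ (?k - 1) * fact (?k - 1) * ?s * ((\<Sum>i\<le>?k - 1. ?V (?q + 2 * Suc i)) - of_nat ?k * ?F)" if c: "c \<in> set bs" for c
  proof -
    obtain b1 b2 where b12: "bs = b1 @ c # b2" "c \<notin> set b1" "c \<notin> set b2" "set (b1 @ b2) = set bs - {c}" "distinct (b1 @ b2)"
      using list_remove[OF less.prems(1) c] by blast
    let ?L = "L(z := L z @ L c)"
    have zy: "?L y = L y" "?L z = L z @ L c" using less.prems by auto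
    have cc: "concat (map ?L (b1 @ b2)) = concat (map L b1) @ concat (map L b2)"
      using b12 less.prems by (subst concat_map_upd) auto
    have n: "?L z @ ?L y @ concat (map ?L (b1 @ b2)) = L z @ L c @ (L y @ concat (map L b1)) @ concat (map L b2)"
      unfolding cc zy by simp
    have p0: "perm_list (L z @ (L y @ concat (map L b1)) @ L c @ concat (map L b2))"
      using less.prems(6) b12 by simp
    then have p1: "perm_list (?L z @ ?L y @ concat (map ?L (b1 @ b2)))"
      unfolding n by (rule perm_list_permute) simp
    have "lsgn (L z @ L c @ (L y @ concat (map L b1)) @ concat (map L b2))
      = (-1) ^ (length (L y @ concat (map L b1)) * length (L c)) * lsgn (L z @ (L y @ concat (map L b1)) @ L c @ concat (map L b2))"
      by (rule lsgn_move_block[OF p0])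
    then have sg: "lsgn (?L z @ ?L y @ concat (map ?L (b1 @ b2))) = lsgn (L z @ L y @ concat (map L bs))"
      unfolding n using less.prems(5)[OF c] b12(1) by simp
    have l1: "length (b1 @ b2) + 1 = ?k" "length (b1 @ b2) = ?k - 1" using b12(1) by auto
    have lq: "length (?L z) + 2 * i = ?q + 2 * Suc i" for i using less.prems(5)[OF c] by simp
    have "alt m (\<lambda>v. fti (insert z (insert y (set (b1 @ b2)))) (lslot E z ?L v)) v
     = (-1) ^ length (b1 @ b2) * fact (length (b1 @ b2)) * of_int (lsgn (?L z @ ?L y @ concat (map ?L (b1 @ b2))))
       * ((\<Sum>i\<le>length (b1 @ b2). ?V (length (?L z) + 2 * i)) - of_nat (length (b1 @ b2) + 1) * ?F)"
    proof (rule less.hyps)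
      show "length (b1 @ b2) < length bs" using b12(1) by simp
      show "length (?L z @ ?L y @ concat (map ?L (b1 @ b2))) = m"
        unfolding n using less.prems(7) b12 by simp
      show "length (?L a) = 2" if "a \<in> set (b1 @ b2)" for a
        using less.prems(2,5) that b12 by auto
    qed (use p1 b12 less.prems in auto)
    then show ?thesis unfolding sg b12(4) lq l1(1) unfolding l1(2) .
  qed
  have "alt m (\<lambda>v. fti ?A (lslot E z L v)) v = (-1) ^ ?k * fact ?k * ?s * ?V ?q - ((-1) ^ ?k * fact ?k * ?s * ?F
     + (\<Sum>c\<in>set bs. (-1) ^ (?k - 1) * fact (?k - 1) * ?s * ((\<Sum>i\<le>?k - 1. ?V (?q + 2 * Suc i)) - of_nat ?k * ?F)))"
    unfolding rec alt_diff alt_add alt_sum 1 2 by (simp add: 3 del: sum_constant fun_upd_apply)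
  also have "\<dots> = (-1) ^ ?k * fact ?k * ?s * ((\<Sum>i\<le>?k. ?V (?q + 2 * i)) - of_nat (?k + 1) * ?F)"
  \<comment> \<open>For \<open>?k = 0\<close> the sum over \<open>set bs\<close> is empty, so the
    truncated \<open>?k - 1\<close> has no effect. Otherwise the \<open>?k\<close> equal summands
    supply the terms with \<open>i \<ge> 1\<close>, and the closed cycle of \<open>z\<close> the
    term with \<open>i = 0\<close>.\<close>
  proof (cases ?k)
    case 0
    then show ?thesis by (simp add: algebra_simps)
  next
    case (Suc k')
    have "(\<Sum>i\<le>Suc k'. ?V (?q + 2 * i)) = ?V ?q + (\<Sum>i\<le>k'. ?V (?q + 2 * Suc i))"
      by (subst sum.atMost_Suc_shift) simp
    then show ?thesis
      using distinct_card[OF less.prems(1)] unfolding Suc sum_constant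
      by (simp del: mult_Suc_right sum.atMost_Suc) (simp add: algebra_simps)
  qed
  finally show ?case .
qed

lemma mtrace_munit: "mtrace (munit (q, p) ** Y) = Y $ p $ q"
proof -
  have "mtrace (munit (q, p) ** Y) = (\<Sum>i\<in>UNIV. \<Sum>j\<in>UNIV. if j = p then (if i = q then Y $ j $ i else 0) else 0)"
    unfolding mtrace_def matrix_matrix_mult_def munit_def vec_lambda_beta by (intro sum.cong refl) simp
  then show ?thesis by simp
qed

lemma fpow_Xf_2n: "fpow Xf (2 * CARD('n)) = (0 :: ('a::field_char_0,'n::finite) mform)"
proof (rule mform_eqI)
  fix k p q and v :: "nat \<Rightarrow> 'a^'n^'n"
  let ?n = "CARD('n)" and ?m = "2 * CARD('n)"
  \<comment> \<open>Slot 0 carries only the matrix unit, slots 1 to \<open>n\<close> two matrices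
    each: n + 1 slots in all, one more than the size of the matrices.\<close>
  define L where "L a = (if a = 0 then [] else [2 * a - 2, 2 * a - 1])" for a :: nat
  have c: "concat (map L [1..<Suc j]) = [0..<2 * j]" for j
    by (induction j) (auto simp: L_def)
  let ?E = "munit (q, p) :: 'a^'n^'n"
  have "alt ?m (\<lambda>v. fti (insert 0 (set [1..<Suc ?n])) (lslot ?E 0 L v)) v
    = (-1) ^ length [1..<Suc ?n] * fact (length [1..<Suc ?n]) * of_int (lsgn ([] @ L 0 @ concat (map L [1..<Suc ?n])))
      * alt ?m (\<lambda>v. mtrace (?E ** wd [0..<?m] v)) v"
  proof -
    have ev: "\<And>a. a \<in> set [1..<Suc ?n] \<Longrightarrow> even (length (L a)) \<and> L a \<noteq> []" by (auto simp: L_def)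
    have p: "perm_list ([] @ L 0 @ concat (map L [1..<Suc ?n]))" "length ([] @ L 0 @ concat (map L [1..<Suc ?n])) = ?m"
      unfolding c by (simp_all add: L_def perm_list_upt)
    show ?thesis
      using alt_fti_special[of "[1..<Suc ?n]" 0 L "[]" ?m "\<lambda>_. 1" ?E v, OF _ _ ev p] by simp
  qed
  moreover have "fti (insert 0 (set [1..<Suc ?n])) (lslot ?E 0 L v) = 0" for v
    by (rule fundamental_trace_identity) auto
  \<comment> \<open>The factor \<open>(-1)^n n!\<close> is cancelled here, which uses characteristic
    0.\<close>
  ultimately have "alt ?m (\<lambda>v. mtrace (?E ** wd [0..<?m] v)) v = 0"
    unfolding c by (simp add: L_def)
  then show "fpow Xf ?m k v $ p $ q = (0 :: ('a,'n) mform) k v $ p $ q"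
    by (simp add: fpow_Xf hform_nth fun_apply mtrace_munit)
qed

lemma fpow_Xf_zero:
  assumes "k \<ge> 2 * CARD('n)"
  shows "fpow Xf k = (0 :: ('a::field_char_0,'n::finite) mform)"
  using fpow_add[of "2 * CARD('n)" "k - 2 * CARD('n)", where 'a='a and 'n='n] assms
  by (simp add: fpow_Xf_2n)

text \<open>\<open>T_h\<close> is the trace of a standard polynomial of degree
  \<open>2h + 1 > 2n\<close>. The vanishing is needed because the invariant theory below produces
  trace forms of every odd degree.\<close>

lemma Tf_zero:
  assumes "h \<ge> CARD('n)"
  shows "Tf h = (0 :: ('a::field_char_0,'n::finite) mform)"
proof (rule mform_eqI)
  fix k p q and v :: "nat \<Rightarrow> 'a^'n^'n"
  let ?m = "2 * h + 1"
  have "alt ?m (\<lambda>v. wd [0..<?m] v $ i $ i) v = 0" for i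
    using fpow_Xf_zero[of ?m, where 'a='a and 'n='n] assms hform_nth[of ?m "wd [0..<?m]" ?m v i i]
    unfolding fpow_Xf by (simp add: fun_apply)
  then have "alt ?m (trw ?m) v = 0"
    unfolding trw_def mtrace_def alt_sum by simp
  then show "Tf h k v $ p $ q = (0 :: ('a,'n) mform) k v $ p $ q"
    by (simp add: Tf_sform sform_nth fun_apply)
qed

lemma trace_form_relation:
  "(\<Sum>i<CARD('n). fpow Xf (2 * i) \<and>\<^sub>w Tf (CARD('n) - i - 1))
    = fscale (of_nat CARD('n)) (fpow Xf (2 * CARD('n) - 1) :: ('a::field_char_0,'n::finite) mform)"
proof (rule mform_eqI)
  fix k p q and v :: "nat \<Rightarrow> 'a^'n^'n"
  let ?n = "CARD('n)" and ?m = "2 * CARD('n) - 1"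
  \<comment> \<open>Slot 0 carries the matrix unit, slot \<open>n\<close> a single matrix, and the
    other \<open>n - 1\<close> slots two matrices each. Again there are n + 1 slots, now of total
    degree \<open>2n - 1\<close>. With \<open>n - 1\<close> words of length 2, the coefficient of
    the single trace becomes \<open>n\<close>.\<close>
  define L where "L a = (if a = 0 then [] else if a = ?n then [0] else [2 * a - 1, 2 * a])" for a :: nat
  have n: "?n \<ge> 1" by (simp add: Suc_leI)
  have c': "concat (map L [1..<Suc j]) = [1..<2 * j + 1]" if "Suc j \<le> ?n" for j
    using that by (induction j) (auto simp: L_def)
  have c: "concat (map L [1..<?n]) = [1..<?m]"
  proof -
    have "Suc (?n - 1) = ?n" "2 * (?n - 1) + 1 = ?m" using n by linarith+
    then show ?thesis using c'[of "?n - 1"] by (simp only: order_refl)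
  qed
  let ?E = "munit (q, p) :: 'a^'n^'n"
  have L: "L 0 @ L ?n @ [1..<?m] = [0..<?m]"
  proof -
    have "0 < ?m" using n by linarith
    then have "[0..<?m] = 0 # [1..<?m]" by (subst upt_conv_Cons) auto
    then show ?thesis using n by (simp add: L_def)
  qed
  have sum: "(\<Sum>i\<le>?n - 1. alt ?m (\<lambda>v. mtrace (?E ** wd [0..<2 * i] v) * mtrace (wd [2 * i..<?m] v)) v)
     = of_nat ?n * alt ?m (\<lambda>v. mtrace (?E ** wd [0..<?m] v)) v"
  proof -
    have "alt ?m (\<lambda>v. fti (insert 0 (insert ?n (set [1..<?n]))) (lslot ?E 0 L v)) v
    = (-1) ^ length [1..<?n] * fact (length [1..<?n]) * of_int (lsgn (L 0 @ L ?n @ concat (map L [1..<?n]))) *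
      ((\<Sum>i\<le>length [1..<?n]. alt ?m (\<lambda>v. mtrace (?E ** wd [0..<length (L 0) + 2 * i] v) * mtrace (wd [length (L 0) + 2 * i..<?m] v)) v)
       - of_nat (length [1..<?n] + 1) * alt ?m (\<lambda>v. mtrace (?E ** wd [0..<?m] v)) v)"
    proof (rule alt_fti_special_odd)
      show "perm_list (L 0 @ L ?n @ concat (map L [1..<?n]))"
        unfolding c L by (rule perm_list_upt)
      show "length (L 0 @ L ?n @ concat (map L [1..<?n])) = ?m"
        unfolding c L by simp
    qed (use n in \<open>auto simp: L_def\<close>)
    moreover have "fti (insert 0 (insert ?n (set [1..<?n]))) (lslot ?E 0 L v) = 0" for v
    proof (rule fundamental_trace_identity)
      have "insert 0 (insert ?n (set [1..<?n])) = {0..?n}" by auto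
      then show "?n < card (insert 0 (insert ?n (set [1..<?n])))" by simp
    qed simp
    moreover have "length (L 0) = 0" by (simp add: L_def)
    ultimately show ?thesis unfolding c L using n by simp
  qed
  \<comment> \<open>The word with the matrix unit precedes the traced word, just as
    \<open>fpow Xf\<close> precedes \<open>Tf\<close> in the product, so no signs arise.\<close>
  have summand: "(fpow Xf (2 * i) \<and>\<^sub>w Tf (?n - i - 1)) k v $ p $ q
     = (if k = ?m then alt ?m (\<lambda>v. mtrace (?E ** wd [0..<2 * i] v) * mtrace (wd [2 * i..<?m] v)) v else 0)" if "i < ?n" for i
  proof -
    let ?h = "2 * (?n - i - 1) + 1"
    have l: "local_on (2 * i) (wd [0..<2 * i] :: _ \<Rightarrow> 'a^'n^'n)" by (rule local_on_wd) auto
    have d: "2 * i + ?h = ?m" using that by simp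
    have r: "(M ** mat c) $ p $ q = M $ p $ q * c" for M :: "'a^'n^'n" and c
      by (simp add: matrix_matrix_mult_def mat_def if_distrib cong: if_cong)
    have t: "trw ?h (shift (2 * i) v) = mtrace (wd [2 * i..<?m] v)" for v :: "nat \<Rightarrow> 'a^'n^'n"
      unfolding trw_def wd_shift[symmetric] d ..
    show ?thesis
      unfolding fpow_Xf Tf_sform sform_def wedge_hform[OF l] d hform_nth r t mtrace_munit ..
  qed
  have "(\<Sum>i<?n. fpow Xf (2 * i) \<and>\<^sub>w Tf (?n - i - 1)) k v $ p $ q
      = (\<Sum>i<?n. (fpow Xf (2 * i) \<and>\<^sub>w Tf (?n - i - 1) :: ('a,'n) mform) k v $ p $ q)"
    by (simp add: sum_fun_apply)
  also have "\<dots> = (\<Sum>i<?n. if k = ?m then alt ?m (\<lambda>v. mtrace (?E ** wd [0..<2 * i] v) * mtrace (wd [2 * i..<?m] v)) v else 0)"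
    by (rule sum.cong[OF refl]) (use summand in simp)
  also have "\<dots> = (if k = ?m then of_nat ?n * alt ?m (\<lambda>v. wd [0..<?m] v $ p $ q) v else 0)"
  proof -
    have "{..?n - 1} = {..<?n}" using n by (intro set_eqI, simp only: atMost_iff lessThan_iff, linarith)
    then show ?thesis using sum by (simp add: mtrace_munit)
  qed
  finally show "(\<Sum>i<?n. fpow Xf (2 * i) \<and>\<^sub>w Tf (?n - i - 1)) k v $ p $ q
     = fscale (of_nat ?n) (fpow Xf ?m) k v $ p $ q"
    by (simp add: fpow_Xf hform_nth)
qed

section \<open>Invariant multilinear functions\<close>

text \<open>Along a line through \<open>A\<close> in direction \<open>B\<close> a multilinear
  function is a polynomial in the parameter, so identities on infinitely many points of the line
  extend to all of it. \<open>C\<close> holds the slots that have not been treated yet.\<close>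

lemma mlin_poly_partial:
  fixes F :: "(nat \<Rightarrow> ('a::field)^'n::finite^'n) \<Rightarrow> 'a"
  assumes "mlin K F" "m \<le> K"
  shows "\<exists>p. \<forall>t. poly p t = F (\<lambda>i. if i < m then mat t ** B i + A i else C i)"
  using assms(2)
proof (induction m arbitrary: C)
  case 0
  then show ?case by (intro exI[of _ "[:F C:]"]) simp
next
  case (Suc m)
  have step: "F (\<lambda>i. if i < Suc m then mat t ** B i + A i else C i)
     = t * F (\<lambda>i. if i < m then mat t ** B i + A i else (C(m := B m)) i)
       + F (\<lambda>i. if i < m then mat t ** B i + A i else (C(m := A m)) i)" for t
  proof -
    let ?w = "\<lambda>i. if i < m then mat t ** B i + A i else C i"
    have e: "(\<lambda>i. if i < m then mat t ** B i + A i else (C(m := z)) i) = ?w(m := z)" for z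
      by (auto simp: fun_eq_iff)
    have "(\<lambda>i. if i < Suc m then mat t ** B i + A i else C i) = ?w(m := mat t ** B m + A m)"
      by (auto simp: fun_eq_iff less_Suc_eq)
    then show ?thesis unfolding e using assms(1) Suc.prems unfolding mlin_def by simp
  qed
  obtain p1 p2 where "\<forall>t. poly p1 t = F (\<lambda>i. if i < m then mat t ** B i + A i else (C(m := B m)) i)"
    "\<forall>t. poly p2 t = F (\<lambda>i. if i < m then mat t ** B i + A i else (C(m := A m)) i)"
    using Suc.IH[of "C(m := B m)"] Suc.IH[of "C(m := A m)"] Suc.prems by auto
  then show ?case
    unfolding step by (intro exI[of _ "pCons 0 p1 + p2"]) simp
qed

lemma mlin_poly:
  fixes F :: "(nat \<Rightarrow> ('a::field)^'n::finite^'n) \<Rightarrow> 'a"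
  assumes "mlin K F" "local_on K F"
  shows "\<exists>p. \<forall>t. poly p t = F (\<lambda>i. mat t ** B i + A i)"
proof -
  obtain p where "\<forall>t. poly p t = F (\<lambda>i. if i < K then mat t ** B i + A i else 0)"
    using mlin_poly_partial[OF assms(1) order_refl, of B A "\<lambda>_. 0"] by blast
  moreover have "F (\<lambda>i. if i < K then mat t ** B i + A i else 0) = F (\<lambda>i. mat t ** B i + A i)" for t
    using assms(2) by (simp add: local_on_def)
  ultimately show ?thesis by auto
qed

lemma det_poly: "\<exists>q. \<forall>t. poly q t = det (mat 1 + mat t ** (x :: ('a::field)^'n::finite^'n))"
proof -
  let ?q = "\<Sum>\<sigma> | \<sigma> permutes (UNIV :: 'n set). of_int (sign \<sigma>) * (\<Prod>i\<in>UNIV. [:(mat 1 :: 'a^'n^'n) $ i $ \<sigma> i, x $ i $ \<sigma> i:])"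
  have "poly ?q t = det (mat 1 + mat t ** x)" for t
    by (simp add: det_def poly_sum poly_prod of_int_poly)
  then show ?thesis by blast
qed

lemma mat_commute: "A ** mat c = mat c ** (A :: ('a::comm_ring_1)^'n::finite^'n)"
  by (simp add: vec_eq_iff) (simp add: matrix_matrix_mult_def mat_def if_distrib mult.commute cong: if_cong)

text \<open>\<open>det (1 + t x)\<close> is a polynomial in \<open>t\<close> with value 1 at 0, so
  it has finitely many zeros, and \<open>s = 1/t\<close> serves for all other nonzero
  \<open>t\<close>. Starting from the value at 0 avoids any statement about leading
  coefficients.\<close>

lemma infinite_invertible_shifts:
  fixes x :: "('a::field_char_0)^'n::finite^'n"
  shows "infinite {s. \<exists>g'. (mat s + x) ** g' = mat 1 \<and> g' ** (mat s + x) = mat 1}" (is "infinite ?S")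
proof
  assume fin: "finite ?S"
  obtain q where q: "\<And>t. poly q t = det (mat 1 + mat t ** x)" using det_poly[of x] by blast
  have "poly q 0 = 1"
  proof -
    have "mat 1 + mat 0 ** x = mat 1" by (simp add: vec_eq_iff)
    then show ?thesis unfolding q by simp
  qed
  then have "q \<noteq> 0" by auto
  then have "finite ({t. poly q t = 0} \<union> {0} \<union> inverse ` ?S)"
    using fin poly_roots_finite by blast
  moreover have "UNIV \<subseteq> {t. poly q t = 0} \<union> {0} \<union> inverse ` ?S"
  proof
    fix t :: 'a
    show "t \<in> {t. poly q t = 0} \<union> {0} \<union> inverse ` ?S"
    proof (cases "poly q t = 0 \<or> t = 0")
      case False
      then have t0: "t \<noteq> 0" and "invertible (mat 1 + mat t ** x)"
        using q by (auto simp: invertible_det_nz)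
      then obtain h where h: "(mat 1 + mat t ** x) ** h = mat 1" "h ** (mat 1 + mat t ** x) = mat 1"
        unfolding invertible_def by blast
      have m: "mat (inverse t) ** mat t = (mat 1 :: 'a^'n^'n)" "mat t ** mat (inverse t) = (mat 1 :: 'a^'n^'n)"
        using t0 by (simp_all add: mat_mult_mat)
      have e: "mat (inverse t) + x = mat (inverse t) ** (mat 1 + mat t ** x)"
        by (simp add: matrix_add_ldistrib matrix_mul_assoc m)
      have "(mat (inverse t) + x) ** (mat t ** h) = mat (inverse t) ** mat t ** ((mat 1 + mat t ** x) ** h)"
        unfolding e by (metis mat_commute matrix_mul_assoc)
      moreover have "(mat t ** h) ** (mat (inverse t) + x) = mat t ** mat (inverse t) ** (h ** (mat 1 + mat t ** x))"
        unfolding e by (metis mat_commute matrix_mul_assoc)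
      ultimately have "inverse t \<in> ?S" using h m by auto
      then show ?thesis using image_iff by fastforce
    qed auto
  qed
  ultimately have "finite (UNIV :: 'a set)" using finite_subset by blast
  then show False using infinite_UNIV_char_0 by blast
qed

text \<open>If \<open>g = t + x\<close> is invertible, invariance applied to the arguments
  \<open>v g\<close> gives \<open>F (g v) = F (v g)\<close>. Both sides are polynomials in
  \<open>t\<close> that agree at infinitely many points, hence also at \<open>t = 0\<close>, where
  \<open>g = x\<close> may be singular.\<close>

lemma invariant_all_matrices:
  fixes F :: "(nat \<Rightarrow> ('a::field_char_0)^'n::finite^'n) \<Rightarrow> 'a"
  assumes F: "mlin K F" "local_on K F"
    and inv: "\<And>g g' v. g ** g' = mat 1 \<Longrightarrow> g' ** g = mat 1 \<Longrightarrow> F (\<lambda>i. g ** v i ** g') = F v"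
  shows "F (\<lambda>i. x ** v i) = F (\<lambda>i. v i ** x)"
proof -
  obtain p where p: "\<And>t. poly p t = F (\<lambda>i. mat t ** v i + x ** v i)"
    using mlin_poly[OF F, of v "\<lambda>i. x ** v i"] by blast
  obtain q where q: "\<And>t. poly q t = F (\<lambda>i. mat t ** v i + v i ** x)"
    using mlin_poly[OF F, of v "\<lambda>i. v i ** x"] by blast
  have "poly p t = poly q t" if t: "(mat t + x) ** g' = mat 1" "g' ** (mat t + x) = mat 1" for t g'
  proof -
    have "F (\<lambda>i. (mat t + x) ** (v i ** (mat t + x)) ** g') = F (\<lambda>i. v i ** (mat t + x))"
      using inv[OF t] .
    moreover have "(mat t + x) ** (v i ** (mat t + x)) ** g' = (mat t + x) ** v i" for i
    proof -
      have "(mat t + x) ** (v i ** (mat t + x)) ** g' = (mat t + x) ** v i ** ((mat t + x) ** g')"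
        by (simp only: matrix_mul_assoc)
      then show ?thesis using t by simp
    qed
    ultimately show ?thesis
      unfolding p q by (simp add: matrix_add_ldistrib matrix_add_rdistr mat_commute)
  qed
  then have "{s. \<exists>g'. (mat s + x) ** g' = mat 1 \<and> g' ** (mat s + x) = mat 1} \<subseteq> {t. poly (p - q) t = 0}"
    by auto
  then have "infinite {t. poly (p - q) t = 0}"
    using infinite_invertible_shifts[of x] finite_subset by blast
  then have "p - q = 0" using poly_roots_finite by blast
  then have "poly p 0 = poly q 0" by simp
  moreover have "mat 0 ** w + w' = w'" for w w' :: "'a^'n^'n" by (simp add: vec_eq_iff)
  ultimately show ?thesis unfolding p q by simp
qed

section \<open>Polarization\<close>

lemma mlin_add_slot:
  "mlin K F \<Longrightarrow> i < K \<Longrightarrow> finite S \<Longrightarrow> F (v(i := (\<Sum>s\<in>S. A s))) = (\<Sum>s\<in>S. F (v(i := A s)))"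
  using mlin_sum[of K F i S v "\<lambda>_. 1" A] by simp

lemma mlin_sum_expand_partial:
  fixes F :: "(nat \<Rightarrow> ('a::field)^'n::finite^'n) \<Rightarrow> 'a"
  assumes "mlin K F" "m \<le> K" "finite S"
  shows "F (\<lambda>l. if l < m then (\<Sum>s\<in>S. A l s) else C l)
    = (\<Sum>e\<in>{..<m} \<rightarrow>\<^sub>E S. F (\<lambda>l. if l < m then A l (e l) else C l))"
  using assms(2)
proof (induction m arbitrary: C)
  case 0
  then show ?case by simp
next
  case (Suc m)
  have 1: "(\<lambda>l. if l < Suc m then g l else C l) = (\<lambda>l. if l < m then g l else (C(m := g m)) l)" for g
    by (auto simp: fun_eq_iff less_Suc_eq)
  have "F (\<lambda>l. if l < Suc m then (\<Sum>s\<in>S. A l s) else C l)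
     = (\<Sum>e\<in>{..<m} \<rightarrow>\<^sub>E S. F (\<lambda>l. if l < m then A l (e l) else (C(m := \<Sum>s\<in>S. A m s)) l))"
    unfolding 1 using Suc by simp
  also have "\<dots> = (\<Sum>e\<in>{..<m} \<rightarrow>\<^sub>E S. \<Sum>y\<in>S. F (\<lambda>l. if l < Suc m then A l ((e(m := y)) l) else C l))"
  proof (rule sum.cong[OF refl])
    fix e
    let ?w = "\<lambda>l. if l < m then A l (e l) else C l"
    have 2: "(\<lambda>l. if l < m then A l (e l) else (C(m := z)) l) = ?w(m := z)" for z
      by (auto simp: fun_eq_iff)
    have 3: "(\<lambda>l. if l < Suc m then A l ((e(m := y)) l) else C l) = ?w(m := A m y)" for y
      by (auto simp: fun_eq_iff less_Suc_eq)
    show "F (\<lambda>l. if l < m then A l (e l) else (C(m := \<Sum>s\<in>S. A m s)) l)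
       = (\<Sum>y\<in>S. F (\<lambda>l. if l < Suc m then A l ((e(m := y)) l) else C l))"
      unfolding 2 3 by (rule mlin_add_slot[OF assms(1)]) (use Suc.prems assms(3) in auto)
  qed
  also have "\<dots> = (\<Sum>e\<in>{..<Suc m} \<rightarrow>\<^sub>E S. F (\<lambda>l. if l < Suc m then A l (e l) else C l))"
    unfolding lessThan_Suc by (subst sum_PiE_insert) auto
  finally show ?case .
qed

text \<open>For \<open>a\<close> in \<open>N\<close> but not in \<open>R\<close>, adding or removing
  \<open>a\<close> pairs the sets with opposite signs.\<close>

lemma sum_supersets_sign:
  fixes N :: "'b set"
  assumes "finite N" "R \<subseteq> N"
  shows "(\<Sum>S | R \<subseteq> S \<and> S \<subseteq> N. (-1) ^ card S) = (if R = N then (-1) ^ card N else (0 :: 'a::comm_ring_1))"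
proof (cases "R = N")
  case True
  then have "{S. R \<subseteq> S \<and> S \<subseteq> N} = {N}" by auto
  then show ?thesis using True by simp
next
  case False
  then obtain a where a: "a \<in> N" "a \<notin> R" using assms by auto
  let ?M = "{S. R \<subseteq> S \<and> S \<subseteq> N - {a}}"
  have fin: "finite ?M" by (rule finite_subset[of _ "Pow N"]) (use assms in auto)
  have sp: "{S. R \<subseteq> S \<and> S \<subseteq> N} = ?M \<union> insert a ` ?M"
  proof (intro equalityI subsetI)
    fix S assume S: "S \<in> {S. R \<subseteq> S \<and> S \<subseteq> N}"
    show "S \<in> ?M \<union> insert a ` ?M"
    proof (cases "a \<in> S")
      case True
      then have "S = insert a (S - {a})" "S - {a} \<in> ?M" using S a by auto
      then show ?thesis by blast
    qed (use S in auto)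
  qed (use a in auto)
  have inj: "inj_on (insert a) ?M" by (rule inj_onI) (metis (no_types, lifting) Diff_insert_absorb mem_Collect_eq subset_Diff_insert)
  have "(\<Sum>S | R \<subseteq> S \<and> S \<subseteq> N. (-1) ^ card S) = (\<Sum>S\<in>?M. (-1) ^ card S) + (\<Sum>S\<in>insert a ` ?M. (-1 :: 'a) ^ card S)"
    unfolding sp by (rule sum.union_disjoint) (use fin in auto)
  also have "(\<Sum>S\<in>insert a ` ?M. (-1 :: 'a) ^ card S) = (\<Sum>S\<in>?M. - ((-1) ^ card S))"
    unfolding sum.reindex[OF inj]
  proof (rule sum.cong[OF refl])
    fix S assume S: "S \<in> ?M"
    then have "finite S" using assms finite_subset by blast
    moreover have "a \<notin> S" using S by auto
    ultimately show "((\<lambda>S. (-1 :: 'a) ^ card S) \<circ> insert a) S = - ((-1) ^ card S)" by simp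
  qed
  finally show ?thesis using False by (simp add: sum_negf)
qed

text \<open>Inclusion-exclusion over the subsets of the slots.\<close>

lemma mlin_polarize:
  fixes H :: "(nat \<Rightarrow> ('a::field)^'n::finite^'n) \<Rightarrow> 'a"
  assumes "mlin K H" "local_on K H"
  shows "(\<Sum>S\<in>Pow {..<K}. (-1) ^ card S * H (\<lambda>l. \<Sum>s\<in>S. x s)) = (-1) ^ K * (\<Sum>\<pi> | \<pi> permutes {..<K}. H (x \<circ> \<pi>))"
proof -
  let ?N = "{..<K}"
  let ?res = "\<lambda>e l. if l < K then x (e l) else 0"
  have loc: "H w = H (\<lambda>l. if l < K then w l else 0)" for w
    using assms(2) by (simp add: local_on_def)
  have ex: "H (\<lambda>l. \<Sum>s\<in>S. x s) = (\<Sum>e\<in>?N \<rightarrow>\<^sub>E ?N. if e ` ?N \<subseteq> S then H (?res e) else 0)" if S: "S \<subseteq> ?N" for S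
  proof -
    have fS: "finite S" using S finite_subset by blast
    have "H (\<lambda>l. \<Sum>s\<in>S. x s) = (\<Sum>e\<in>?N \<rightarrow>\<^sub>E S. H (?res e))"
      using mlin_sum_expand_partial[OF assms(1) order_refl fS, of "\<lambda>_. x" "\<lambda>_. 0"] loc[of "\<lambda>l. \<Sum>s\<in>S. x s"] by simp
    also have "?N \<rightarrow>\<^sub>E S = {e \<in> ?N \<rightarrow>\<^sub>E ?N. e ` ?N \<subseteq> S}"
      using S by (auto simp: PiE_def Pi_def)
    also have "(\<Sum>e\<in>\<dots>. H (?res e)) = (\<Sum>e\<in>?N \<rightarrow>\<^sub>E ?N. if e ` ?N \<subseteq> S then H (?res e) else 0)"
      by (rule sum.inter_filter) (simp add: finite_PiE)
    finally show ?thesis .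
  qed
  have "(\<Sum>S\<in>Pow ?N. (-1) ^ card S * H (\<lambda>l. \<Sum>s\<in>S. x s))
     = (\<Sum>S\<in>Pow ?N. \<Sum>e\<in>?N \<rightarrow>\<^sub>E ?N. if e ` ?N \<subseteq> S then (-1) ^ card S * H (?res e) else 0)"
    by (intro sum.cong refl) (simp add: ex sum_distrib_left if_distrib cong: if_cong)
  also have "\<dots> = (\<Sum>e\<in>?N \<rightarrow>\<^sub>E ?N. \<Sum>S\<in>Pow ?N. if e ` ?N \<subseteq> S then (-1) ^ card S * H (?res e) else 0)"
    by (rule sum.swap)
  \<comment> \<open>For each choice \<open>e\<close> of arguments the signs of the sets
    \<open>S\<close> that contain its range cancel, unless the range is everything, that is, unless
    \<open>e\<close> is a permutation.\<close>
  also have "\<dots> = (\<Sum>e\<in>?N \<rightarrow>\<^sub>E ?N. if e ` ?N = ?N then (-1) ^ K * H (?res e) else 0)"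
  proof (rule sum.cong[OF refl])
    fix e assume e: "e \<in> ?N \<rightarrow>\<^sub>E ?N"
    have "(\<Sum>S\<in>Pow ?N. if e ` ?N \<subseteq> S then (-1) ^ card S * H (?res e) else 0)
      = (\<Sum>S\<in>{S \<in> Pow ?N. e ` ?N \<subseteq> S}. (-1) ^ card S * H (?res e))"
      by (rule sum.inter_filter[symmetric]) simp
    also have "{S \<in> Pow ?N. e ` ?N \<subseteq> S} = {S. e ` ?N \<subseteq> S \<and> S \<subseteq> ?N}" by auto
    also have "(\<Sum>S\<in>\<dots>. (-1) ^ card S * H (?res e)) = (if e ` ?N = ?N then (-1) ^ K * H (?res e) else 0)"
      unfolding sum_distrib_right[symmetric] by (subst sum_supersets_sign) (use e in auto)
    finally show "(\<Sum>S\<in>Pow ?N. if e ` ?N \<subseteq> S then (-1) ^ card S * H (?res e) else 0)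
      = (if e ` ?N = ?N then (-1) ^ K * H (?res e) else 0)" .
  qed
  also have "\<dots> = (\<Sum>e\<in>{e \<in> ?N \<rightarrow>\<^sub>E ?N. e ` ?N = ?N}. (-1) ^ K * H (?res e))"
    by (rule sum.inter_filter[symmetric]) (simp add: finite_PiE)
  also have "\<dots> = (\<Sum>\<pi> | \<pi> permutes ?N. (-1) ^ K * H (x \<circ> \<pi>))"
  proof (rule sum.reindex_bij_witness[where
      i = "\<lambda>\<pi>. restrict \<pi> ?N" and j = "\<lambda>e l. if l \<in> ?N then e l else l"])
    fix e assume e: "e \<in> {e \<in> ?N \<rightarrow>\<^sub>E ?N. e ` ?N = ?N}"
    then have "bij_betw e ?N ?N" by (auto simp: bij_betw_def intro: eq_card_imp_inj_on)
    then have "bij_betw (\<lambda>l. if l \<in> ?N then e l else l) ?N ?N"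
      by (rule bij_betw_cong[THEN iffD1, rotated]) simp
    then show "(\<lambda>l. if l \<in> ?N then e l else l) \<in> {\<pi>. \<pi> permutes ?N}"
      unfolding mem_Collect_eq by (rule bij_imp_permutes) simp
    show "restrict (\<lambda>l. if l \<in> ?N then e l else l) ?N = e"
      using e by (auto simp: fun_eq_iff PiE_def extensional_def)
    show "(-1) ^ K * H (x \<circ> (\<lambda>l. if l \<in> ?N then e l else l)) = (-1) ^ K * H (?res e)"
      using assms(2) by (simp add: local_on_def)
  next
    fix \<pi> assume p: "\<pi> \<in> {\<pi>. \<pi> permutes ?N}"
    then have "\<pi> ` ?N = ?N" using permutes_image by blast
    then show "restrict \<pi> ?N \<in> {e \<in> ?N \<rightarrow>\<^sub>E ?N. e ` ?N = ?N}" by auto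
    show "(\<lambda>l. if l \<in> ?N then restrict \<pi> ?N l else l) = \<pi>"
      using p by (auto simp: fun_eq_iff permutes_def)
  qed
  finally show ?thesis by (simp add: sum_distrib_left)
qed

text \<open>Replaces one matrix acting on all slots by different matrices acting on the individual
  slots, summed over all assignments. With matrix units for \<open>x\<close> this expresses that
  \<open>F\<close> commutes with symmetrized operators on the tensor power.\<close>

lemma polarized_invariance:
  fixes F :: "(nat \<Rightarrow> ('a::field_char_0)^'n::finite^'n) \<Rightarrow> 'a"
  assumes F: "mlin K F" "local_on K F"
    and inv: "\<And>x v. F (\<lambda>i. x ** v i) = F (\<lambda>i. v i ** x)"
  shows "(\<Sum>\<pi> | \<pi> permutes {..<K}. F (\<lambda>l. x (\<pi> l) ** v l)) = (\<Sum>\<pi> | \<pi> permutes {..<K}. F (\<lambda>l. v l ** x (\<pi> l)))"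
proof -
  let ?H1 = "\<lambda>w. F (\<lambda>l. w l ** v l)" and ?H2 = "\<lambda>w. F (\<lambda>l. v l ** w l)"
  have u1: "(\<lambda>l. (w(i := z)) l ** v l) = (\<lambda>l. w l ** v l)(i := z ** v i)" for w :: "nat \<Rightarrow> 'a^'n^'n" and i z by auto
  have u2: "(\<lambda>l. v l ** (w(i := z)) l) = (\<lambda>l. v l ** w l)(i := v i ** z)" for w :: "nat \<Rightarrow> 'a^'n^'n" and i z by auto
  have m1: "mlin K ?H1"
    unfolding mlin_def u1 using F(1) unfolding mlin_def
    by (simp add: matrix_add_rdistr matrix_mul_assoc[symmetric])
  have m2: "mlin K ?H2"
    unfolding mlin_def u2
  proof (intro allI impI)
    fix i c and w :: "nat \<Rightarrow> 'a^'n^'n" and y z :: "'a^'n^'n" assume i: "i < K"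
    have "v i ** (mat c ** y + z) = mat c ** (v i ** y) + v i ** z"
      by (simp add: matrix_add_ldistrib) (metis mat_commute matrix_mul_assoc)
    then show "F ((\<lambda>l. v l ** w l)(i := v i ** (mat c ** y + z)))
      = c * F ((\<lambda>l. v l ** w l)(i := v i ** y)) + F ((\<lambda>l. v l ** w l)(i := v i ** z))"
      using F(1) i unfolding mlin_def by simp
  qed
  have l: "local_on K ?H1" "local_on K ?H2" using F(2) by (simp_all add: local_on_def)
  have "(-1) ^ K * (\<Sum>\<pi> | \<pi> permutes {..<K}. ?H1 (x \<circ> \<pi>)) = (-1) ^ K * (\<Sum>\<pi> | \<pi> permutes {..<K}. ?H2 (x \<circ> \<pi>))"
    unfolding mlin_polarize[OF m1 l(1), symmetric] mlin_polarize[OF m2 l(2), symmetric] inv ..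
  then show ?thesis by simp
qed

lemma vector_space_functions: "vector_space (\<lambda>(c::'a::field) (f :: 'x \<Rightarrow> 'a) x. c * f x)"
  by unfold_locales (auto simp: fun_eq_iff fun_apply algebra_simps)

text \<open>The projection comes from an arbitrary complement, without regard to symmetry; it is
  made symmetric by the averaging in \<open>fft_coordinates\<close>.\<close>

lemma function_projection_exists:
  fixes U :: "('x \<Rightarrow> 'a::field) set"
  assumes "0 \<in> U" "\<And>f g. f \<in> U \<Longrightarrow> g \<in> U \<Longrightarrow> f + g \<in> U" "\<And>c f. f \<in> U \<Longrightarrow> (\<lambda>x. c * f x) \<in> U"
  obtains p where "\<And>f. p f \<in> U" "\<And>f. f \<in> U \<Longrightarrow> p f = f"
    "\<And>f g. p (f + g) = p f + p g" "\<And>c f. p (\<lambda>x. c * f x) = (\<lambda>x. c * p f x)"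
proof -
  interpret V: vector_space "\<lambda>(c::'a) (f :: 'x \<Rightarrow> 'a) x. c * f x" by (rule vector_space_functions)
  interpret VP: vector_space_pair "\<lambda>(c::'a) (f :: 'x \<Rightarrow> 'a) x. c * f x" "\<lambda>(c::'a) (f :: 'x \<Rightarrow> 'a) x. c * f x" ..
  have U: "V.subspace U" unfolding V.subspace_def using assms by blast
  obtain p where p: "p ` UNIV \<subseteq> U" "Vector_Spaces.linear (\<lambda>(c::'a) (f :: 'x \<Rightarrow> 'a) x. c * f x) (\<lambda>(c::'a) (f :: 'x \<Rightarrow> 'a) x. c * f x) p" "\<forall>v\<in>U. p (id v) = v"
    using VP.linear_exists_left_inverse_on[OF V.linear_id U] by auto
  interpret L: Vector_Spaces.linear "\<lambda>(c::'a) (f :: 'x \<Rightarrow> 'a) x. c * f x" "\<lambda>(c::'a) (f :: 'x \<Rightarrow> 'a) x. c * f x" p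
    by (rule p(2))
  show ?thesis
  proof (rule that[of p])
    show "p f \<in> U" for f using p(1) by blast
    show "p f = f" if "f \<in> U" for f using p(3) that by simp
    show "p (f + g) = p f + p g" for f g by (rule L.add)
    show "p (\<lambda>x. c * f x) = (\<lambda>x. c * p f x)" for c f by (rule L.scale)
  qed
qed

section \<open>Operators on the tensor power in coordinates\<close>

lemma munit_mult: "munit (a, b) ** munit (i, j) = (if b = i then munit (a, j) else 0 :: ('a::field)^'n::finite^'n)"
proof -
  have "(munit (a, b) ** munit (i, j) :: 'a^'n^'n) $ p $ q = (\<Sum>k\<in>UNIV. if k = b then (if p = a \<and> b = i \<and> q = j then 1 else 0) else 0)" for p q
    unfolding matrix_matrix_mult_def munit_def vec_lambda_beta by (intro sum.cong refl) auto
  then show ?thesis by (auto simp: vec_eq_iff munit_def)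
qed

lemma mlin_indicator:
  assumes "mlin K F" "local_on K F"
  shows "F (\<lambda>l. if c l then w l else 0) = (if \<forall>l<K. c l then F w else 0)"
proof (cases "\<forall>l<K. c l")
  case True
  then show ?thesis using assms(2) by (simp add: local_on_def)
next
  case False
  then obtain l where l: "l < K" "\<not> c l" by auto
  then have "(\<lambda>l. if c l then w l else 0) = (\<lambda>l. if c l then w l else 0)(l := 0)" by auto
  then have "F (\<lambda>l. if c l then w l else 0) = F ((\<lambda>l. if c l then w l else 0)(l := 0))"
    by (rule arg_cong)
  also have "\<dots> = 0" by (rule mlin_zero[OF assms(1) l(1)])
  finally show ?thesis using False by auto
qed

text \<open>Indices of the standard basis of the \<open>K\<close>-th tensor power of the column
  space. Extensionality makes two tuples equal as soon as their first \<open>K\<close> entries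
  agree.\<close>

definition mindex :: "nat \<Rightarrow> (nat \<Rightarrow> 'n::finite) set" where
  "mindex K = {..<K} \<rightarrow>\<^sub>E UNIV"

lemma finite_mindex [simp]: "finite (mindex K)"
  by (simp add: mindex_def finite_PiE)

lemma mindex_eqI: "i \<in> mindex K \<Longrightarrow> j \<in> mindex K \<Longrightarrow> (\<And>l. l < K \<Longrightarrow> i l = j l) \<Longrightarrow> i = j"
  unfolding mindex_def by (rule PiE_ext) auto

lemma mindex_comp: "\<pi> permutes {..<K} \<Longrightarrow> i \<in> mindex K \<Longrightarrow> i \<circ> \<pi> \<in> mindex K"
  by (auto simp: mindex_def PiE_def extensional_def permutes_def)

lemma sum_mindex_comp:
  assumes "\<pi> permutes {..<K}"
  shows "(\<Sum>a\<in>mindex K. g (a \<circ> \<pi>)) = (\<Sum>a\<in>mindex K. g a)"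
  by (rule sum.reindex_bij_witness[where i = "\<lambda>a. a \<circ> inv \<pi>" and j = "\<lambda>a. a \<circ> \<pi>"])
    (use assms in \<open>auto simp: mindex_comp permutes_inv comp_assoc permutes_inv_o\<close>)

text \<open>\<phi> is the matrix of an operator on the tensor power, and the claim is that it
  commutes with the transpose of \<open>B\<close>. A matrix that is invariant under simultaneous
  permutation of both indices is a combination of symmetrized products of matrix units, and these
  are covered by \<open>polarized_invariance\<close>.\<close>

lemma coordinate_commutes:
  fixes F :: "(nat \<Rightarrow> ('a::field_char_0)^'n::finite^'n) \<Rightarrow> 'a"
  assumes F: "mlin K F" "local_on K F"
    and inv: "\<And>x v. F (\<lambda>i. x ** v i) = F (\<lambda>i. v i ** x)"
    and B: "\<And>\<pi> a b. \<pi> permutes {..<K} \<Longrightarrow> B (a \<circ> \<pi>) (b \<circ> \<pi>) = B a b"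
    and ij: "i \<in> mindex K" "j \<in> mindex K"
  defines "\<phi> \<equiv> \<lambda>i j. F (\<lambda>l. munit (i l, j l))"
  shows "(\<Sum>a\<in>mindex K. B a i * \<phi> a j) = (\<Sum>b\<in>mindex K. B j b * \<phi> i b)"
proof -
  let ?I = "mindex K" and ?P = "{\<pi>. \<pi> permutes {..<K}}"
  \<comment> \<open>This is \<open>polarized_invariance\<close> at the matrix units with indices
    \<open>a\<close> and \<open>b\<close>.\<close>
  have key: "(\<Sum>\<pi>\<in>?P. if b \<circ> \<pi> = i then \<phi> (a \<circ> \<pi>) j else 0) = (\<Sum>\<pi>\<in>?P. if a \<circ> \<pi> = j then \<phi> i (b \<circ> \<pi>) else 0)"
    if ab: "a \<in> ?I" "b \<in> ?I" for a b
  proof -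
    let ?x = "\<lambda>l. munit (a l, b l) :: 'a^'n^'n" and ?v = "\<lambda>l. munit (i l, j l) :: 'a^'n^'n"
    have 1: "F (\<lambda>l. ?x (\<pi> l) ** ?v l) = (if b \<circ> \<pi> = i then \<phi> (a \<circ> \<pi>) j else 0)" if p: "\<pi> \<in> ?P" for \<pi>
    proof -
      have "(\<forall>l<K. b (\<pi> l) = i l) \<longleftrightarrow> b \<circ> \<pi> = i"
        using mindex_eqI[OF mindex_comp[of \<pi> K b] ij(1)] p ab by auto
      then show ?thesis
        unfolding munit_mult mlin_indicator[OF F, of "\<lambda>l. b (\<pi> l) = i l" "\<lambda>l. munit (a (\<pi> l), j l)"] \<phi>_def by simp
    qed
    have 2: "F (\<lambda>l. ?v l ** ?x (\<pi> l)) = (if a \<circ> \<pi> = j then \<phi> i (b \<circ> \<pi>) else 0)" if p: "\<pi> \<in> ?P" for \<pi>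
    proof -
      have "(\<forall>l<K. j l = a (\<pi> l)) \<longleftrightarrow> a \<circ> \<pi> = j"
        using mindex_eqI[OF mindex_comp[of \<pi> K a] ij(2)] p ab by auto
      then show ?thesis
        unfolding munit_mult mlin_indicator[OF F, of "\<lambda>l. j l = a (\<pi> l)" "\<lambda>l. munit (i l, b (\<pi> l))"] \<phi>_def by simp
    qed
    have "(\<Sum>\<pi>\<in>?P. F (\<lambda>l. ?x (\<pi> l) ** ?v l)) = (\<Sum>\<pi>\<in>?P. F (\<lambda>l. ?v l ** ?x (\<pi> l)))"
      using polarized_invariance[OF F inv, of ?x ?v] by simp
    then show ?thesis by (simp only: 1 2 cong: sum.cong)
  qed
  \<comment> \<open>\<open>key\<close> is weighted with \<open>B a b\<close> and summed over
    \<open>a\<close> and \<open>b\<close>. By the invariance of \<open>B\<close> all permutations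
    contribute equally; the factor \<open>K!\<close> arises on both sides and is cancelled at the
    end.\<close>
  have L: "(\<Sum>a\<in>?I. \<Sum>b\<in>?I. B a b * (\<Sum>\<pi>\<in>?P. if b \<circ> \<pi> = i then \<phi> (a \<circ> \<pi>) j else 0))
     = of_nat (card ?P) * (\<Sum>a\<in>?I. B a i * \<phi> a j)"
  proof -
    have "(\<Sum>a\<in>?I. \<Sum>b\<in>?I. B a b * (\<Sum>\<pi>\<in>?P. if b \<circ> \<pi> = i then \<phi> (a \<circ> \<pi>) j else 0))
      = (\<Sum>a\<in>?I. \<Sum>\<pi>\<in>?P. \<Sum>b\<in>?I. B a b * (if b \<circ> \<pi> = i then \<phi> (a \<circ> \<pi>) j else 0))"
      unfolding sum_distrib_left by (rule sum.cong[OF refl], rule sum.swap)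
    also have "\<dots> = (\<Sum>\<pi>\<in>?P. \<Sum>a\<in>?I. \<Sum>b\<in>?I. B a b * (if b \<circ> \<pi> = i then \<phi> (a \<circ> \<pi>) j else 0))"
      by (rule sum.swap)
    also have "\<dots> = (\<Sum>\<pi>\<in>?P. \<Sum>a\<in>?I. B a i * \<phi> a j)"
    proof (rule sum.cong[OF refl])
      fix \<pi> assume "\<pi> \<in> ?P"
      then have p: "\<pi> permutes {..<K}" by simp
      have "(\<Sum>a\<in>?I. \<Sum>b\<in>?I. B a b * (if b \<circ> \<pi> = i then \<phi> (a \<circ> \<pi>) j else 0))
        = (\<Sum>a\<in>?I. \<Sum>b\<in>?I. B (a \<circ> \<pi>) (b \<circ> \<pi>) * (if b \<circ> \<pi> = i then \<phi> (a \<circ> \<pi>) j else 0))"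
        by (simp add: B[OF p])
      also have "\<dots> = (\<Sum>a\<in>?I. \<Sum>b\<in>?I. B (a \<circ> \<pi>) b * (if b = i then \<phi> (a \<circ> \<pi>) j else 0))"
        by (rule sum.cong[OF refl], rule sum_mindex_comp[OF p])
      also have "\<dots> = (\<Sum>a\<in>?I. \<Sum>b\<in>?I. B a b * (if b = i then \<phi> a j else 0))"
        by (rule sum_mindex_comp[OF p, of "\<lambda>a. \<Sum>b\<in>?I. B a b * (if b = i then \<phi> a j else 0)"])
      also have "\<dots> = (\<Sum>a\<in>?I. B a i * \<phi> a j)"
        using ij(1) by (simp add: if_distrib cong: if_cong)
      finally show "(\<Sum>a\<in>?I. \<Sum>b\<in>?I. B a b * (if b \<circ> \<pi> = i then \<phi> (a \<circ> \<pi>) j else 0)) = (\<Sum>a\<in>?I. B a i * \<phi> a j)" .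
    qed
    finally show ?thesis by simp
  qed
  have R: "(\<Sum>a\<in>?I. \<Sum>b\<in>?I. B a b * (\<Sum>\<pi>\<in>?P. if a \<circ> \<pi> = j then \<phi> i (b \<circ> \<pi>) else 0))
     = of_nat (card ?P) * (\<Sum>b\<in>?I. B j b * \<phi> i b)"
  proof -
    have "(\<Sum>a\<in>?I. \<Sum>b\<in>?I. B a b * (\<Sum>\<pi>\<in>?P. if a \<circ> \<pi> = j then \<phi> i (b \<circ> \<pi>) else 0))
      = (\<Sum>a\<in>?I. \<Sum>\<pi>\<in>?P. \<Sum>b\<in>?I. B a b * (if a \<circ> \<pi> = j then \<phi> i (b \<circ> \<pi>) else 0))"
      unfolding sum_distrib_left by (rule sum.cong[OF refl], rule sum.swap)
    also have "\<dots> = (\<Sum>\<pi>\<in>?P. \<Sum>a\<in>?I. \<Sum>b\<in>?I. B a b * (if a \<circ> \<pi> = j then \<phi> i (b \<circ> \<pi>) else 0))"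
      by (rule sum.swap)
    also have "\<dots> = (\<Sum>\<pi>\<in>?P. \<Sum>b\<in>?I. B j b * \<phi> i b)"
    proof (rule sum.cong[OF refl])
      fix \<pi> assume "\<pi> \<in> ?P"
      then have p: "\<pi> permutes {..<K}" by simp
      have "(\<Sum>a\<in>?I. \<Sum>b\<in>?I. B a b * (if a \<circ> \<pi> = j then \<phi> i (b \<circ> \<pi>) else 0))
        = (\<Sum>a\<in>?I. \<Sum>b\<in>?I. B (a \<circ> \<pi>) (b \<circ> \<pi>) * (if a \<circ> \<pi> = j then \<phi> i (b \<circ> \<pi>) else 0))"
        by (simp add: B[OF p])
      also have "\<dots> = (\<Sum>a\<in>?I. \<Sum>b\<in>?I. B (a \<circ> \<pi>) b * (if a \<circ> \<pi> = j then \<phi> i b else 0))"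
        by (rule sum.cong[OF refl], rule sum_mindex_comp[OF p])
      also have "\<dots> = (\<Sum>a\<in>?I. \<Sum>b\<in>?I. B a b * (if a = j then \<phi> i b else 0))"
        by (rule sum_mindex_comp[OF p, of "\<lambda>a. \<Sum>b\<in>?I. B a b * (if a = j then \<phi> i b else 0)"])
      also have "\<dots> = (\<Sum>b\<in>?I. \<Sum>a\<in>?I. B a b * (if a = j then \<phi> i b else 0))" by (rule sum.swap)
      also have "\<dots> = (\<Sum>b\<in>?I. B j b * \<phi> i b)"
        using ij(2) by (simp add: if_distrib cong: if_cong)
      finally show "(\<Sum>a\<in>?I. \<Sum>b\<in>?I. B a b * (if a \<circ> \<pi> = j then \<phi> i (b \<circ> \<pi>) else 0)) = (\<Sum>b\<in>?I. B j b * \<phi> i b)" .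
    qed
    finally show ?thesis by simp
  qed
  have "of_nat (card ?P) * (\<Sum>a\<in>?I. B a i * \<phi> a j) = of_nat (card ?P) * (\<Sum>b\<in>?I. B j b * \<phi> i b)"
    unfolding L[symmetric] R[symmetric] by (intro sum.cong refl) (simp only: key)
  moreover have "card ?P = fact K" using card_permutations[of "{..<K}" K] by simp
  ultimately show ?thesis by simp
qed

text \<open>Double centralizer argument: \<open>q\<close> below is the matrix of a projection \<open>p\<close> onto the span \<open>U\<close> of the permutation
  operators, summed over the symmetric group. Its blocks commute with the symmetric group, hence with \<open>\<phi>\<close>, so the
  resulting operator fixes \<open>\<phi>\<close> up to the factor \<open>K!\<close> while mapping it into \<open>U\<close>.\<close>

lemma fft_coordinates:
  fixes F :: "(nat \<Rightarrow> ('a::field_char_0)^'n::finite^'n) \<Rightarrow> 'a"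
  assumes F: "mlin K F" "local_on K F"
    and inv: "\<And>x v. F (\<lambda>i. x ** v i) = F (\<lambda>i. v i ** x)"
  defines "\<phi> \<equiv> \<lambda>i j. F (\<lambda>l. munit (i l, j l))"
  obtains d where "\<And>i j. i \<in> mindex K \<Longrightarrow> j \<in> mindex K \<Longrightarrow>
    \<phi> i j = (\<Sum>\<sigma> | \<sigma> permutes {..<K}. d \<sigma> * (if j = i \<circ> \<sigma> then 1 else 0))"
proof -
  let ?I = "mindex K :: (nat \<Rightarrow> 'n) set" and ?P = "{\<pi>. \<pi> permutes {..<K}}"
  define Pm where "Pm \<sigma> = (\<lambda>x :: (nat \<Rightarrow> 'n) \<times> (nat \<Rightarrow> 'n). if fst x \<in> ?I \<and> snd x = fst x \<circ> \<sigma> then 1 else 0 :: 'a)" for \<sigma>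
  define U where "U = range (\<lambda>c x. \<Sum>\<sigma>\<in>?P. c \<sigma> * Pm \<sigma> x)"
  have U0: "0 \<in> U"
    unfolding U_def by (rule range_eqI[of _ _ "\<lambda>_. 0"]) (simp add: fun_eq_iff fun_apply)
  have Uadd: "f + g \<in> U" if fg: "f \<in> U" "g \<in> U" for f g
  proof -
    obtain c d where "f = (\<lambda>x. \<Sum>\<sigma>\<in>?P. c \<sigma> * Pm \<sigma> x)" "g = (\<lambda>x. \<Sum>\<sigma>\<in>?P. d \<sigma> * Pm \<sigma> x)"
      using fg unfolding U_def by blast
    then show ?thesis unfolding U_def
      by (intro range_eqI[of _ _ "\<lambda>\<sigma>. c \<sigma> + d \<sigma>"]) (simp add: fun_eq_iff fun_apply sum.distrib distrib_right)
  qed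
  have Uscale: "(\<lambda>x. t * f x) \<in> U" if f: "f \<in> U" for t f
  proof -
    obtain c where "f = (\<lambda>x. \<Sum>\<sigma>\<in>?P. c \<sigma> * Pm \<sigma> x)"
      using f unfolding U_def by blast
    then show ?thesis unfolding U_def
      by (intro range_eqI[of _ _ "\<lambda>\<sigma>. t * c \<sigma>"]) (simp add: fun_eq_iff sum_distrib_left mult.assoc)
  qed
  have PmU: "Pm \<sigma> \<in> U" if "\<sigma> \<in> ?P" for \<sigma>
    unfolding U_def
  proof (rule range_eqI[of _ _ "\<lambda>\<tau>. if \<tau> = \<sigma> then 1 else 0"])
    show "Pm \<sigma> = (\<lambda>x. \<Sum>\<tau>\<in>?P. (if \<tau> = \<sigma> then 1 else 0) * Pm \<tau> x)"
    proof
      fix x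
      have "(\<Sum>\<tau>\<in>?P. (if \<tau> = \<sigma> then 1 else 0) * Pm \<tau> x) = (\<Sum>\<tau>\<in>?P. if \<tau> = \<sigma> then Pm \<sigma> x else 0)"
        by (intro sum.cong refl) auto
      then show "Pm \<sigma> x = (\<Sum>\<tau>\<in>?P. (if \<tau> = \<sigma> then 1 else 0) * Pm \<tau> x)"
        using that by simp
    qed
  qed
  obtain p where p: "\<And>f. p f \<in> U" "\<And>f. f \<in> U \<Longrightarrow> p f = f"
    "\<And>f g. p (f + g) = p f + p g" "\<And>c f. p (\<lambda>x. c * f x) = (\<lambda>x. c * p f x)"
    using function_projection_exists[OF U0 Uadd Uscale] by blast
  have psum: "p (\<lambda>x. \<Sum>s\<in>S. c s * f s x) = (\<lambda>x. \<Sum>s\<in>S. c s * p (f s) x)" if "finite S"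
    for S :: "'s set" and c :: "'s \<Rightarrow> 'a" and f
    using that
  proof (induction S rule: finite_induct)
    case empty
    have "p (\<lambda>x. 0 * Pm id x) = (\<lambda>x. 0 * p (Pm id) x)" by (rule p(4))
    then show ?case by simp
  next
    case (insert s S)
    have "(\<lambda>x. \<Sum>s\<in>insert s S. c s * f s x) = (\<lambda>x. c s * f s x) + (\<lambda>x. \<Sum>s\<in>S. c s * f s x)"
      using insert by (simp add: fun_eq_iff fun_apply)
    then have "p (\<lambda>x. \<Sum>s\<in>insert s S. c s * f s x) = (\<lambda>x. c s * p (f s) x) + (\<lambda>x. \<Sum>s\<in>S. c s * p (f s) x)"
      by (simp only: p(3,4) insert.IH)
    then show ?case using insert by (simp add: fun_eq_iff fun_apply)
  qed
  define E where "E ab = (\<lambda>x. if x = ab then 1 else 0 :: 'a)" for ab :: "(nat \<Rightarrow> 'n) \<times> (nat \<Rightarrow> 'n)"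
  \<comment> \<open>\<open>p (E (a, b)) (i, j)\<close> is a matrix entry of the projection
    \<open>p\<close>. For fixed \<open>j\<close> and \<open>b\<close> the sum over \<tau> is
    invariant under simultaneous permutation of \<open>i\<close> and \<open>a\<close>, as
    \<open>coordinate_commutes\<close> demands.\<close>
  define q where "q i j a b = (\<Sum>\<tau>\<in>?P. p (E (a \<circ> \<tau>, b)) (i \<circ> \<tau>, j))" for i j a b
  have qinv: "q (i \<circ> \<pi>) j (a \<circ> \<pi>) b = q i j a b" if "\<pi> permutes {..<K}" for \<pi> i j a b
    unfolding q_def comp_assoc
    by (rule setum_permutations_compose_left[OF that, symmetric, of "\<lambda>\<tau>. p (E (a \<circ> \<tau>, b)) (i \<circ> \<tau>, j)"])
  \<comment> \<open>Contracting \<open>a\<close> with \<open>b\<close> produces the sum of all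
    \<open>E (b \<circ> \<tau>, b)\<close>, which is the operator of \<open>inv \<tau>\<close>. It
    lies in \<open>U\<close>, so \<open>p\<close> leaves it unchanged, and each of the
    \<open>K!\<close> permutations contributes the identity.\<close>
  have trace: "(\<Sum>b\<in>?I. q c j b b) = (if c = j then fact K else 0)" if c: "c \<in> ?I" for c j
  proof -
    have "(\<Sum>b\<in>?I. q c j b b) = (\<Sum>\<tau>\<in>?P. \<Sum>b\<in>?I. p (E (b \<circ> \<tau>, b)) (c \<circ> \<tau>, j))"
      unfolding q_def by (rule sum.swap)
    also have "\<dots> = (\<Sum>\<tau>\<in>?P. if c = j then 1 else 0)"
    proof (rule sum.cong[OF refl])
      fix \<tau> assume t: "\<tau> \<in> ?P"
      have "(\<lambda>x. \<Sum>b\<in>?I. 1 * E (b \<circ> \<tau>, b) x) = Pm (inv \<tau>)"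
      proof
        fix x :: "(nat \<Rightarrow> 'n) \<times> (nat \<Rightarrow> 'n)"
        obtain a' b' where x: "x = (a', b')" by (cases x)
        have "(\<Sum>b\<in>?I. 1 * E (b \<circ> \<tau>, b) x) = (\<Sum>b\<in>?I. if b = b' then (if a' = b' \<circ> \<tau> then 1 else 0) else 0)"
          by (intro sum.cong refl) (auto simp: E_def x)
        also have "\<dots> = (if b' \<in> ?I \<and> a' = b' \<circ> \<tau> then 1 else 0)" by simp
        also have "b' \<in> ?I \<and> a' = b' \<circ> \<tau> \<longleftrightarrow> a' \<in> ?I \<and> b' = a' \<circ> inv \<tau>"
          using t mindex_comp[of \<tau> K b'] mindex_comp[of "inv \<tau>" K a']
          by (auto simp: comp_assoc permutes_inv_o permutes_inv)
        finally show "(\<Sum>b\<in>?I. 1 * E (b \<circ> \<tau>, b) x) = Pm (inv \<tau>) x"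
          by (simp only: Pm_def x fst_conv snd_conv)
      qed
      then have "(\<Sum>b\<in>?I. 1 * p (E (b \<circ> \<tau>, b)) (c \<circ> \<tau>, j)) = p (Pm (inv \<tau>)) (c \<circ> \<tau>, j)"
        using fun_cong[OF psum[of ?I "\<lambda>_. 1" "\<lambda>b. E (b \<circ> \<tau>, b)"], of "(c \<circ> \<tau>, j)"] by simp
      also have "p (Pm (inv \<tau>)) = Pm (inv \<tau>)" by (rule p(2), rule PmU) (use t permutes_inv in auto)
      also have "Pm (inv \<tau>) (c \<circ> \<tau>, j) = (if c = j then 1 else 0)"
        using t c mindex_comp[of \<tau> K c] by (auto simp: Pm_def comp_assoc permutes_inv_o)
      finally show "(\<Sum>b\<in>?I. p (E (b \<circ> \<tau>, b)) (c \<circ> \<tau>, j)) = (if c = j then 1 else 0)" by (simp only: mult_1)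
    qed
    also have "\<dots> = (if c = j then fact K else 0)"
      using card_permutations[of "{..<K}" K] by simp
    finally show ?thesis .
  qed
  \<comment> \<open>This is \<phi> with its first index permuted by \<tau>. Its projection lies in
    \<open>U\<close>, which yields the coefficients \<open>C \<tau>\<close>.\<close>
  define G where "G \<tau> = (\<lambda>x. \<Sum>ab\<in>?I \<times> ?I. \<phi> (fst ab) (snd ab) * E (fst ab \<circ> \<tau>, snd ab) x)" for \<tau>
  have "\<exists>C. p (G \<tau>) = (\<lambda>x. \<Sum>\<sigma>\<in>?P. C \<sigma> * Pm \<sigma> x)" for \<tau>
    using p(1)[of "G \<tau>"] unfolding U_def by blast
  then obtain C where C: "\<And>\<tau>. p (G \<tau>) = (\<lambda>x. \<Sum>\<sigma>\<in>?P. C \<tau> \<sigma> * Pm \<sigma> x)" by metis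
  \<comment> \<open>The index \<open>inv \<tau> \<circ> \<sigma>\<close> undoes the permutation of
    the first index by \<tau>, and \<open>fact K\<close> is the factor from
    \<open>trace\<close>.\<close>
  define d where "d \<sigma> = (\<Sum>\<tau>\<in>?P. C \<tau> (inv \<tau> \<circ> \<sigma>)) / fact K" for \<sigma>
  show ?thesis
  proof (rule that[of d])
    fix i j assume ij: "i \<in> ?I" "j \<in> ?I"
    have "fact K * \<phi> i j = (\<Sum>c\<in>?I. (if c = j then fact K else 0) * \<phi> i c)"
      using ij by (simp add: if_distrib[of "\<lambda>x. x * _"] cong: if_cong)
    also have "\<dots> = (\<Sum>c\<in>?I. (\<Sum>b\<in>?I. q c j b b) * \<phi> i c)"
      by (intro sum.cong refl) (simp only: trace)
    also have "\<dots> = (\<Sum>b\<in>?I. \<Sum>c\<in>?I. q c j b b * \<phi> i c)"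
      unfolding sum_distrib_right by (rule sum.swap)
    \<comment> \<open>The commutation leaves \<open>i\<close> and \<open>j\<close> attached to
      \<open>q\<close> alone, so that \<open>p\<close> is applied to \<phi> as a whole.\<close>
    also have "\<dots> = (\<Sum>b\<in>?I. \<Sum>a\<in>?I. q i j a b * \<phi> a b)"
    proof (rule sum.cong[OF refl])
      fix b assume b: "b \<in> ?I"
      have B: "q (c \<circ> \<pi>) j (a \<circ> \<pi>) b = q c j a b" if "\<pi> permutes {..<K}" for \<pi> a c
        by (rule qinv[OF that])
      show "(\<Sum>c\<in>?I. q c j b b * \<phi> i c) = (\<Sum>a\<in>?I. q i j a b * \<phi> a b)"
        using coordinate_commutes[OF F inv, of "\<lambda>a c. q c j a b" i b, OF B ij(1) b] by (simp add: \<phi>_def)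
    qed
    also have "\<dots> = (\<Sum>b\<in>?I. \<Sum>a\<in>?I. \<Sum>\<tau>\<in>?P. \<phi> a b * p (E (a \<circ> \<tau>, b)) (i \<circ> \<tau>, j))"
      by (simp add: q_def sum_distrib_left sum_distrib_right mult.commute)
    also have "\<dots> = (\<Sum>a\<in>?I. \<Sum>b\<in>?I. \<Sum>\<tau>\<in>?P. \<phi> a b * p (E (a \<circ> \<tau>, b)) (i \<circ> \<tau>, j))"
      by (rule sum.swap)
    also have "\<dots> = (\<Sum>ab\<in>?I \<times> ?I. \<Sum>\<tau>\<in>?P. \<phi> (fst ab) (snd ab) * p (E (fst ab \<circ> \<tau>, snd ab)) (i \<circ> \<tau>, j))"
      by (subst sum.cartesian_product) (simp only: case_prod_unfold)
    also have "\<dots> = (\<Sum>\<tau>\<in>?P. \<Sum>ab\<in>?I \<times> ?I. \<phi> (fst ab) (snd ab) * p (E (fst ab \<circ> \<tau>, snd ab)) (i \<circ> \<tau>, j))"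
      by (rule sum.swap)
    also have "\<dots> = (\<Sum>\<tau>\<in>?P. p (G \<tau>) (i \<circ> \<tau>, j))"
    proof (rule sum.cong[OF refl])
      fix \<tau>
      show "(\<Sum>ab\<in>?I \<times> ?I. \<phi> (fst ab) (snd ab) * p (E (fst ab \<circ> \<tau>, snd ab)) (i \<circ> \<tau>, j)) = p (G \<tau>) (i \<circ> \<tau>, j)"
        unfolding G_def by (subst psum) simp_all
    qed
    also have "\<dots> = (\<Sum>\<tau>\<in>?P. \<Sum>\<sigma>\<in>?P. C \<tau> (inv \<tau> \<circ> \<sigma>) * (if j = i \<circ> \<sigma> then 1 else 0))"
    proof (rule sum.cong[OF refl])
      fix \<tau> assume t: "\<tau> \<in> ?P"
      have "p (G \<tau>) (i \<circ> \<tau>, j) = (\<Sum>\<sigma>\<in>?P. C \<tau> \<sigma> * Pm \<sigma> (i \<circ> \<tau>, j))" by (simp add: C)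
      also have "\<dots> = (\<Sum>\<sigma>\<in>?P. C \<tau> (inv \<tau> \<circ> \<sigma>) * Pm (inv \<tau> \<circ> \<sigma>) (i \<circ> \<tau>, j))"
        by (rule setum_permutations_compose_left) (use t permutes_inv in auto)
      also have "\<dots> = (\<Sum>\<sigma>\<in>?P. C \<tau> (inv \<tau> \<circ> \<sigma>) * (if j = i \<circ> \<sigma> then 1 else 0))"
      proof (rule sum.cong[OF refl])
        fix \<sigma> :: "nat \<Rightarrow> nat"
        have "i \<circ> \<tau> \<circ> (inv \<tau> \<circ> \<sigma>) = i \<circ> (\<tau> \<circ> inv \<tau>) \<circ> \<sigma>" by (simp only: comp_assoc)
        also have "\<dots> = i \<circ> \<sigma>" using t by (simp add: permutes_inv_o)
        finally have "i \<circ> \<tau> \<circ> (inv \<tau> \<circ> \<sigma>) = i \<circ> \<sigma>" .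
        then show "C \<tau> (inv \<tau> \<circ> \<sigma>) * Pm (inv \<tau> \<circ> \<sigma>) (i \<circ> \<tau>, j) = C \<tau> (inv \<tau> \<circ> \<sigma>) * (if j = i \<circ> \<sigma> then 1 else 0)"
          using t ij mindex_comp[of \<tau> K i] by (simp add: Pm_def)
      qed
      finally show "p (G \<tau>) (i \<circ> \<tau>, j) = (\<Sum>\<sigma>\<in>?P. C \<tau> (inv \<tau> \<circ> \<sigma>) * (if j = i \<circ> \<sigma> then 1 else 0))" .
    qed
    also have "\<dots> = (\<Sum>\<sigma>\<in>?P. \<Sum>\<tau>\<in>?P. C \<tau> (inv \<tau> \<circ> \<sigma>) * (if j = i \<circ> \<sigma> then 1 else 0))"
      by (rule sum.swap)
    also have "\<dots> = fact K * (\<Sum>\<sigma>\<in>?P. d \<sigma> * (if j = i \<circ> \<sigma> then 1 else 0))"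
      unfolding d_def sum_distrib_left by (intro sum.cong refl) (simp add: sum_distrib_right)
    finally show "\<phi> i j = (\<Sum>\<sigma>\<in>?P. d \<sigma> * (if j = i \<circ> \<sigma> then 1 else 0))" by simp
  qed
qed

text \<open>By multilinearity only the values at matrix units count. There the coordinates of a
  permutation operator select the index choices in which the column index of slot \<open>l\<close>
  is the row index of slot \<open>\<sigma> l\<close>, and the sum over these choices is
  \<open>psum\<close>.\<close>

theorem first_fundamental_theorem:
  fixes F :: "(nat \<Rightarrow> ('a::field_char_0)^'n::finite^'n) \<Rightarrow> 'a"
  assumes F: "mlin K F" "local_on K F"
    and inv: "\<And>g g' v. g ** g' = mat 1 \<Longrightarrow> g' ** g = mat 1 \<Longrightarrow> F (\<lambda>i. g ** v i ** g') = F v"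
  obtains d where "\<And>v. F v = (\<Sum>\<sigma> | \<sigma> permutes {..<K}. d \<sigma> * psum {..<K} \<sigma> v)"
proof -
  let ?P = "{\<pi>. \<pi> permutes {..<K}}" and ?E = "{..<K} \<rightarrow>\<^sub>E (UNIV :: ('n \<times> 'n) set)"
  have inv': "F (\<lambda>i. x ** v i) = F (\<lambda>i. v i ** x)" for x v
    by (rule invariant_all_matrices[OF F inv])
  obtain d where d: "\<And>i j. i \<in> mindex K \<Longrightarrow> j \<in> mindex K \<Longrightarrow>
    F (\<lambda>l. munit (i l, j l)) = (\<Sum>\<sigma>\<in>?P. d \<sigma> * (if j = i \<circ> \<sigma> then 1 else 0))"
    using fft_coordinates[OF F inv'] by blast
  have coeff: "F (\<lambda>l. munit (e l)) = (\<Sum>\<sigma>\<in>?P. d \<sigma> * (if \<forall>l<K. snd (e l) = fst (e (\<sigma> l)) then 1 else 0))" for e :: "nat \<Rightarrow> 'n \<times> 'n"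
  proof -
    let ?i = "restrict (fst \<circ> e) {..<K}" and ?j = "restrict (snd \<circ> e) {..<K}"
    have ij: "?i \<in> mindex K" "?j \<in> mindex K" by (auto simp: mindex_def)
    have "F (\<lambda>l. munit (e l)) = F (\<lambda>l. munit (?i l, ?j l))"
      using F(2) by (simp add: local_on_def)
    also have "\<dots> = (\<Sum>\<sigma>\<in>?P. d \<sigma> * (if ?j = ?i \<circ> \<sigma> then 1 else 0))" by (rule d[OF ij])
    also have "\<dots> = (\<Sum>\<sigma>\<in>?P. d \<sigma> * (if \<forall>l<K. snd (e l) = fst (e (\<sigma> l)) then 1 else 0))"
    proof (rule sum.cong[OF refl])
      fix \<sigma> assume s: "\<sigma> \<in> ?P"
      have s': "\<sigma> l < K" if "l < K" for l using s that permutes_in_image[of \<sigma> "{..<K}" l] by simp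
      have "?j = ?i \<circ> \<sigma> \<longleftrightarrow> (\<forall>l<K. ?j l = (?i \<circ> \<sigma>) l)"
      proof
        assume eq: "?j = ?i \<circ> \<sigma>"
        show "\<forall>l<K. ?j l = (?i \<circ> \<sigma>) l" unfolding eq by simp
      next
        assume "\<forall>l<K. ?j l = (?i \<circ> \<sigma>) l"
        then show "?j = ?i \<circ> \<sigma>"
          using mindex_eqI[OF ij(2) mindex_comp[OF _ ij(1), of \<sigma>]] s by blast
      qed
      also have "\<dots> \<longleftrightarrow> (\<forall>l<K. snd (e l) = fst (e (\<sigma> l)))" using s' by simp
      finally show "d \<sigma> * (if ?j = ?i \<circ> \<sigma> then 1 else 0) = d \<sigma> * (if \<forall>l<K. snd (e l) = fst (e (\<sigma> l)) then 1 else 0)"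
        by simp
    qed
    finally show ?thesis .
  qed
  have "F v = (\<Sum>\<sigma>\<in>?P. d \<sigma> * psum {..<K} \<sigma> v)" for v
  proof -
    have "F v = (\<Sum>e\<in>?E. (\<Prod>l<K. v l $ fst (e l) $ snd (e l)) * F (\<lambda>l. munit (e l)))"
      by (rule mlin_expand[OF F])
    also have "\<dots> = (\<Sum>e\<in>?E. \<Sum>\<sigma>\<in>?P. d \<sigma> * (if \<forall>l<K. snd (e l) = fst (e (\<sigma> l)) then (\<Prod>l<K. v l $ fst (e l) $ snd (e l)) else 0))"
      unfolding coeff sum_distrib_left by (intro sum.cong refl) auto
    also have "\<dots> = (\<Sum>\<sigma>\<in>?P. \<Sum>e\<in>?E. d \<sigma> * (if \<forall>l<K. snd (e l) = fst (e (\<sigma> l)) then (\<Prod>l<K. v l $ fst (e l) $ snd (e l)) else 0))"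
      by (rule sum.swap)
    also have "\<dots> = (\<Sum>\<sigma>\<in>?P. d \<sigma> * psum {..<K} \<sigma> v)"
    proof (rule sum.cong[OF refl])
      fix \<sigma> assume s: "\<sigma> \<in> ?P"
      have s': "\<sigma> l < K" if "l < K" for l using s that permutes_in_image[of \<sigma> "{..<K}" l] by simp
      have "(\<Sum>e\<in>?E. if \<forall>l<K. snd (e l) = fst (e (\<sigma> l)) then (\<Prod>l<K. v l $ fst (e l) $ snd (e l)) else 0)
        = (\<Sum>e\<in>{e\<in>?E. \<forall>l<K. snd (e l) = fst (e (\<sigma> l))}. \<Prod>l<K. v l $ fst (e l) $ snd (e l))"
        by (rule sum.inter_filter[symmetric]) (simp add: finite_PiE)
      also have "\<dots> = psum {..<K} \<sigma> v"
        unfolding psum_def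
      proof (rule sum.reindex_bij_witness[where
          j = "\<lambda>e. restrict (fst \<circ> e) {..<K}" and i = "\<lambda>i. restrict (\<lambda>l. (i l, i (\<sigma> l))) {..<K}"])
        fix e assume e: "e \<in> {e\<in>?E. \<forall>l<K. snd (e l) = fst (e (\<sigma> l))}"
        then have eE: "e \<in> ?E" and es: "\<And>l. l < K \<Longrightarrow> snd (e l) = fst (e (\<sigma> l))" by auto
        show "restrict (\<lambda>l. (restrict (fst \<circ> e) {..<K} l, restrict (fst \<circ> e) {..<K} (\<sigma> l))) {..<K} = e"
        proof
          fix l
          show "restrict (\<lambda>l. (restrict (fst \<circ> e) {..<K} l, restrict (fst \<circ> e) {..<K} (\<sigma> l))) {..<K} l = e l"
            using es[of l] s'[of l] eE by (cases "l < K") (auto simp: prod_eq_iff PiE_def extensional_def)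
        qed
        show "(\<Prod>a<K. v a $ restrict (fst \<circ> e) {..<K} a $ restrict (fst \<circ> e) {..<K} (\<sigma> a)) = (\<Prod>l<K. v l $ fst (e l) $ snd (e l))"
          by (rule prod.cong[OF refl]) (use es s' in auto)
      next
        fix i assume i: "i \<in> {..<K} \<rightarrow>\<^sub>E (UNIV :: 'n set)"
        show "restrict (fst \<circ> restrict (\<lambda>l. (i l, i (\<sigma> l))) {..<K}) {..<K} = i"
          using i by (auto simp: fun_eq_iff PiE_def extensional_def)
        show "restrict (\<lambda>l. (i l, i (\<sigma> l))) {..<K} \<in> {e\<in>?E. \<forall>l<K. snd (e l) = fst (e (\<sigma> l))}"
          using s' by auto
      qed auto
      finally show "(\<Sum>e\<in>?E. d \<sigma> * (if \<forall>l<K. snd (e l) = fst (e (\<sigma> l)) then (\<Prod>l<K. v l $ fst (e l) $ snd (e l)) else 0))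
        = d \<sigma> * psum {..<K} \<sigma> v"
        by (simp only: sum_distrib_left[symmetric])
    qed
    finally show ?thesis .
  qed
  then show ?thesis by (rule that)
qed

section \<open>Spanning by trace monomials\<close>

text \<open>The cycles of \<sigma> are contracted one slot at a time. Slot \<open>z\<close> is never
  merged into another one, so \<open>E\<close> stays in front of the word of its cycle. It is enough
  to record the multiset of slots, since their order enters later through \<open>lsgn\<close>. Empty
  words are kept out of \<open>ls\<close> because the trace of the empty word is \<open>n\<close>,
  which does not alternate to zero like the other even traces.\<close>

lemma psum_trace_monomial:
  assumes "finite A" "z \<in> A" "\<sigma> permutes A" "\<And>a. a \<in> A - {z} \<Longrightarrow> L a \<noteq> []"
  shows "\<exists>l0 ls. [] \<notin> set ls \<and> mset (concat ls @ l0) = (\<Sum>a\<in>A. mset (L a)) \<and>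
    (\<forall>E v. psum A \<sigma> (lslot E z L v :: nat \<Rightarrow> ('a::field)^'n::finite^'n)
      = prod_list (map (\<lambda>l. mtrace (wd l v)) ls) * mtrace (E ** wd l0 v))"
  using assms
proof (induction "card A" arbitrary: A \<sigma> L rule: less_induct)
  case less
  have merge: "\<exists>l0 ls. [] \<notin> set ls \<and> mset (concat ls @ l0) = (\<Sum>a\<in>A. mset (L a)) \<and>
    (\<forall>E v. psum A \<sigma> (lslot E z L v :: nat \<Rightarrow> 'a^'n^'n)
      = prod_list (map (\<lambda>l. mtrace (wd l v)) ls) * mtrace (E ** wd l0 v))"
    if bc: "b \<in> A" "c \<in> A" "\<sigma> b = c" "c \<noteq> b" "c \<noteq> z" for b c
  proof -
    let ?L = "L(b := L b @ L c)"
    have bA: "b \<in> A - {c}" using bc by auto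
    have ms: "(\<Sum>a\<in>A - {c}. mset (?L a)) = (\<Sum>a\<in>A. mset (L a))"
    proof -
      have "(\<Sum>a\<in>A - {c}. mset (?L a)) = mset (L b @ L c) + (\<Sum>a\<in>A - {c} - {b}. mset (?L a))"
        using less.prems bA by (subst sum.remove[of _ b]) auto
      also have "(\<Sum>a\<in>A - {c} - {b}. mset (?L a)) = (\<Sum>a\<in>A - {c} - {b}. mset (L a))"
        by (rule sum.cong) auto
      also have "mset (L b @ L c) + \<dots> = mset (L c) + (\<Sum>a\<in>A - {c}. mset (L a))"
        using less.prems bA by (subst sum.remove[of "A - {c}" b]) auto
      also have "\<dots> = (\<Sum>a\<in>A. mset (L a))"
        using less.prems bc by (subst sum.remove[of A c]) auto
      finally show ?thesis .
    qed
    have m: "psum A \<sigma> (lslot E z L v) = psum (A - {c}) (bypass c \<sigma>) (lslot E z ?L v)" for E and v :: "nat \<Rightarrow> 'a^'n^'n"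
      using psum_merge[OF less.prems(1) bc(1) less.prems(3) bc(3,4), of "lslot E z L v"] lslot_merge[OF bc(5), of E L v b]
      by simp
    have "\<exists>l0 ls. [] \<notin> set ls \<and> mset (concat ls @ l0) = (\<Sum>a\<in>A - {c}. mset (?L a)) \<and>
      (\<forall>E v. psum (A - {c}) (bypass c \<sigma>) (lslot E z ?L v :: nat \<Rightarrow> 'a^'n^'n)
        = prod_list (map (\<lambda>l. mtrace (wd l v)) ls) * mtrace (E ** wd l0 v))"
    proof (rule less.hyps)
      show "card (A - {c}) < card A" using less.prems bc by (metis card_Diff1_less)
      show "bypass c \<sigma> permutes A - {c}" by (rule bypass_permutes[OF less.prems(3) bc(2)])
      show "?L a \<noteq> []" if "a \<in> A - {c} - {z}" for a
        using less.prems(4)[of a] less.prems(4)[of c] that bc by auto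
    qed (use less.prems bc in auto)
    then show ?thesis unfolding ms m .
  qed
  show ?case
  proof (cases "\<sigma> z = z")
    case False
    then show ?thesis
      using merge[of z "\<sigma> z"] less.prems permutes_in_image[OF less.prems(3), of z] by auto
  next
    case zz: True
    show ?thesis
    proof (cases "A = {z}")
      case True
      have "psum A \<sigma> (lslot E z L v) = mtrace (E ** wd (L z) v)" for E and v :: "nat \<Rightarrow> 'a^'n^'n"
        using psum_fixed_point[OF less.prems(1-3) zz, of "lslot E z L v"] True by (simp add: lslot_def)
      then show ?thesis using True by (intro exI[of _ "L z"] exI[of _ "[]"]) simp
    next
      case False
      then obtain b where b: "b \<in> A" "b \<noteq> z" using less.prems by auto
      have sb: "\<sigma> b \<noteq> z" using inj_eq[OF permutes_inj[OF less.prems(3)], of b z] zz b by auto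
      show ?thesis
      proof (cases "\<sigma> b = b")
        case False
        then show ?thesis using merge[of b "\<sigma> b"] b sb permutes_in_image[OF less.prems(3), of b] by auto
      next
        case True
        have p: "\<sigma> permutes (A - {b})"
          by (rule permutes_superset[OF less.prems(3)]) (use True in auto)
        have "\<exists>l0 ls. [] \<notin> set ls \<and> mset (concat ls @ l0) = (\<Sum>a\<in>A - {b}. mset (L a)) \<and>
          (\<forall>E v. psum (A - {b}) \<sigma> (lslot E z L v :: nat \<Rightarrow> 'a^'n^'n)
            = prod_list (map (\<lambda>l. mtrace (wd l v)) ls) * mtrace (E ** wd l0 v))"
        proof (rule less.hyps)
          show "card (A - {b}) < card A" using less.prems b by (metis card_Diff1_less)
        qed (use less.prems b p in auto)
        then obtain l0 ls where l: "[] \<notin> set ls" "mset (concat ls @ l0) = (\<Sum>a\<in>A - {b}. mset (L a))"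
          "\<And>E v. psum (A - {b}) \<sigma> (lslot E z L v :: nat \<Rightarrow> 'a^'n^'n)
            = prod_list (map (\<lambda>l. mtrace (wd l v)) ls) * mtrace (E ** wd l0 v)" by blast
        have "psum A \<sigma> (lslot E z L v) = mtrace (wd (L b) v) * psum (A - {b}) \<sigma> (lslot E z L v)" for E and v :: "nat \<Rightarrow> 'a^'n^'n"
          using psum_fixed_point[OF less.prems(1) b(1) less.prems(3) True, of "lslot E z L v"] b by (simp add: lslot_def)
        moreover have "mset (concat (L b # ls) @ l0) = (\<Sum>a\<in>A. mset (L a))"
          using less.prems b l(2) by (subst sum.remove[of A b]) auto
        ultimately show ?thesis
          using l less.prems(4)[of b] b by (intro exI[of _ l0] exI[of _ "L b # ls"]) (simp add: mult.assoc)
      qed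
    qed
  qed
qed

text \<open>Cuts a list of matrices into the words of the traces. The matrices enter through one
  list only, so that \<open>alt_perm_list\<close> applies.\<close>

fun tmono :: "nat list \<Rightarrow> ('a::field)^'n::finite^'n \<Rightarrow> ('a^'n^'n) list \<Rightarrow> 'a" where
  "tmono [] E X = mtrace (E ** mprod X)"
| "tmono (d # ds) E X = mtrace (mprod (take d X)) * tmono ds E (drop d X)"

lemma tmono_concat:
  "tmono (map length ls) E (map v (concat ls @ l0)) = prod_list (map (\<lambda>l. mtrace (wd l v)) ls) * mtrace (E ** wd l0 v)"
proof (induction ls)
  case Nil
  show ?case by (simp add: wd_mprod)
next
  case (Cons l ls)
  then show ?case by (simp add: wd_mprod mult.assoc)
qed

definition trX :: "nat list \<Rightarrow> nat \<Rightarrow> ('a::field,'n::finite) mform" where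
  "trX ds j = foldr (\<lambda>d acc. sform d (trw d) \<and>\<^sub>w acc) ds (fpow Xf j)"

lemma trX_hform:
  "trX ds j = (hform (sum_list ds + j) (\<lambda>v. \<chi> p q. tmono ds (munit (q, p)) (map v [0..<sum_list ds + j])) :: ('a::field_char_0,'n::finite) mform)"
proof (induction ds)
  case Nil
  show ?case by (simp add: trX_def fpow_Xf mtrace_munit wd_mprod[symmetric] eta_contract_eq)
next
  case (Cons d ds)
  let ?m = "sum_list ds + j"
  have "trX (d # ds) j = (hform d (\<lambda>v. mat (trw d v)) \<and>\<^sub>w hform ?m (\<lambda>v. \<chi> p q. tmono ds (munit (q, p)) (map v [0..<?m])) :: ('a,'n) mform)"
    using Cons by (simp add: trX_def sform_def)
  also have "\<dots> = hform (d + ?m) (\<lambda>v. mat (trw d v) ** (\<chi> p q. tmono ds (munit (q, p)) (map (shift d v) [0..<?m])))"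
    by (rule wedge_hform[OF local_on_comp[OF local_on_trw]])
  also have "(\<lambda>v. mat (trw d v) ** (\<chi> p q. tmono ds (munit (q, p)) (map (shift d v) [0..<?m])))
     = (\<lambda>v :: nat \<Rightarrow> 'a^'n^'n. \<chi> p q. tmono (d # ds) (munit (q, p)) (map v [0..<d + ?m]))"
  proof
    fix v :: "nat \<Rightarrow> 'a^'n^'n"
    have "take d (map v [0..<d + ?m]) = map v [0..<d]" by (simp add: take_map)
    moreover have "drop d (map v [0..<d + ?m]) = map (shift d v) [0..<?m]"
      by (rule nth_equalityI) (auto simp: shift_apply add.commute)
    ultimately show "mat (trw d v) ** (\<chi> p q. tmono ds (munit (q, p)) (map (shift d v) [0..<?m]))
      = (\<chi> p q. tmono (d # ds) (munit (q, p)) (map v [0..<d + ?m]))"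
      by (simp add: vec_eq_iff trw_def wd_mprod)
  qed
  finally show ?case by (simp add: add.assoc)
qed

lemma trace_form_even:
  assumes "even d" "d > 0"
  shows "sform d (trw d) = (0 :: ('a::field_char_0,'n::finite) mform)"
proof (rule mform_eqI)
  fix k p q and v :: "nat \<Rightarrow> 'a^'n^'n"
  have "alt d (\<lambda>v. 1 * mtrace (wd [0..<d] v)) v = 0"
    using alt_even_trace_zero[of "[]" "[0..<d]" d "\<lambda>_. 1" v] assms perm_list_upt by simp
  moreover have "trw d = (\<lambda>v :: nat \<Rightarrow> 'a^'n^'n. 1 * mtrace (wd [0..<d] v))"
    by (rule ext) (simp only: trw_def mult_1)
  ultimately have "alt d (trw d) v = 0" by (simp only:)
  then show "sform d (trw d) k v $ p $ q = (0 :: ('a,'n) mform) k v $ p $ q"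
    by (simp add: sform_nth fun_apply)
qed

definition TXspan :: "('a::field_char_0,'n::finite) mform set" where
  "TXspan = mf.span {TX S j | S j. S \<subseteq> {..<CARD('n)}}"

lemma Tf_wedge_TXspan:
  assumes "f \<in> TXspan" shows "Tf h \<and>\<^sub>w f \<in> (TXspan :: ('a::field_char_0,'n::finite) mform set)"
  using assms unfolding TXspan_def
proof (induction rule: mf.span_induct_alt)
  case base
  then show ?case by (simp add: mf.span_zero)
next
  case (step c x y)
  then obtain S j where x: "x = TX S j" "S \<subseteq> {..<CARD('n)}" by auto
  have fS: "finite S" using x finite_subset by blast
  have "Tf h \<and>\<^sub>w x \<in> mf.span {TX S j | S j. S \<subseteq> {..<CARD('n)}}"
  proof (cases "h < CARD('n)")
    case False
    then show ?thesis by (simp add: Tf_zero mf.span_zero)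
  next
    case True
    have "Tf h \<and>\<^sub>w x = (Tf h \<and>\<^sub>w Tprod S) \<and>\<^sub>w fpow Xf j"
      unfolding x(1) TX_def by (rule wedge_assoc[symmetric, OF hom_form_Tf hom_form_Tprod[OF fS] hom_form_pow])
    also have "\<dots> = (if h \<in> S then 0 else fscale ((-1) ^ card {s \<in> S. s < h}) (TX (insert h S) j))"
      by (simp add: Tf_wedge_Tprod[OF fS] TX_def wedge_scale_left)
    also have "\<dots> \<in> mf.span {TX S j | S j. S \<subseteq> {..<CARD('n)}}"
    proof (cases "h \<in> S")
      case False
      have "TX (insert h S) j \<in> {TX S j | S j. S \<subseteq> {..<CARD('n)}}" using True x(2) by blast
      then have "fscale c' (TX (insert h S) j) \<in> mf.span {TX S j | S j. S \<subseteq> {..<CARD('n)}}" for c'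
        by (intro mf.span_scale mf.span_base)
      then show ?thesis using False by (simp only: if_False)
    qed (simp add: mf.span_zero)
    finally show ?thesis .
  qed
  then show ?case using step by (simp add: wedge_add_right wedge_scale_right mf.span_add mf.span_scale)
qed

text \<open>Trace forms of positive even degree vanish and those of odd degree are the
  \<open>T_h\<close>, so every product of traces collapses to the sorted monomials.\<close>

lemma trX_TXspan:
  assumes "0 \<notin> set ds" shows "trX ds j \<in> (TXspan :: ('a::field_char_0,'n::finite) mform set)"
  using assms
proof (induction ds)
  case Nil
  have "trX [] j = (TX {} j :: ('a,'n) mform)"
    by (simp add: trX_def TX_def Tprod_empty wedge_fone_left[OF hom_form_pow])
  then show ?case unfolding TXspan_def by (auto intro: mf.span_base)
next
  case (Cons d ds)
  have e: "trX (d # ds) j = (sform d (trw d) \<and>\<^sub>w trX ds j :: ('a,'n) mform)" by (simp add: trX_def)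
  show ?case
  proof (cases "even d")
    case True
    then have "sform d (trw d) = (0 :: ('a,'n) mform)" using Cons.prems by (intro trace_form_even) auto
    then have "trX (d # ds) j = (0 :: ('a,'n) mform)" unfolding e by simp
    then show ?thesis unfolding TXspan_def by (simp add: mf.span_zero)
  next
    case False
    then obtain h where "d = 2 * h + 1" by (auto elim: oddE)
    then show ?thesis unfolding e using Cons Tf_wedge_TXspan[of "trX ds j" h] by (simp add: Tf_sform)
  qed
qed

lemma kform_perm:
  assumes "kform k f" "\<pi> permutes {..<k}"
  shows "f (v \<circ> \<pi>) $ p $ q = of_int (sign \<pi>) * f v $ p $ q"
  using assms(2) finite_lessThan
proof (induction \<pi> arbitrary: v rule: permutes_induct)
  case id
  then show ?case by simp
next
  case (swap a b \<pi>)
  have t: "f (w \<circ> Transposition.transpose a b) $ p $ q = - f w $ p $ q" for w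
  proof (cases "a < b")
    case True
    then show ?thesis using kform_nth(3)[OF assms(1) True] swap by simp
  next
    case False
    then show ?thesis using kform_nth(3)[OF assms(1), of b a w p q] swap by (simp add: transpose_commute)
  qed
  have "permutation \<pi>" using swap permutation_permutes by blast
  then have s: "sign (Transposition.transpose a b \<circ> \<pi>) = - sign \<pi>"
    using swap by (simp add: sign_compose permutation_swap_id sign_swap_id)
  have f: "f (v \<circ> (Transposition.transpose a b \<circ> \<pi>)) $ p $ q = of_int (sign \<pi>) * f (v \<circ> Transposition.transpose a b) $ p $ q"
    unfolding comp_assoc[symmetric] by (rule swap.IH)
  show ?case unfolding f s t by simp
qed

lemma sum_singletons_mset: "(\<Sum>a<k. {#a#}) = mset [0..<k]"
proof (induction k)
  case (Suc k)
  have "(\<Sum>a<Suc k. {#a#}) = (\<Sum>a<k. {#a#}) + {#k#}" by (rule sum.lessThan_Suc)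
  then show ?case unfolding Suc by simp
qed simp

lemma homogeneous_component_TXspan:
  assumes f: "f \<in> (A_alg :: ('a::field_char_0,'n::finite) mform set)"
  shows "(\<lambda>m v. if m = k then f k v else 0) \<in> TXspan"
proof -
  have kf: "kform k (f k)" using f by (simp add: A_alg_def forms_def)
  \<comment> \<open>Slot \<open>k\<close> pairs the value of the form with one further matrix. A
    matrix unit in this slot gives back an entry, see \<open>entry\<close>.\<close>
  define F where "F v = mtrace (f k v ** v k)" for v
  have Fs: "F v = (\<Sum>p\<in>UNIV. \<Sum>q\<in>UNIV. f k v $ p $ q * v k $ q $ p)" for v
    by (simp add: F_def mtrace_def matrix_matrix_mult_def)
  have loc: "local_on (Suc k) F"
    unfolding local_on_def
  proof (intro allI impI)
    fix v v' :: "nat \<Rightarrow> 'a^'n^'n" assume v: "\<forall>i<Suc k. v i = v' i"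
    then have "f k v = f k v'" using kf unfolding kform_def by (meson less_SucI)
    then show "F v = F v'" using v by (simp add: F_def)
  qed
  have ml: "mlin (Suc k) F"
    unfolding mlin_def
  proof (intro allI impI)
    fix i c and v :: "nat \<Rightarrow> 'a^'n^'n" and x y :: "'a^'n^'n" assume i: "i < Suc k"
    show "F (v(i := mat c ** x + y)) = c * F (v(i := x)) + F (v(i := y))"
    proof (cases "i = k")
      case True
      have "f k (v(k := z)) = f k v" for z
        using kf unfolding kform_def by auto
      then show ?thesis unfolding F_def True
        by (simp add: matrix_add_ldistrib mtrace_add) (metis mat_commute matrix_mul_assoc mtrace_mat_scale)
    next
      case False
      then have "f k (v(i := mat c ** x + y)) = mat c ** f k (v(i := x)) + f k (v(i := y))"
        using kf i unfolding kform_def by auto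
      then show ?thesis using False unfolding F_def
        by (simp add: matrix_add_rdistr mtrace_add mtrace_mat_scale matrix_mul_assoc[symmetric])
    qed
  qed
  have inv: "F (\<lambda>i. g ** v i ** g') = F v" if g: "g ** g' = mat 1" "g' ** g = mat 1" for g g' v
  proof -
    have "f k (\<lambda>i. g ** v i ** g') = g ** f k v ** g'"
      using f g by (auto simp: A_alg_def invariant_def)
    then have "F (\<lambda>i. g ** v i ** g') = mtrace (g ** (f k v ** (g' ** g) ** v k ** g'))"
      by (simp add: F_def matrix_mul_assoc)
    also have "\<dots> = mtrace (f k v ** v k ** (g' ** g))"
      using g by (subst mtrace_mult_commute) (simp add: matrix_mul_assoc[symmetric])
    finally show ?thesis using g by (simp add: F_def)
  qed
  obtain d where d: "\<And>v. F v = (\<Sum>\<sigma> | \<sigma> permutes {..<Suc k}. d \<sigma> * psum {..<Suc k} \<sigma> v)"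
    using first_fundamental_theorem[OF ml loc inv] by blast
  let ?P = "{\<sigma>. \<sigma> permutes {..<Suc k}}"
  have entry: "f k v $ p $ q = F (v(k := munit (q, p)))" for v p q
  proof -
    have "f k (v(k := munit (q, p))) = f k v" using kf unfolding kform_def by auto
    then show ?thesis by (simp add: F_def mtrace_mult_commute[of "f k v"] mtrace_munit)
  qed
  define Q where "Q \<sigma> t \<longleftrightarrow> t \<in> TXspan \<and> (\<forall>v p q. alt k (\<lambda>v. psum {..<Suc k} \<sigma> (v(k := munit (q, p)))) v = t k v $ p $ q)
      \<and> (\<forall>m v. m \<noteq> k \<longrightarrow> t m v = (0 :: 'a^'n^'n))" for \<sigma> t
  have mono: "\<exists>t. Q \<sigma> t" if s: "\<sigma> \<in> ?P" for \<sigma>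
  proof -
    \<comment> \<open>Slot \<open>k\<close> is the distinguished one and carries nothing but
      \<open>E\<close>, hence the empty word.\<close>
    let ?L = "\<lambda>a. if a = k then [] else [a]"
    obtain l0 ls where l: "[] \<notin> set ls" "mset (concat ls @ l0) = (\<Sum>a\<in>{..<Suc k}. mset (?L a))"
      "\<And>E v. psum {..<Suc k} \<sigma> (lslot E k ?L v :: nat \<Rightarrow> 'a^'n^'n)
            = prod_list (map (\<lambda>l. mtrace (wd l v)) ls) * mtrace (E ** wd l0 v)"
      using psum_trace_monomial[of "{..<Suc k}" k \<sigma> ?L] s by auto
    have lsl: "lslot E k ?L v = v(k := E)" for E and v :: "nat \<Rightarrow> 'a^'n^'n"
      by (auto simp: lslot_def fun_eq_iff)
    have "(\<Sum>a\<in>{..<Suc k}. mset (?L a)) = (\<Sum>a<k. mset (?L a)) + mset (?L k)"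
      by (rule sum.lessThan_Suc)
    also have "(\<Sum>a<k. mset (?L a)) = (\<Sum>a<k. {#a#})"
      by (rule sum.cong[OF refl]) auto
    also have "(\<Sum>a<k. {#a#}) + mset (?L k) = mset [0..<k]"
      unfolding sum_singletons_mset by simp
    finally have ms: "mset (concat ls @ l0) = mset [0..<k]" using l(2) by (simp only:)
    have pl: "perm_list (concat ls @ l0)" using perm_list_upt ms by (rule perm_list_permute)
    have len: "length (concat ls @ l0) = k" using mset_eq_length[OF ms] by simp
    let ?ds = "map length ls" and ?j = "length l0"
    have sl: "sum_list ?ds + ?j = k" using len by (simp add: length_concat)
    let ?t = "fscale (of_int (lsgn (concat ls @ l0))) (trX ?ds ?j) :: ('a,'n) mform"
    have t1: "alt k (\<lambda>v. psum {..<Suc k} \<sigma> (v(k := munit (q, p)))) v = ?t k v $ p $ q" for v p q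
    proof -
      have "alt k (\<lambda>v. psum {..<Suc k} \<sigma> (v(k := munit (q, p)))) v
        = alt k (\<lambda>v. tmono ?ds (munit (q, p)) (map v (concat ls @ l0))) v"
        unfolding lsl[symmetric] l(3) tmono_concat ..
      also have "\<dots> = of_int (lsgn (concat ls @ l0)) * alt k (\<lambda>v. tmono ?ds (munit (q, p)) (map v [0..<k])) v"
        by (rule alt_perm_list[OF pl len])
      also have "\<dots> = ?t k v $ p $ q"
        unfolding trX_hform sl fscale_nth hform_nth by (simp only: simp_thms if_True vec_lambda_beta)
      finally show ?thesis .
    qed
    have t2: "?t \<in> TXspan"
    proof -
      have "0 \<notin> set ?ds" using l(1) by (simp add: image_iff)
      then have "trX ?ds ?j \<in> (TXspan :: ('a,'n) mform set)" by (rule trX_TXspan)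
      then show ?thesis unfolding TXspan_def by (rule mf.span_scale)
    qed
    have t3: "?t m v = 0" if "m \<noteq> k" for m v
    proof -
      have "(trX ?ds ?j :: ('a,'n) mform) m v = 0"
        unfolding trX_hform sl hform_def using that by (simp only: if_False)
      then show ?thesis by (simp add: fscale_def)
    qed
    have "Q \<sigma> ?t" unfolding Q_def by (intro conjI allI impI t1 t2 t3)
    then show ?thesis by (rule exI[where x = ?t])
  qed
  have "\<forall>\<sigma>\<in>?P. \<exists>t. Q \<sigma> t" by (rule ballI) (rule mono)
  from bchoice[OF this] obtain t where tQ: "\<forall>\<sigma>\<in>?P. Q \<sigma> (t \<sigma>)" by (rule exE)
  have t: "\<And>\<sigma>. \<sigma> \<in> ?P \<Longrightarrow> t \<sigma> \<in> TXspan"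
    "\<And>\<sigma> v p q. \<sigma> \<in> ?P \<Longrightarrow> alt k (\<lambda>v. psum {..<Suc k} \<sigma> (v(k := munit (q, p)))) v = t \<sigma> k v $ p $ q"
    "\<And>\<sigma> m v. \<sigma> \<in> ?P \<Longrightarrow> m \<noteq> k \<Longrightarrow> t \<sigma> m v = (0 :: 'a^'n^'n)"
    using bspec[OF tQ] unfolding Q_def by simp_all
  have "(\<lambda>m v. if m = k then f k v else 0) = (\<Sum>\<sigma>\<in>?P. fscale (d \<sigma> / fact k) (t \<sigma>))"
  proof (rule mform_eqI)
    fix m v p q
    show "(if m = k then f k v else 0) $ p $ q = (\<Sum>\<sigma>\<in>?P. fscale (d \<sigma> / fact k) (t \<sigma>)) m v $ p $ q"
    proof (cases "m = k")
      case False
      have "(\<Sum>\<sigma>\<in>?P. fscale (d \<sigma> / fact k) (t \<sigma>) m v) = 0"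
        by (rule sum.neutral) (simp add: t(3)[OF _ False] fscale_def)
      then show ?thesis using False by (simp only: sum_fun_apply if_False)
    next
      case True
      \<comment> \<open>\<open>f k\<close> is alternating already, so one more alternation
        multiplies it by \<open>k!\<close>, while on the other side it turns each
        \<open>psum\<close> into a product of trace forms.\<close>
      have "of_nat (fact k) * f k v $ p $ q = alt k (\<lambda>v. f k v $ p $ q) v"
        by (rule alt_alternating_fixed[symmetric], rule kform_perm[OF kf])
      also have "\<dots> = (\<Sum>\<sigma>\<in>?P. d \<sigma> * alt k (\<lambda>v. psum {..<Suc k} \<sigma> (v(k := munit (q, p)))) v)"
        unfolding entry d alt_sum alt_mult_const ..
      also have "\<dots> = (\<Sum>\<sigma>\<in>?P. d \<sigma> * t \<sigma> k v $ p $ q)"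
        by (rule sum.cong[OF refl]) (simp only: t(2))
      finally have "f k v $ p $ q = (\<Sum>\<sigma>\<in>?P. d \<sigma> * t \<sigma> k v $ p $ q) / fact k"
        by (simp add: field_simps)
      then show ?thesis using True by (simp add: sum_fun_apply sum_divide_distrib)
    qed
  qed
  also have "\<dots> \<in> TXspan"
    unfolding TXspan_def by (intro mf.span_sum mf.span_scale) (use t(1) in \<open>simp add: TXspan_def\<close>)
  finally show ?thesis .
qed

theorem A_alg_subset_TXspan: "(A_alg :: ('a::field_char_0,'n::finite) mform set) \<subseteq> TXspan"
proof
  fix f :: "('a,'n) mform" assume f: "f \<in> A_alg"
  have "f = (\<Sum>k\<le>CARD('n)^2. (\<lambda>m v. if m = k then f k v else 0))"
  proof (intro ext)
    fix m v
    show "f m v = (\<Sum>k\<le>CARD('n)^2. (\<lambda>m v. if m = k then f k v else 0)) m v"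
      using f by (cases "m \<le> CARD('n)^2") (auto simp: sum_fun_apply A_alg_def forms_def)
  qed
  also have "\<dots> \<in> TXspan"
    unfolding TXspan_def
    by (intro mf.span_sum) (use homogeneous_component_TXspan[OF f] in \<open>simp add: TXspan_def\<close>)
  finally show "f \<in> TXspan" .
qed

section \<open>Reduction modulo the relations\<close>

lemma ta_basis_in_TA: "ta_basis n S k \<in> TA n"
  by (simp add: TA_def ta_basis_def)

lemma ta_mult_in_TA: "ta_mult n a b \<in> TA n"
  by (simp add: TA_def ta_mult_def)

lemma ta_mult_add_right: "ta_mult n a (\<lambda>U m. b U m + c U m) = (\<lambda>U m. ta_mult n a b U m + ta_mult n a c U m)"
  by (auto simp: ta_mult_def fun_eq_iff sum.distrib distrib_left)

lemma ta_mult_scale_right: "ta_mult n a (\<lambda>U m. s * b U m) = (\<lambda>U m. s * ta_mult n a b U m)"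
  by (auto simp: ta_mult_def fun_eq_iff sum_distrib_left mult.left_commute[of _ s])

lemma ta_mult_sum_right:
  "finite I \<Longrightarrow> ta_mult n a (\<lambda>U m. \<Sum>i\<in>I. c i U m) = (\<lambda>U m. \<Sum>i\<in>I. ta_mult n a (c i) U m)"
proof (induction I rule: finite_induct)
  case empty
  show ?case by (simp add: ta_mult_def fun_eq_iff)
next
  case (insert i I)
  then show ?case by (simp add: ta_mult_add_right)
qed

lemma ta_mult_linear_right:
  assumes "finite I"
  shows "ta_mult n a (\<lambda>U m. s * b U m - (\<Sum>i\<in>I. c i U m)) = (\<lambda>U m. s * ta_mult n a b U m - (\<Sum>i\<in>I. ta_mult n a (c i) U m))"
proof -
  have "(\<lambda>U m. s * b U m - (\<Sum>i\<in>I. c i U m)) = (\<lambda>U m. s * b U m + (-1) * (\<Sum>i\<in>I. c i U m))" by simp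
  then show ?thesis
    by (simp only: ta_mult_add_right ta_mult_scale_right ta_mult_sum_right[OF assms]) simp
qed

lemma tsign_square: "tsign S R k * tsign S R k = 1"
  unfolding tsign_def by (rule minus_one_mult_self)

lemma ta_basis_mult_overlap:
  assumes "S \<inter> R \<noteq> {}"
  shows "ta_mult n (ta_basis n S k) (ta_basis n R l) = (\<lambda>U m. 0 :: 'a::field)"
proof (intro ext)
  fix U m
  have "of_int (tsign S' (U - S') k') * ta_basis n S k S' k' * (ta_basis n R l (U - S') (m - k') :: 'a) = 0" for S' k'
    using assms by (auto simp: ta_basis_def)
  then show "ta_mult n (ta_basis n S k) (ta_basis n R l) U m = (0 :: 'a)"
    by (simp only: ta_mult_def sum.neutral_const if_cancel)
qed

text \<open>\<open>ta_ideal\<close> has no rule for scalars; a scalar multiple is obtained as the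
  product with a multiple of the unit.\<close>

lemma ta_scalar_mult:
  assumes "c \<in> TA n"
  shows "ta_mult n (\<lambda>U m. t * ta_basis n {} 0 U m) c = (\<lambda>U m. t * c U m)"
proof (intro ext)
  fix U m
  show "ta_mult n (\<lambda>U m. t * ta_basis n {} 0 U m) c U m = t * c U m"
  proof (cases "ta_ok n U m")
    case False
    then show ?thesis using assms by (simp add: ta_mult_def TA_def)
  next
    case True
    then have fU: "finite U" using finite_subset by (auto simp: ta_ok_def)
    have ok0: "ta_ok n {} 0" by (simp add: ta_ok_def tdeg_def)
    have "ta_mult n (\<lambda>U m. t * ta_basis n {} 0 U m) c U m
      = (\<Sum>y\<in>Pow U \<times> {..m}. if y = ({}, 0) then t * c U m else 0)"
      using True unfolding ta_mult_def
      by (simp add: sum.cartesian_product case_prod_unfold)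
        (intro sum.cong refl, auto simp: ta_basis_def ok0 tsign_def prod_eq_iff)
    also have "\<dots> = t * c U m" using fU by (subst sum.delta) auto
    finally show ?thesis .
  qed
qed

locale ta_relations =
  fixes n :: nat and dummy :: "'a::field_char_0 itself"
  assumes n: "n \<ge> 1"
begin

definition J :: "'a ta set" where
  "J = ta_ideal n {ta_pow n (ta_X n) (2 * n), ta_O n}"

text \<open>The normal forms: \<open>T_(n-1)\<close> is eliminated by means of \<open>O_n\<close>,
  and the powers from \<open>X^(2n)\<close> on by means of the other generator.\<close>

definition R :: "'a ta set" where
  "R = {c \<in> TA n. \<forall>S k. c S k \<noteq> 0 \<longrightarrow> S \<subseteq> {..<n - 1} \<and> k < 2 * n}"

definition reducible :: "'a ta \<Rightarrow> bool" where
  "reducible c \<longleftrightarrow> (\<exists>r\<in>R. (\<lambda>U m. c U m - r U m) \<in> J)"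

lemma ta_O_eq: "ta_O n = (\<lambda>U m. of_nat n * ta_basis n {} (2 * n - 1) U m - (\<Sum>i<n. ta_basis n {n - i - 1} (2 * i) U m) :: 'a)"
proof -
  have "ta_mult n (ta_basis n {} (2 * i)) (ta_basis n {n - i - 1} 0) = (ta_basis n {n - i - 1} (2 * i) :: 'a ta)" for i
    by (subst ta_basis_mult) (auto simp: tsign_def power_mult)
  then show ?thesis
    unfolding ta_O_def ta_pow_X[OF n] ta_T_def by simp
qed

lemma J_subset_TA: "c \<in> J \<Longrightarrow> c \<in> TA n"
  unfolding J_def
proof (induction rule: ta_ideal.induct)
  case (base b)
  have "ta_basis n S k U m = (0 :: 'a)" if "\<not> ta_ok n U m" for S k U m
    using that by (auto simp: ta_basis_def)
  then have "(ta_O n :: 'a ta) \<in> TA n"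
    by (simp add: TA_def ta_O_eq)
  then show ?case using base by (auto simp: ta_pow_X[OF n] ta_basis_in_TA)
next
  case (add a b)
  then show ?case by (simp add: TA_def)
next
  case zero
  show ?case by (simp add: TA_def)
qed (rule ta_mult_in_TA)+

lemma J_zero: "(\<lambda>U m. 0) \<in> J"
  unfolding J_def by (rule ta_ideal.zero)

lemma J_add: "a \<in> J \<Longrightarrow> b \<in> J \<Longrightarrow> (\<lambda>U m. a U m + b U m) \<in> J"
  unfolding J_def by (rule ta_ideal.add)

lemma J_scale: "c \<in> J \<Longrightarrow> (\<lambda>U m. t * c U m) \<in> J"
proof -
  assume c: "c \<in> J"
  have "(\<lambda>U m. t * ta_basis n {} 0 U m) \<in> TA n" by (simp add: TA_def ta_basis_def)
  then have "ta_mult n (\<lambda>U m. t * ta_basis n {} 0 U m) c \<in> J"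
    using c unfolding J_def by (intro ta_ideal.lmult)
  then show ?thesis unfolding ta_scalar_mult[OF J_subset_TA[OF c]] .
qed

lemma J_high_power:
  assumes "S \<subseteq> {..<n}" "k \<ge> 2 * n" shows "ta_basis n S k \<in> J"
proof -
  have "finite S" using assms finite_subset by blast
  then have "ta_mult n (ta_basis n S (k - 2 * n)) (ta_basis n {} (2 * n)) = (ta_basis n S k :: 'a ta)"
    using assms(2) by (subst ta_basis_mult) (auto simp: tsign_def)
  moreover have "ta_basis n {} (2 * n) \<in> J"
    unfolding J_def by (rule ta_ideal.base) (simp add: ta_pow_X[OF n])
  then have "ta_mult n (ta_basis n S (k - 2 * n)) (ta_basis n {} (2 * n)) \<in> J"
    unfolding J_def by (rule ta_ideal.lmult) (rule ta_basis_in_TA)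
  ultimately show ?thesis by simp
qed

lemma reducible_lin: "reducible a \<Longrightarrow> reducible b \<Longrightarrow> reducible (\<lambda>U m. s * a U m + t * b U m)"
proof -
  assume "reducible a" "reducible b"
  then obtain r r' where r: "r \<in> R" "(\<lambda>U m. a U m - r U m) \<in> J" "r' \<in> R" "(\<lambda>U m. b U m - r' U m) \<in> J"
    unfolding reducible_def by blast
  have "(\<lambda>U m. s * r U m + t * r' U m) \<in> R"
    unfolding R_def
  proof (intro CollectI conjI allI impI)
    show "(\<lambda>U m. s * r U m + t * r' U m) \<in> TA n" using r by (simp add: R_def TA_def)
    fix S k assume "s * r S k + t * r' S k \<noteq> 0"
    then have "r S k \<noteq> 0 \<or> r' S k \<noteq> 0" by auto
    then show "S \<subseteq> {..<n - 1}" "k < 2 * n" using r(1,3) unfolding R_def by blast+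
  qed
  moreover have "(\<lambda>U m. s * (a U m - r U m) + t * (b U m - r' U m)) \<in> J"
    by (rule J_add[OF J_scale[OF r(2)] J_scale[OF r(4)]])
  then have "(\<lambda>U m. (s * a U m + t * b U m) - (s * r U m + t * r' U m)) \<in> J"
    by (simp add: algebra_simps)
  ultimately show ?thesis
    unfolding reducible_def by (intro bexI[where x = "\<lambda>U m. s * r U m + t * r' U m"])
qed

lemma R_zero: "(\<lambda>U m. 0) \<in> R"
  by (simp add: R_def TA_def)

lemma reducible_J: "c \<in> J \<Longrightarrow> reducible c"
  unfolding reducible_def using R_zero by (intro bexI[of _ "\<lambda>U m. 0"]) auto

lemma reducible_sum:
  "finite I \<Longrightarrow> (\<And>i. i \<in> I \<Longrightarrow> reducible (c i)) \<Longrightarrow> reducible (\<lambda>U m. \<Sum>i\<in>I. t i * c i U m)"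
proof (induction I rule: finite_induct)
  case empty
  then show ?case using reducible_J[OF J_zero] by simp
next
  case (insert i I)
  then have "reducible (\<lambda>U m. t i * c i U m + 1 * (\<Sum>i\<in>I. t i * c i U m))"
    by (intro reducible_lin) auto
  then show ?case using insert by simp
qed

lemma reducible_basis_low:
  assumes "S \<subseteq> {..<n - 1}" shows "reducible (ta_basis n S k)"
proof (cases "k < 2 * n")
  case True
  then have "ta_basis n S k \<in> R" using assms ta_basis_in_TA[of n S k] by (auto simp: R_def ta_basis_def)
  then show ?thesis unfolding reducible_def by (intro bexI[of _ "ta_basis n S k"]) (auto simp: J_zero)
next
  case False
  have "S \<subseteq> {..<n}" using assms by auto
  then show ?thesis using False by (intro reducible_J J_high_power) auto
qed

text \<open>\<open>O_n\<close> is solved for its term with \<open>i = 0\<close>, which is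
  \<open>T_(n-1)\<close>. After multiplication by the remaining factors this term becomes the given
  monomial up to sign, and no other term contains \<open>T_(n-1)\<close>.\<close>

lemma reducible_basis:
  assumes "S \<subseteq> {..<n}" shows "reducible (ta_basis n S k)"
proof (cases "n - 1 \<in> S")
  case False
  have "S \<subseteq> {..<n - 1}"
  proof
    fix s assume "s \<in> S"
    then have "s < n" "s \<noteq> n - 1" using assms False by auto
    then show "s \<in> {..<n - 1}" by simp
  qed
  then show ?thesis by (rule reducible_basis_low)
next
  case True
  define S' where "S' = S - {n - 1}"
  have S': "S' \<subseteq> {..<n - 1}" "finite S'" "S' \<inter> {n - 1} = {}" "insert (n - 1) S' = S"
  proof -
    show "S' \<subseteq> {..<n - 1}"
    proof
      fix s assume "s \<in> S'"
      then have "s < n" "s \<noteq> n - 1" using assms by (auto simp: S'_def)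
      then show "s \<in> {..<n - 1}" by simp
    qed
    then show "finite S'" using finite_subset by blast
    show "S' \<inter> {n - 1} = {}" "insert (n - 1) S' = S" using True by (auto simp: S'_def)
  qed
  \<comment> \<open>The sign of the product, or 0 if \<open>T_(n-i-1)\<close> occurs already in
    \<open>S'\<close> and the product vanishes.\<close>
  define s where "s i = (if n - i - 1 \<in> S' then 0 else of_int (tsign S' {n - i - 1} k) :: 'a)" for i
  have summand: "ta_mult n (ta_basis n S' k) (ta_basis n {n - i - 1} (2 * i))
      = (\<lambda>U m. s i * ta_basis n (insert (n - i - 1) S') (k + 2 * i) U m)" for i
  proof (cases "n - i - 1 \<in> S'")
    case True
    then show ?thesis by (subst ta_basis_mult_overlap) (auto simp: s_def)
  next
    case False
    then show ?thesis using S' by (subst ta_basis_mult) (auto simp: s_def)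
  qed
  have X: "ta_mult n (ta_basis n S' k) (ta_basis n {} (2 * n - 1)) = (ta_basis n S' (k + (2 * n - 1)) :: 'a ta)"
    using S' by (subst ta_basis_mult) (auto simp: tsign_def)
  define P where "P = ta_mult n (ta_basis n S' k) (ta_O n :: 'a ta)"
  have PJ: "P \<in> J"
    unfolding P_def J_def by (intro ta_ideal.lmult ta_ideal.base ta_basis_in_TA) simp
  have P: "P = (\<lambda>U m. of_nat n * ta_basis n S' (k + (2 * n - 1)) U m
      - (\<Sum>i<n. s i * ta_basis n (insert (n - i - 1) S') (k + 2 * i) U m))"
    unfolding P_def ta_O_eq ta_mult_linear_right[OF finite_lessThan] summand X ..
  have split: "(\<Sum>i<n. s i * ta_basis n (insert (n - i - 1) S') (k + 2 * i) U m)
      = s 0 * ta_basis n S k U m + (\<Sum>i\<in>{1..<n}. s i * ta_basis n (insert (n - i - 1) S') (k + 2 * i) U m)" for U m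
  proof -
    have "{..<n} = insert 0 {1..<n}" using n by auto
    then show ?thesis using S'(4) by simp
  qed
  \<comment> \<open>A sign is its own inverse, so multiplication by \<open>s 0\<close> isolates the
    wanted monomial.\<close>
  have s0: "s 0 * s 0 = 1"
    using S'(3) tsign_square[of S' "{n - 1}" k] by (simp add: s_def flip: of_int_mult)
  have red: "reducible (\<lambda>U m. \<Sum>i\<in>{1..<n}. s i * ta_basis n (insert (n - i - 1) S') (k + 2 * i) U m)"
  proof (rule reducible_sum)
    fix i assume "i \<in> {1..<n}"
    then have "insert (n - i - 1) S' \<subseteq> {..<n - 1}" using S'(1) by auto
    then show "reducible (ta_basis n (insert (n - i - 1) S') (k + 2 * i))" by (rule reducible_basis_low)
  qed simp
  have "reducible (\<lambda>U m. of_nat n * ta_basis n S' (k + (2 * n - 1)) U m + (-1) * P U m)"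
    by (rule reducible_lin[OF reducible_basis_low[OF S'(1)] reducible_J[OF PJ]])
  from reducible_lin[OF this red, of "s 0" "- s 0"]
  have "reducible (\<lambda>U m. s 0 * (of_nat n * ta_basis n S' (k + (2 * n - 1)) U m + (-1) * P U m)
     + (- s 0) * (\<Sum>i\<in>{1..<n}. s i * ta_basis n (insert (n - i - 1) S') (k + 2 * i) U m))" .
  also have "(\<lambda>U m. s 0 * (of_nat n * ta_basis n S' (k + (2 * n - 1)) U m + (-1) * P U m)
     + (- s 0) * (\<Sum>i\<in>{1..<n}. s i * ta_basis n (insert (n - i - 1) S') (k + 2 * i) U m)) = ta_basis n S k"
  proof (intro ext)
    fix U m
    have "s 0 * (of_nat n * ta_basis n S' (k + (2 * n - 1)) U m + (-1) * P U m)
     + (- s 0) * (\<Sum>i\<in>{1..<n}. s i * ta_basis n (insert (n - i - 1) S') (k + 2 * i) U m) = (s 0 * s 0) * ta_basis n S k U m"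
      unfolding P split by (simp add: algebra_simps)
    then show "s 0 * (of_nat n * ta_basis n S' (k + (2 * n - 1)) U m + (-1) * P U m)
     + (- s 0) * (\<Sum>i\<in>{1..<n}. s i * ta_basis n (insert (n - i - 1) S') (k + 2 * i) U m) = ta_basis n S k U m"
      unfolding s0 by simp
  qed
  finally show ?thesis .
qed

lemma reducible_TA:
  assumes "c \<in> TA n" shows "reducible c"
proof -
  let ?B = "Pow {..<n} \<times> {..n^2}"
  have "reducible (\<lambda>U m. \<Sum>x\<in>?B. c (fst x) (snd x) * ta_basis n (fst x) (snd x) U m)"
    by (rule reducible_sum) (auto intro: reducible_basis)
  also have "(\<lambda>U m. \<Sum>x\<in>?B. c (fst x) (snd x) * ta_basis n (fst x) (snd x) U m) = c"
  proof (intro ext)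
    fix U m
    show "(\<Sum>x\<in>?B. c (fst x) (snd x) * ta_basis n (fst x) (snd x) U m) = c U m"
    proof (cases "ta_ok n U m")
      case True
      then have "(U, m) \<in> ?B" by (auto simp: ta_ok_def tdeg_def)
      moreover have "(\<Sum>x\<in>?B. c (fst x) (snd x) * ta_basis n (fst x) (snd x) U m) = (\<Sum>x\<in>?B. if x = (U, m) then c U m else 0)"
        by (intro sum.cong refl) (use True in \<open>auto simp: ta_basis_def\<close>)
      ultimately show ?thesis by simp
    next
      case False
      then have "ta_basis n S k U m = (0 :: 'a)" for S k by (auto simp: ta_basis_def)
      then show ?thesis using False assms by (simp add: TA_def)
    qed
  qed
  finally show ?thesis .
qed

end

section \<open>The volume form\<close>

text \<open>Any enumeration of the \<open>n^2\<close> positions will do; another choice changes the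
  volume form at most by a sign.\<close>

definition slot_index :: "'n::finite \<times> 'n \<Rightarrow> nat" where
  "slot_index = (SOME h. bij_betw h UNIV {..<CARD('n)^2})"

lemma bij_slot_index: "bij_betw (slot_index :: 'n::finite \<times> 'n \<Rightarrow> nat) UNIV {..<CARD('n)^2}"
proof -
  have "\<exists>h :: 'n \<times> 'n \<Rightarrow> nat. bij_betw h UNIV {..<CARD('n)^2}"
    by (rule finite_same_card_bij) (simp_all add: power2_eq_square)
  then show ?thesis unfolding slot_index_def by (rule someI_ex)
qed

definition mvol :: "(nat \<Rightarrow> ('a::field)^'n::finite^'n) \<Rightarrow> 'a" where
  "mvol v = det (\<chi> (r :: 'n \<times> 'n) (s :: 'n \<times> 'n). v (slot_index r) $ fst s $ snd s)"

text \<open>Left multiplication by \<open>g\<close> in the basis of matrix units, acting on columns;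
  \<open>right_op\<close> is right multiplication, acting on rows.\<close>

definition left_op :: "('a::field)^'n::finite^'n \<Rightarrow> 'a^('n \<times> 'n)^('n \<times> 'n)" where
  "left_op g = (\<chi> s t. if snd s = snd t then g $ fst s $ fst t else 0)"

definition right_op :: "('a::field)^'n::finite^'n \<Rightarrow> 'a^('n \<times> 'n)^('n \<times> 'n)" where
  "right_op g = (\<chi> s t. if fst s = fst t then g $ snd s $ snd t else 0)"

lemma sum_UNIV_prod: "(\<Sum>t\<in>(UNIV :: ('n::finite \<times> 'n) set). h t) = (\<Sum>a\<in>UNIV. \<Sum>b\<in>UNIV. h (a, b))"
  by (simp add: sum.cartesian_product UNIV_Times_UNIV)

lemma left_op_mult: "left_op g ** left_op g' = left_op (g ** g')"
  unfolding vec_eq_iff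
proof (intro allI)
  fix s t :: "'b \<times> 'b"
  have "(left_op g ** left_op g') $ s $ t = (\<Sum>a\<in>UNIV. \<Sum>b\<in>UNIV. if b = snd s then (if snd s = snd t then g $ fst s $ a * g' $ a $ fst t else 0) else 0)"
    unfolding matrix_matrix_mult_def left_op_def vec_lambda_beta sum_UNIV_prod
    by (intro sum.cong refl) auto
  also have "\<dots> = left_op (g ** g') $ s $ t"
    by (simp add: left_op_def matrix_matrix_mult_def)
  finally show "(left_op g ** left_op g') $ s $ t = left_op (g ** g') $ s $ t" .
qed

lemma left_op_one: "left_op (mat 1) = mat 1"
  by (auto simp: vec_eq_iff left_op_def mat_def prod_eq_iff)

text \<open>Transposing matrices exchanges the two operators. This is why conjugation has determinant 1 on the space of
  matrices.\<close>

lemma det_right_op: "det (right_op g) = det (left_op (g :: ('a::field)^'n::finite^'n))"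
proof -
  let ?p = "prod.swap :: 'n \<times> 'n \<Rightarrow> 'n \<times> 'n"
  have p: "?p permutes UNIV" by (rule bij_imp_permutes) simp_all
  have "right_op g = (\<chi> i. (\<chi> i j. left_op g $ i $ ?p j) $ ?p i)"
    by (simp add: vec_eq_iff right_op_def left_op_def)
  also have "det \<dots> = of_int (sign ?p) * det (\<chi> i j. left_op g $ i $ ?p j)"
    by (rule det_permute_rows[OF p])
  also have "det (\<chi> i j. left_op g $ i $ ?p j) = of_int (sign ?p) * det (left_op g)"
    by (rule det_permute_columns[OF p])
  finally show ?thesis by simp
qed

lemma mvol_invariant:
  fixes g g' :: "('a::field)^'n::finite^'n"
  assumes g: "g ** g' = mat 1"
  shows "mvol (\<lambda>i. g ** v i ** g') = mvol v"
proof -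
  let ?V = "\<chi> (r :: 'n \<times> 'n) (s :: 'n \<times> 'n). v (slot_index r) $ fst s $ snd s"
  \<comment> \<open>The arguments are the rows of \<open>?V\<close>, so left multiplication acts on
    them through the transposed operator.\<close>
  have "(\<chi> (r :: 'n \<times> 'n) (s :: 'n \<times> 'n). (g ** v (slot_index r) ** g') $ fst s $ snd s)
      = ?V ** (Finite_Cartesian_Product.transpose (left_op g) ** right_op g')"
    unfolding vec_eq_iff
  proof (intro allI)
    fix r s :: "'n \<times> 'n"
    let ?v = "v (slot_index r)"
    have lr: "(Finite_Cartesian_Product.transpose (left_op g) ** right_op g') $ t $ s = g $ fst s $ fst t * g' $ snd t $ snd s" for t
    proof -
      have "(Finite_Cartesian_Product.transpose (left_op g) ** right_op g') $ t $ s
        = (\<Sum>a\<in>UNIV. \<Sum>b\<in>UNIV. if b = snd t then (if a = fst s then g $ fst s $ fst t * g' $ snd t $ snd s else 0) else 0)"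
        unfolding matrix_matrix_mult_def left_op_def right_op_def Finite_Cartesian_Product.transpose_def vec_lambda_beta sum_UNIV_prod
        by (intro sum.cong refl) auto
      then show ?thesis by simp
    qed
    have "(?V ** (Finite_Cartesian_Product.transpose (left_op g) ** right_op g')) $ r $ s
      = (\<Sum>t\<in>UNIV. ?v $ fst t $ snd t * (g $ fst s $ fst t * g' $ snd t $ snd s))"
      by (simp only: matrix_matrix_mult_def[of ?V] vec_lambda_beta lr)
    also have "\<dots> = (\<Sum>a\<in>UNIV. \<Sum>b\<in>UNIV. g $ fst s $ a * ?v $ a $ b * g' $ b $ snd s)"
      unfolding sum_UNIV_prod by (simp add: mult_ac)
    also have "\<dots> = (g ** ?v ** g') $ fst s $ snd s"
      unfolding matrix_matrix_mult_def vec_lambda_beta sum_distrib_right by (rule sum.swap)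
    finally show "(\<chi> r s. (g ** v (slot_index r) ** g') $ fst s $ snd s) $ r $ s
      = (?V ** (Finite_Cartesian_Product.transpose (left_op g) ** right_op g')) $ r $ s" by simp
  qed
  then have "mvol (\<lambda>i. g ** v i ** g') = mvol v * (det (left_op g) * det (right_op g'))"
    by (simp add: mvol_def det_mul)
  \<comment> \<open>By \<open>det_right_op\<close> the second factor is
    \<open>det (left_op g')\<close>, and the product is the determinant of the operator of
    \<open>g ** g'\<close>, the identity.\<close>
  also have "det (left_op g) * det (right_op g') = 1"
    unfolding det_right_op det_mul[symmetric] left_op_mult g left_op_one by simp
  finally show ?thesis by simp
qed

definition vol_form :: "('a::field,'n::finite) mform" where
  "vol_form = (\<lambda>k v. if k = CARD('n)^2 then mat (mvol v) else 0)"

lemma mvol_alternating: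
  assumes "i < j" "j < CARD('n)^2"
  shows "mvol (v \<circ> Transposition.transpose i j) = - mvol (v :: nat \<Rightarrow> ('a::field)^'n::finite^'n)"
proof -
  let ?s = "slot_index :: 'n \<times> 'n \<Rightarrow> nat"
  obtain a b where ab: "?s a = i" "?s b = j"
    using bij_slot_index[where 'n='n] assms unfolding bij_betw_def by (metis imageE lessThan_iff less_trans)
  have inj: "?s x = ?s y \<longleftrightarrow> x = y" for x y
    using bij_slot_index[where 'n='n] unfolding bij_betw_def by (meson UNIV_I inj_on_eq_iff)
  let ?p = "Transposition.transpose a b"
  have "Transposition.transpose i j (?s r) = ?s (?p r)" for r
    unfolding Transposition.transpose_def using ab inj[of r a] inj[of r b] by simp
  then have "mvol (v \<circ> Transposition.transpose i j) = det (\<chi> r. (\<chi> r s. v (?s r) $ fst s $ snd s) $ ?p r)"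
    by (simp add: mvol_def)
  also have "\<dots> = of_int (sign ?p) * mvol v"
    unfolding mvol_def by (rule det_permute_rows) (rule permutes_swap_id, auto)
  also have "sign ?p = -1" using ab assms by (auto simp: sign_swap_id)
  finally show ?thesis by (simp only: of_int_minus of_int_1 mult_minus1)
qed

lemma mvol_mlin: "mlin (CARD('n)^2) (mvol :: (nat \<Rightarrow> ('a::field)^'n::finite^'n) \<Rightarrow> 'a)"
  unfolding mlin_def
proof (intro allI impI)
  fix i c and v :: "nat \<Rightarrow> 'a^'n^'n" and x y :: "'a^'n^'n" assume "i < CARD('n)^2"
  let ?s = "slot_index :: 'n \<times> 'n \<Rightarrow> nat"
  obtain a where a: "?s a = i"
    using bij_slot_index[where 'n='n] \<open>i < CARD('n)^2\<close> unfolding bij_betw_def by (metis imageE lessThan_iff)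
  have inj: "?s x = ?s y \<longleftrightarrow> x = y" for x y
    using bij_slot_index[where 'n='n] unfolding bij_betw_def by (meson UNIV_I inj_on_eq_iff)
  let ?row = "\<lambda>z. \<chi> s :: 'n \<times> 'n. (z :: 'a^'n^'n) $ fst s $ snd s"
  have vol: "mvol (v(i := z)) = det (\<chi> r. if r = a then ?row z else ?row (v (?s r)))" for z
  proof -
    have "(v(i := z)) (?s r) = (if r = a then z else v (?s r))" for r
      using a inj[of r a] by simp
    then show ?thesis unfolding mvol_def
      by (intro arg_cong[where f = det]) (simp add: vec_eq_iff)
  qed
  have row: "?row (mat c ** x + y) = c *s ?row x + ?row y"
    by (simp add: vec_eq_iff)
  show "mvol (v(i := mat c ** x + y)) = c * mvol (v(i := x)) + mvol (v(i := y))"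
    unfolding vol row det_row_add[of a "\<lambda>_. c *s ?row x" "\<lambda>_. ?row y" "\<lambda>r. ?row (v (?s r))"]
      det_row_mul[of a c "\<lambda>_. ?row x" "\<lambda>r. ?row (v (?s r))"] ..
qed

lemma vol_form_A_alg: "(vol_form :: ('a::field_char_0,'n::finite) mform) \<in> A_alg"
proof -
  have bnd: "slot_index r < CARD('n)^2" for r :: "'n \<times> 'n"
    using bij_slot_index[where 'n='n] unfolding bij_betw_def by blast
  have "kform k (vol_form k :: (nat \<Rightarrow> 'a^'n^'n) \<Rightarrow> _)" for k
  proof (cases "k = CARD('n)^2")
    case False
    then show ?thesis by (simp add: kform_def vol_form_def)
  next
    case True
    have v: "(vol_form k :: (nat \<Rightarrow> 'a^'n^'n) \<Rightarrow> _) = (\<lambda>v. mat (mvol v))" using True by (simp add: vol_form_def)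
    have m: "mvol (v(i := mat c ** x + y)) = c * mvol (v(i := x)) + mvol (v(i := y))" if "i < k"
      for i c x y and v :: "nat \<Rightarrow> 'a^'n^'n"
      using mvol_mlin[where 'a='a and 'n='n] that True unfolding mlin_def by blast
    have mm: "mat (c * s + t) = mat c ** mat s + (mat t :: 'a^'n^'n)" for c s t
      by (simp add: mat_mult_mat) (simp add: vec_eq_iff mat_def)
    have mn: "mat (- s) = - (mat s :: 'a^'n^'n)" for s by (simp add: vec_eq_iff mat_def)
    show ?thesis unfolding v kform_def
    proof (intro conjI allI impI)
      fix w w' :: "nat \<Rightarrow> 'a^'n^'n" assume "\<forall>i<k. w i = w' i"
      then have "mvol w = mvol w'" using bnd True by (simp add: mvol_def)
      then show "mat (mvol w) = (mat (mvol w') :: 'a^'n^'n)" by simp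
    next
      fix i c and w :: "nat \<Rightarrow> 'a^'n^'n" and x y assume "i < k"
      then show "mat (mvol (w(i := mat c ** x + y))) = mat c ** mat (mvol (w(i := x))) + (mat (mvol (w(i := y))) :: 'a^'n^'n)"
        by (simp only: m mm)
    next
      fix i j and w :: "nat \<Rightarrow> 'a^'n^'n" assume "i < j \<and> j < k"
      then show "mat (mvol (w \<circ> Transposition.transpose i j)) = - (mat (mvol w) :: 'a^'n^'n)"
        using mvol_alternating[of i j w] True mn by simp
    qed
  qed
  moreover have "g ** mat c ** g' = mat c" if "g ** g' = mat 1" for g g' :: "'a^'n^'n" and c
    by (simp only: mat_commute[of g c] matrix_mul_assoc[symmetric] that matrix_mul_rid)
  ultimately show ?thesis
    unfolding A_alg_def forms_def invariant_def
    by (auto simp: mvol_invariant vol_form_def)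
qed

lemma vol_form_nonzero: "\<exists>v. (vol_form :: ('a::field,'n::finite) mform) (CARD('n)^2) v \<noteq> 0"
proof -
  let ?s = "slot_index :: 'n \<times> 'n \<Rightarrow> nat"
  \<comment> \<open>The matrix units, in the order of \<open>slot_index\<close>, make the
    determinant that of the identity.\<close>
  define v where "v i = (munit (inv_into UNIV ?s i) :: 'a^'n^'n)" for i
  have "inv_into UNIV ?s (?s r) = r" for r
    using bij_slot_index[where 'n='n] unfolding bij_betw_def by (simp add: inv_into_f_f)
  then have "(\<chi> (r :: 'n \<times> 'n) (s :: 'n \<times> 'n). v (?s r) $ fst s $ snd s) = mat 1"
    by (auto simp: v_def vec_eq_iff munit_def mat_def prod_eq_iff)
  then have "mvol v = 1" by (simp add: mvol_def)
  then have "vol_form (CARD('n)^2) v = (mat 1 :: 'a^'n^'n)" by (simp add: vol_form_def)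
  moreover have "(mat 1 :: 'a^'n^'n) \<noteq> 0" by (auto simp: vec_eq_iff mat_def)
  ultimately show ?thesis by metis
qed

section \<open>The main theorem\<close>

lemma Tprod_singleton: "Tprod {h} = (Tf h :: ('a::field_char_0,'n::finite) mform)"
proof -
  have "Tprod {h} = (Tf h \<and>\<^sub>w Tprod {} :: ('a,'n) mform)" by (rule Tprod_insert_min) auto
  then show ?thesis by (simp add: Tprod_empty wedge_fone_right[OF hom_form_Tf])
qed

lemma TX_empty: "TX {} k = (fpow Xf k :: ('a::field_char_0,'n::finite) mform)"
  by (simp add: TX_def Tprod_empty wedge_fone_left[OF hom_form_pow])

lemma TX_high_power: "k \<ge> 2 * CARD('n) \<Longrightarrow> TX S k = (0 :: ('a::field_char_0,'n::finite) mform)"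
  by (simp add: TX_def fpow_Xf_zero)

lemma card_pos: "CARD('n::finite) \<ge> 1"
  by (simp add: Suc_leI)

lemma kform_local: "kform k f \<Longrightarrow> (\<And>i. i < k \<Longrightarrow> v i = v' i) \<Longrightarrow> f v = f v'"
  unfolding kform_def by simp

lemma kform_linear: "kform k f \<Longrightarrow> i < k \<Longrightarrow> f (v(i := mat c ** x + y)) = mat c ** f (v(i := x)) + f (v(i := y))"
  unfolding kform_def by simp

lemma kform_swap: "kform k f \<Longrightarrow> i < j \<Longrightarrow> j < k \<Longrightarrow> f (v \<circ> Transposition.transpose i j) = - f v"
  unfolding kform_def by simp

lemma A_alg_subspace: "mf.subspace (A_alg :: ('a::field_char_0,'n::finite) mform set)"
proof -
  have z: "kform k (\<lambda>v. 0 :: 'a^'n^'n)" for k by (simp add: kform_def)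
  have a: "kform k (\<lambda>v. f v + g v)" if "kform k f" "kform k g" for k and f g :: "(nat \<Rightarrow> 'a^'n^'n) \<Rightarrow> 'a^'n^'n"
    unfolding kform_def
  proof (intro conjI allI impI)
    fix v v' :: "nat \<Rightarrow> 'a^'n^'n" assume v: "\<forall>i<k. v i = v' i"
    have "f v = f v'" "g v = g v'" using that[THEN kform_local] v by blast+
    then show "f v + g v = f v' + g v'" by simp
  next
    fix i v x y c assume i: "i < k"
    have "f (v(i := mat c ** x + y)) = mat c ** f (v(i := x)) + f (v(i := y))"
      "g (v(i := mat c ** x + y)) = mat c ** g (v(i := x)) + g (v(i := y))"
      using that[THEN kform_linear, OF i] by blast+
    then show "f (v(i := mat c ** x + y)) + g (v(i := mat c ** x + y))
      = mat c ** (f (v(i := x)) + g (v(i := x))) + (f (v(i := y)) + g (v(i := y)))"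
      by (simp add: matrix_add_ldistrib)
  next
    fix i j v assume ij: "i < j \<and> j < k"
    have "f (v \<circ> Transposition.transpose i j) = - f v" "g (v \<circ> Transposition.transpose i j) = - g v"
      using that[THEN kform_swap] ij by blast+
    then show "f (v \<circ> Transposition.transpose i j) + g (v \<circ> Transposition.transpose i j) = - (f v + g v)" by simp
  qed
  have s: "kform k (\<lambda>v. mat t ** f v)" if "kform k f" for k t and f :: "(nat \<Rightarrow> 'a^'n^'n) \<Rightarrow> 'a^'n^'n"
    unfolding kform_def
  proof (intro conjI allI impI)
    fix v v' :: "nat \<Rightarrow> 'a^'n^'n" assume v: "\<forall>i<k. v i = v' i"
    have "f v = f v'" using that[THEN kform_local] v by blast
    then show "mat t ** f v = mat t ** f v'" by simp
  next
    fix i v x y c assume i: "i < k"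
    have "f (v(i := mat c ** x + y)) = mat c ** f (v(i := x)) + f (v(i := y))"
      using that[THEN kform_linear, OF i] by blast
    then show "mat t ** f (v(i := mat c ** x + y)) = mat c ** (mat t ** f (v(i := x))) + mat t ** f (v(i := y))"
      by (simp add: matrix_add_ldistrib matrix_mul_assoc mat_mult_mat mult.commute)
  next
    fix i j v assume ij: "i < j \<and> j < k"
    have "f (v \<circ> Transposition.transpose i j) = - f v"
      using that[THEN kform_swap] ij by blast
    then show "mat t ** f (v \<circ> Transposition.transpose i j) = - (mat t ** f v)" by (simp add: vec_eq_iff)
  qed
  have m: "g ** (mat t ** M) ** g' = mat t ** (g ** M ** g')" for g g' M :: "'a^'n^'n" and t
    by (simp only: matrix_mul_assoc mat_commute[of g t])
  show ?thesis
    unfolding mf.subspace_def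
  proof (intro conjI ballI allI)
    show "(0 :: ('a,'n) mform) \<in> A_alg"
      by (simp add: A_alg_def forms_def invariant_def fun_apply z zero_fun_def)
  next
    fix f g :: "('a,'n) mform" assume fg: "f \<in> A_alg" "g \<in> A_alg"
    then show "f + g \<in> A_alg"
      unfolding A_alg_def forms_def invariant_def
      by (simp add: plus_fun_def a matrix_add_ldistrib matrix_add_rdistr)
  next
    fix t and f :: "('a,'n) mform" assume "f \<in> A_alg"
    then show "fscale t f \<in> A_alg"
      unfolding A_alg_def forms_def invariant_def fscale_def
      by (simp add: s m)
  qed
qed

lemma canon_in_A_alg: "(canon c :: ('a::field_char_0,'n::finite) mform) \<in> A_alg"
  unfolding canon_eq
proof (intro mf.subspace_sum mf.subspace_scale A_alg_subspace)
  fix x assume "x \<in> Pow {..<CARD('n)} \<times> {..CARD('n)^2}"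
  then have "finite (fst x)" using finite_subset[of "fst x" "{..<CARD('n)}"] by auto
  then show "(TX (fst x) (snd x) :: ('a,'n) mform) \<in> A_alg" by (rule inv_form_A_alg[OF inv_form_TX])
qed

lemma sum_odd_numbers: "(\<Sum>h<m. 2 * h + 1) = (m :: nat)^2"
  by (induction m) (auto simp: power2_eq_square)

text \<open>The odd numbers \<open>2h + 1\<close> with \<open>h < n - 1\<close> add up to
  \<open>(n - 1)^2\<close>, which falls short of \<open>n^2\<close> by the largest exponent
  \<open>2n - 1\<close>. Equality therefore leaves no index out and forces that exponent.\<close>

lemma tdeg_bound:
  assumes "n \<ge> 1" "S \<subseteq> {..<n - 1}" "k < 2 * n"
  shows "tdeg S k \<le> n^2" "tdeg S k = n^2 \<Longrightarrow> S = {..<n - 1} \<and> k = 2 * n - 1"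
proof -
  have n2: "n^2 = (n - 1)^2 + (2 * n - 1)"
    using assms(1) by (cases n) (auto simp: power2_eq_square)
  have split: "(n - 1)^2 = (\<Sum>h\<in>S. 2 * h + 1) + (\<Sum>h\<in>{..<n - 1} - S. 2 * h + 1)"
    unfolding sum_odd_numbers[symmetric] using sum.subset_diff[OF assms(2), of "\<lambda>h. 2 * h + 1"] by simp
  then show "tdeg S k \<le> n^2" using n2 assms(3) unfolding tdeg_def by linarith
  assume "tdeg S k = n^2"
  then have "(\<Sum>h\<in>{..<n - 1} - S. 2 * h + 1) = 0" "k = 2 * n - 1"
    using n2 assms(3) split unfolding tdeg_def by linarith+
  then show "S = {..<n - 1} \<and> k = 2 * n - 1" using assms(2) by auto
qed

lemma canon_J_zero:
  assumes "c \<in> ta_ideal CARD('n) {ta_pow CARD('n) (ta_X CARD('n)) (2 * CARD('n)), ta_O CARD('n)}"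
  shows "canon c = (0 :: ('a::field_char_0,'n::finite) mform)"
  using assms
proof (induction rule: ta_ideal.induct)
  case zero
  show ?case by (rule canon_zero)
next
  case (base b)
  let ?n = "CARD('n)"
  interpret ta_relations ?n "TYPE('a)" by unfold_locales (rule card_pos)
  have 1: "canon (ta_pow ?n (ta_X ?n) (2 * ?n)) = (0 :: ('a,'n) mform)"
    unfolding ta_pow_X[OF card_pos] by (simp add: canon_basis TX_high_power)
  have "ta_O ?n = (\<lambda>U m. of_nat ?n * ta_basis ?n {} (2 * ?n - 1) U m + (-1) * (\<Sum>i<?n. ta_basis ?n {?n - i - 1} (2 * i) U m) :: 'a)"
    unfolding ta_O_eq by simp
  then have "canon (ta_O ?n) = (fscale (of_nat ?n) (canon (ta_basis ?n {} (2 * ?n - 1)))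
      + fscale (-1) (\<Sum>i<?n. canon (ta_basis ?n {?n - i - 1} (2 * i))) :: ('a,'n) mform)"
    by (simp only: canon_add canon_scale canon_sum)
  also have "canon (ta_basis ?n {} (2 * ?n - 1)) = (fpow Xf (2 * ?n - 1) :: ('a,'n) mform)"
    by (simp add: canon_basis TX_empty)
  also have "(\<Sum>i<?n. canon (ta_basis ?n {?n - i - 1} (2 * i))) = (\<Sum>i<?n. fpow Xf (2 * i) \<and>\<^sub>w Tf (?n - i - 1) :: ('a,'n) mform)"
  proof (rule sum.cong[OF refl])
    fix i assume "i \<in> {..<?n}"
    have "canon (ta_basis ?n {?n - i - 1} (2 * i)) = (TX {?n - i - 1} (2 * i) :: ('a,'n) mform)"
      by (rule canon_basis) auto
    then show "canon (ta_basis ?n {?n - i - 1} (2 * i)) = (fpow Xf (2 * i) \<and>\<^sub>w Tf (?n - i - 1) :: ('a,'n) mform)"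
      by (simp add: TX_def Tprod_singleton pow_wedge_Tf)
  qed
  finally have 2: "canon (ta_O ?n) = (0 :: ('a,'n) mform)"
    unfolding trace_form_relation by simp
  show ?case using base 1 2 by auto
next
  case (add a b)
  then show ?case by (simp add: canon_add)
next
  case (lmult a c)
  then show ?case by (simp add: canon_mult)
next
  case (rmult a c)
  then show ?case by (simp add: canon_mult)
qed

lemma TXspan_canon:
  assumes "f \<in> (TXspan :: ('a::field_char_0,'n::finite) mform set)"
  shows "\<exists>c\<in>TA CARD('n). f = canon c"
  using assms unfolding TXspan_def
proof (induction rule: mf.span_induct_alt)
  case base
  show ?case by (intro bexI[of _ "\<lambda>U m. 0"]) (simp_all add: canon_zero TA_def)
next
  case (step t x y)
  then obtain S j c where x: "x = TX S j" "S \<subseteq> {..<CARD('n)}" and c: "c \<in> TA CARD('n)" "y = canon c" by auto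
  let ?c = "\<lambda>U m. t * ta_basis CARD('n) S j U m + c U m"
  have "fscale t x + y = canon ?c"
    unfolding canon_add canon_scale canon_basis[OF x(2)] x(1) c(2) ..
  moreover have "?c \<in> TA CARD('n)" using c(1) by (simp add: TA_def ta_basis_def)
  ultimately show ?case by blast
qed

lemma A_alg_canon_reduced:
  assumes "f \<in> (A_alg :: ('a::field_char_0,'n::finite) mform set)"
  shows "\<exists>r\<in>ta_relations.R CARD('n). f = canon r"
proof -
  interpret ta_relations "CARD('n)" "TYPE('a)" by unfold_locales (rule card_pos)
  obtain c where c: "c \<in> TA CARD('n)" "f = canon c"
    using TXspan_canon A_alg_subset_TXspan assms by blast
  obtain r where r: "r \<in> R" "(\<lambda>U m. c U m - r U m) \<in> J"
    using reducible_TA[OF c(1)] unfolding reducible_def by blast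
  have "canon (\<lambda>U m. (c U m - r U m) + r U m) = (canon (\<lambda>U m. c U m - r U m) + canon r :: ('a,'n) mform)"
    by (rule canon_add)
  then have "f = canon r" using c(2) canon_J_zero[OF r(2)[unfolded J_def]] by simp
  then show ?thesis using r(1) by blast
qed

lemma top_form_nonzero:
  "TX {..<CARD('n) - 1} (2 * CARD('n) - 1) \<noteq> (0 :: ('a::field_char_0,'n::finite) mform)"
proof
  let ?n = "CARD('n)"
  interpret ta_relations ?n "TYPE('a)" by unfold_locales (rule card_pos)
  assume top: "TX {..<?n - 1} (2 * ?n - 1) = (0 :: ('a,'n) mform)"
  obtain r where r: "r \<in> R" "vol_form = (canon r :: ('a,'n) mform)"
    using A_alg_canon_reduced[OF vol_form_A_alg] by blast
  have "vol_form (?n^2) v = (0 :: 'a^'n^'n)" for v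
  proof -
    have "fscale (r (fst x) (snd x)) (TX (fst x) (snd x)) (?n^2) v = (0 :: 'a^'n^'n)"
      if x: "x \<in> Pow {..<?n} \<times> {..?n^2}" for x
    proof (cases "r (fst x) (snd x) = 0")
      case True
      then show ?thesis by (simp add: fscale_def vec_eq_iff)
    next
      case False
      then have S: "fst x \<subseteq> {..<?n - 1}" "snd x < 2 * ?n" using r(1) unfolding R_def by blast+
      have fin: "finite (fst x)" using S finite_subset by blast
      show ?thesis
      proof (cases "tdeg (fst x) (snd x) = ?n^2")
        case True
        then have "fst x = {..<?n - 1}" "snd x = 2 * ?n - 1"
          using tdeg_bound(2)[OF card_pos S] by auto
        then show ?thesis using top by (simp add: fscale_def fun_apply)
      next
        case False
        then have "TX (fst x) (snd x) (?n^2) = (\<lambda>v. 0 :: 'a^'n^'n)" by (intro TX_nondeg[OF fin]) auto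
        then show ?thesis by (simp add: fscale_def)
      qed
    qed
    then show ?thesis unfolding r(2) canon_eq sum_fun_apply by (rule sum.neutral[OF ballI])
  qed
  then show False using vol_form_nonzero[where 'a='a and 'n='n] by blast
qed

text \<open>The exponent \<open>k0\<close> is minimal among the nonzero coefficients, and
  \<open>S0\<close> has minimal size for it. The relation is multiplied by the product complementary
  to \<open>(S0, k0)\<close>. A term with an index outside \<open>S0\<close> acquires a repeated
  factor, and one with \<open>k > k0\<close> a power of X of exponent at least \<open>2n\<close>. A
  term with \<open>k = k0\<close> and index set inside \<open>S0\<close> is that of
  \<open>(S0, k0)\<close> itself.\<close>

lemma canon_reduced_injective:
  assumes r: "r \<in> ta_relations.R CARD('n)" and zero: "canon r = (0 :: ('a::field_char_0,'n::finite) mform)"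
  shows "r = (\<lambda>U m. 0)"
proof (rule ccontr)
  let ?n = "CARD('n)" and ?B = "Pow {..<CARD('n)} \<times> {..CARD('n)^2}"
  interpret ta_relations ?n "TYPE('a)" by unfold_locales (rule card_pos)
  assume "r \<noteq> (\<lambda>U m. 0)"
  then have ex: "\<exists>k S. r S k \<noteq> 0" by (auto simp: fun_eq_iff)
  define k0 where "k0 = (LEAST k. \<exists>S. r S k \<noteq> 0)"
  have k0: "\<exists>S. r S k0 \<noteq> 0" unfolding k0_def by (rule LeastI_ex[OF ex])
  have k0_min: "k0 \<le> k" if "r S k \<noteq> 0" for S k
    unfolding k0_def by (rule Least_le) (use that in blast)
  obtain S0 where S0: "r S0 k0 \<noteq> 0" "\<And>S. r S k0 \<noteq> 0 \<Longrightarrow> card S0 \<le> card S"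
    using k0 ex_has_least_nat[of "\<lambda>S. r S k0 \<noteq> 0" _ card] by blast
  have Rr: "S \<subseteq> {..<?n - 1}" "k < 2 * ?n" if "r S k \<noteq> 0" for S k
    using r that unfolding R_def by blast+
  let ?R = "{..<?n - 1} - S0" and ?l = "2 * ?n - 1 - k0"
  let ?g = "\<lambda>x. fscale (r (fst x) (snd x)) (TX (fst x) (snd x) \<and>\<^sub>w TX ?R ?l) :: ('a,'n) mform"
  have fin0: "finite S0" using Rr(1)[OF S0(1)] finite_subset by blast
  have in_B: "(S0, k0) \<in> ?B"
  proof -
    have "tdeg S0 k0 \<le> ?n^2" using tdeg_bound(1)[OF card_pos Rr[OF S0(1)]] .
    then show ?thesis using Rr(1)[OF S0(1)] by (auto simp: tdeg_def)
  qed
  have others: "?g x = 0" if x: "x \<in> ?B - {(S0, k0)}" for x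
  proof -
    obtain S k where xS: "x = (S, k)" by (cases x)
    have fin: "finite S" using x xS finite_subset by auto
    show ?thesis
    proof (cases "r S k = 0 \<or> S \<inter> ?R \<noteq> {}")
      case True
      then show ?thesis using xS fin by (auto simp: TX_wedge_TX)
    next
      case False
      then have rS: "r S k \<noteq> 0" and "S \<inter> ?R = {}" by auto
      then have sub: "S \<subseteq> S0" using Rr(1)[OF rS] by auto
      have "k \<noteq> k0"
      proof
        assume "k = k0"
        then have "card S0 \<le> card S" using S0(2) rS by blast
        then have "S = S0" using sub fin0 by (metis card_seteq)
        then show False using x xS \<open>k = k0\<close> by simp
      qed
      then have "k0 < k" using k0_min[OF rS] by simp
      then have "k + ?l \<ge> 2 * ?n" using Rr(2)[OF S0(1)] by linarith
      then have "TX (S \<union> ?R) (k + ?l) = (0 :: ('a,'n) mform)" by (rule TX_high_power)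
      then show ?thesis using xS fin by (simp add: TX_wedge_TX)
    qed
  qed
  have "(0 :: ('a,'n) mform) = canon r \<and>\<^sub>w TX ?R ?l" using zero by simp
  also have "\<dots> = (\<Sum>x\<in>?B. ?g x)" unfolding canon_eq wedge_sum_left wedge_scale_left ..
  also have "\<dots> = ?g (S0, k0) + (\<Sum>x\<in>?B - {(S0, k0)}. ?g x)"
    by (rule sum.remove) (use in_B in auto)
  also have "(\<Sum>x\<in>?B - {(S0, k0)}. ?g x) = 0" by (rule sum.neutral[OF ballI]) (rule others)
  also have "?g (S0, k0) = fscale (r S0 k0 * of_int (tsign S0 ?R k0)) (TX {..<?n - 1} (2 * ?n - 1))"
  proof -
    have "S0 \<union> ?R = {..<?n - 1}" "k0 + ?l = 2 * ?n - 1" "S0 \<inter> ?R = {}"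
      using Rr[OF S0(1)] by auto
    then show ?thesis using TX_wedge_TX[OF fin0, of ?R k0 ?l, where 'a='a and 'n='n] by simp
  qed
  finally have "r S0 k0 * of_int (tsign S0 ?R k0) = 0"
    using top_form_nonzero[where 'a='a and 'n='n] by simp
  then show False using S0(1) by (simp add: tsign_def)
qed

section \<open>Coefficients in the exterior subalgebra\<close>

definition at_comb :: "(nat set \<Rightarrow> 'a) \<Rightarrow> ('a::field_char_0,'n::finite) mform" where
  "at_comb a = (\<Sum>S\<in>Pow {..<CARD('n) - 1}. fscale (a S) (Tprod S))"

lemma at_comb_single: "S \<subseteq> {..<CARD('n) - 1} \<Longrightarrow> at_comb (\<lambda>U. if U = S then 1 else 0) = (Tprod S :: ('a::field_char_0,'n::finite) mform)"
proof -
  assume S: "S \<subseteq> {..<CARD('n) - 1}"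
  have "at_comb (\<lambda>U. if U = S then 1 else 0) = (\<Sum>U\<in>Pow {..<CARD('n) - 1}. if U = S then Tprod S else (0 :: ('a,'n) mform))"
    unfolding at_comb_def by (intro sum.cong refl) auto
  then show ?thesis using S by simp
qed

text \<open>Products of the forms \<open>Tprod S\<close> are again of this kind up to sign, or zero.
  Their span is thus closed under multiplication and contains everything that is generated.\<close>

lemma AT_sub_eq: "AT_sub = range (at_comb :: _ \<Rightarrow> ('a::field_char_0,'n::finite) mform)"
proof (intro equalityI subsetI)
  let ?G = "{Tprod S | S. S \<subseteq> {..<CARD('n) - 1}} :: ('a,'n) mform set"
  have mult1: "Tprod S \<and>\<^sub>w y \<in> mf.span ?G" if S: "S \<subseteq> {..<CARD('n) - 1}" and y: "y \<in> mf.span ?G" for S y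
    using y
  proof (induction rule: mf.span_induct_alt)
    case base
    then show ?case by (simp add: mf.span_zero)
  next
    case (step c x y)
    then obtain U where U: "x = Tprod U" "U \<subseteq> {..<CARD('n) - 1}" by auto
    have fin: "finite S" "finite U" using S U finite_subset by blast+
    have "Tprod (S \<union> U) \<in> ?G" using S U by blast
    then have "Tprod S \<and>\<^sub>w x \<in> mf.span ?G"
      unfolding U(1) Tprod_wedge_Tprod[OF fin]
      by (cases "S \<inter> U = {}") (simp_all only: if_False if_True simp_thms mf.span_zero mf.span_scale mf.span_base)
    then show ?case using step by (simp only: wedge_add_right wedge_scale_right mf.span_add mf.span_scale)
  qed
  have mult2: "x \<and>\<^sub>w y \<in> mf.span ?G" if x: "x \<in> mf.span ?G" and y: "y \<in> mf.span ?G" for x y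
    using x
  proof (induction rule: mf.span_induct_alt)
    case base
    then show ?case by (simp add: mf.span_zero)
  next
    case (step c u w)
    then have "u \<and>\<^sub>w y \<in> mf.span ?G" using mult1[OF _ y] by auto
    then show ?case using step by (simp only: wedge_add_left wedge_scale_left mf.span_add mf.span_scale)
  qed
  fix f :: "('a,'n) mform" assume "f \<in> AT_sub"
  then have "f \<in> mf.span ?G"
  proof (induction rule: AT_sub.induct)
    case one
    have "Tprod {} \<in> ?G" by blast
    then show ?case by (simp only: Tprod_empty[symmetric] mf.span_base)
  next
    case (gen h)
    then have "{h} \<subseteq> {..<CARD('n) - 1}" by auto
    then have "Tprod {h} \<in> ?G" by blast
    then show ?case by (simp only: Tprod_singleton[symmetric] mf.span_base)
  next
    case (add f g)
    then show ?case by (simp only: fadd_eq mf.span_add)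
  next
    case (scale f c)
    then show ?case by (simp only: mf.span_scale)
  next
    case (mult f g)
    then show ?case by (intro mult2)
  qed
  then show "f \<in> range at_comb"
  proof (induction rule: mf.span_induct_alt)
    case base
    show ?case by (rule range_eqI[of _ _ "\<lambda>_. 0"]) (simp add: at_comb_def)
  next
    case (step c x y)
    then obtain U a where U: "x = Tprod U" "U \<subseteq> {..<CARD('n) - 1}" and a: "y = at_comb a" by auto
    have "fscale c x + y = at_comb (\<lambda>S. c * (if S = U then 1 else 0) + a S)"
      unfolding U(1) a at_comb_single[OF U(2), symmetric] at_comb_def
      by (simp only: mf.scale_sum_right mf.scale_scale mf.scale_left_distrib sum.distrib)
    then show ?case by (simp only: rangeI)
  qed
next
  fix f :: "('a,'n) mform" assume "f \<in> range at_comb"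
  then obtain a where f: "f = at_comb a" by auto
  have T: "Tprod S \<in> (AT_sub :: ('a,'n) mform set)" if S: "S \<subseteq> {..<CARD('n) - 1}" for S
  proof -
    have "finite S" using S finite_subset by blast
    then show ?thesis using S
    proof (induction S rule: finite_linorder_min_induct)
      case empty
      then show ?case by (simp add: Tprod_empty AT_sub.one)
    next
      case (insert b A)
      then have "Tprod (insert b A) = (Tf b \<and>\<^sub>w Tprod A :: ('a,'n) mform)" by (intro Tprod_insert_min) auto
      moreover have "Tf b \<in> (AT_sub :: ('a,'n) mform set)" using insert by (intro AT_sub.gen) auto
      ultimately show ?case using insert by (simp add: AT_sub.mult)
    qed
  qed
  have zero: "0 \<in> (AT_sub :: ('a,'n) mform set)"
  proof -
    have "fscale 0 fone \<in> (AT_sub :: ('a,'n) mform set)" by (rule AT_sub.scale[OF AT_sub.one])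
    then show ?thesis by simp
  qed
  have "(\<Sum>S\<in>P. fscale (a S) (Tprod S)) \<in> (AT_sub :: ('a,'n) mform set)" if "finite P" "P \<subseteq> Pow {..<CARD('n) - 1}" for P
    using that
  proof (induction P rule: finite_induct)
    case empty
    then show ?case using zero by simp
  next
    case (insert S P)
    then have "fadd (fscale (a S) (Tprod S)) (\<Sum>S\<in>P. fscale (a S) (Tprod S)) \<in> (AT_sub :: ('a,'n) mform set)"
      using T by (intro AT_sub.add AT_sub.scale) auto
    then show ?case using insert by (simp add: fadd_eq)
  qed
  then show "f \<in> AT_sub" unfolding f at_comb_def by simp
qed

text \<open>Turns coefficients with respect to the powers of X into formal coefficients. The cut-off
  makes the result reduced for every \<open>a\<close>.\<close>

definition coef :: "nat \<Rightarrow> (nat \<Rightarrow> nat set \<Rightarrow> 'a::field_char_0) \<Rightarrow> 'a ta" where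
  "coef n a = (\<lambda>S j. if S \<subseteq> {..<n - 1} \<and> j < 2 * n then a j S else 0)"

lemma coef_reduced:
  assumes "n \<ge> 1" shows "coef n a \<in> ta_relations.R n"
proof -
  interpret ta_relations n "TYPE('a)" by unfold_locales (rule assms)
  have "ta_ok n S k" if "S \<subseteq> {..<n - 1}" "k < 2 * n" for S k
    using tdeg_bound(1)[OF assms that] that(1) by (auto simp: ta_ok_def)
  then show ?thesis unfolding R_def TA_def coef_def by auto
qed

lemma canon_coef:
  "(\<Sum>j<2 * CARD('n). at_comb (a j) \<and>\<^sub>w fpow Xf j) = (canon (coef CARD('n) a) :: ('a::field_char_0,'n::finite) mform)"
proof -
  let ?n = "CARD('n)"
  let ?C = "Pow {..<?n - 1} \<times> {..<2 * ?n}"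
  \<comment> \<open>\<open>canon\<close> runs over exponents up to \<open>n^2\<close>; the
    inequality ensures that all powers below \<open>2n\<close> are among them.\<close>
  have "2 * ?n \<le> ?n^2 + 1"
    using tdeg_bound(1)[OF card_pos[where 'n='n], of "{}" "2 * ?n - 1"] card_pos[where 'n='n] by (simp add: tdeg_def)
  then have sub: "?C \<subseteq> Pow {..<?n} \<times> {..?n^2}" by auto
  have "canon (coef ?n a) = (\<Sum>x\<in>?C. fscale (coef ?n a (fst x) (snd x)) (TX (fst x) (snd x)) :: ('a,'n) mform)"
    unfolding canon_eq
    by (rule sum.mono_neutral_right[OF _ sub]) (auto simp: coef_def)
  also have "\<dots> = (\<Sum>x\<in>?C. fscale (a (snd x) (fst x)) (TX (fst x) (snd x)))"
    by (rule sum.cong[OF refl]) (auto simp: coef_def)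
  also have "\<dots> = (\<Sum>S\<in>Pow {..<?n - 1}. \<Sum>j<2 * ?n. fscale (a j S) (TX S j))"
    by (simp only: sum.cartesian_product case_prod_unfold)
  also have "\<dots> = (\<Sum>j<2 * ?n. \<Sum>S\<in>Pow {..<?n - 1}. fscale (a j S) (TX S j))"
    by (rule sum.swap)
  also have "\<dots> = (\<Sum>j<2 * ?n. at_comb (a j) \<and>\<^sub>w fpow Xf j)"
    unfolding at_comb_def wedge_sum_left wedge_scale_left TX_def ..
  finally show ?thesis by simp
qed

lemma foldr_fadd: "foldr fadd (map g [0..<m]) fzero = (\<Sum>j<m. g j :: ('a::field,'n::finite) mform)"
proof -
  have "foldr fadd (map g [0..<m]) z = (\<Sum>j<m. g j) + z" for z
    by (induction m arbitrary: z) (simp_all add: fadd_eq add.assoc)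
  then show ?thesis by (simp add: fzero_eq)
qed

text \<open>Freeness with the given basis is expressed as bijectivity of the evaluation on families
  of coefficients; such a family is set to zero from \<open>2n\<close> on, so that equal
  coefficients mean equal functions. The kernel is taken inside \<open>TA\<close>, as coefficient
  functions outside it do not represent formal elements.\<close>

theorem mainTheorem8:
  fixes dummy :: "'a::field_char_0 itself" and dummyn :: "'n::finite itself"
  shows "bij_betw (\<lambda>c. foldr fadd (map (\<lambda>j. c j \<and>\<^sub>w fpow Xf j) [0..<2 * CARD('n)]) fzero)
            {c :: nat \<Rightarrow> ('a,'n) mform. (\<forall>j<2 * CARD('n). c j \<in> AT_sub) \<and> (\<forall>j\<ge>2 * CARD('n). c j = fzero)}
            (A_alg :: ('a,'n) mform set)
     \<and> {c \<in> TA CARD('n). (canon c :: ('a,'n) mform) = fzero}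
         = ta_ideal CARD('n) {ta_pow CARD('n) (ta_X CARD('n)) (2 * CARD('n)), ta_O CARD('n)}"
proof
  let ?n = "CARD('n)"
  interpret ta_relations ?n "TYPE('a)" by unfold_locales (rule card_pos)
  let ?\<Phi> = "\<lambda>c :: nat \<Rightarrow> ('a,'n) mform. \<Sum>j<2 * ?n. c j \<and>\<^sub>w fpow Xf j"
  let ?D = "{c :: nat \<Rightarrow> ('a,'n) mform. (\<forall>j<2 * ?n. c j \<in> AT_sub) \<and> (\<forall>j\<ge>2 * ?n. c j = fzero)}"
  have coords: "\<exists>a. (\<forall>j<2 * ?n. c j = at_comb (a j)) \<and> ?\<Phi> c = canon (coef ?n a)" if c: "c \<in> ?D" for c
  proof -
    have "\<forall>j. \<exists>b. j < 2 * ?n \<longrightarrow> c j = at_comb b" using c unfolding AT_sub_eq by blast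
    then obtain a where a: "\<And>j. j < 2 * ?n \<Longrightarrow> c j = at_comb (a j)" by metis
    have "?\<Phi> c = (\<Sum>j<2 * ?n. at_comb (a j) \<and>\<^sub>w fpow Xf j)"
      by (rule sum.cong[OF refl]) (simp add: a)
    then show ?thesis using a canon_coef[of a, where 'n='n] by auto
  qed
  have "bij_betw ?\<Phi> ?D A_alg"
    unfolding bij_betw_def
  proof (intro conjI inj_onI equalityI subsetI)
    fix c c' assume c: "c \<in> ?D" "c' \<in> ?D" and eq: "?\<Phi> c = ?\<Phi> c'"
    obtain a where a: "\<forall>j<2 * ?n. c j = at_comb (a j)" "?\<Phi> c = canon (coef ?n a)" using coords[OF c(1)] by blast
    obtain a' where a': "\<forall>j<2 * ?n. c' j = at_comb (a' j)" "?\<Phi> c' = canon (coef ?n a')" using coords[OF c(2)] by blast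
    let ?d = "\<lambda>j S. a j S - a' j S"
    have "coef ?n ?d = (\<lambda>U m. coef ?n a U m + (-1) * coef ?n a' U m)" by (auto simp: coef_def fun_eq_iff)
    then have "canon (coef ?n ?d) = (canon (coef ?n a) + fscale (-1) (canon (coef ?n a')) :: ('a,'n) mform)"
      by (simp only: canon_add canon_scale)
    then have "canon (coef ?n ?d) = (0 :: ('a,'n) mform)" using eq a(2) a'(2) by simp
    then have z: "coef ?n ?d = (\<lambda>U m. 0)" by (rule canon_reduced_injective[OF coef_reduced[OF card_pos]])
    have "a j S = a' j S" if "j < 2 * ?n" "S \<subseteq> {..<?n - 1}" for j S
      using fun_cong[OF fun_cong[OF z, of S], of j] that by (simp add: coef_def)
    then have "at_comb (a j) = (at_comb (a' j) :: ('a,'n) mform)" if "j < 2 * ?n" for j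
      unfolding at_comb_def using that by (intro sum.cong refl) simp
    then show "c = c'" using a(1) a'(1) c by (intro ext) (metis (mono_tags, lifting) mem_Collect_eq not_less)
  next
    fix f assume "f \<in> ?\<Phi> ` ?D"
    then show "f \<in> A_alg" using coords canon_in_A_alg by fastforce
  next
    fix f :: "('a,'n) mform" assume "f \<in> A_alg"
    then obtain r where r: "r \<in> R" "f = canon r" using A_alg_canon_reduced by blast
    define c where "c j = (if j < 2 * ?n then at_comb (\<lambda>S. r S j) else fzero :: ('a,'n) mform)" for j
    have "c \<in> ?D" by (auto simp: c_def AT_sub_eq)
    moreover have "?\<Phi> c = (\<Sum>j<2 * ?n. at_comb (\<lambda>S. r S j) \<and>\<^sub>w fpow Xf j)"
      by (rule sum.cong[OF refl]) (simp add: c_def)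
    \<comment> \<open>A reduced element has no coefficients outside the range kept by
      \<open>coef\<close>.\<close>
    moreover have "coef ?n (\<lambda>j S. r S j) = r"
      using r(1) unfolding R_def coef_def fun_eq_iff by auto
    ultimately have "c \<in> ?D" "f = ?\<Phi> c" using r(2) canon_coef[of "\<lambda>j S. r S j", where 'n='n] by simp_all
    then show "f \<in> ?\<Phi> ` ?D" by blast
  qed
  then show "bij_betw (\<lambda>c. foldr fadd (map (\<lambda>j. c j \<and>\<^sub>w fpow Xf j) [0..<2 * ?n]) fzero) ?D A_alg"
    unfolding foldr_fadd .
  show "{c \<in> TA ?n. (canon c :: ('a,'n) mform) = fzero} = ta_ideal ?n {ta_pow ?n (ta_X ?n) (2 * ?n), ta_O ?n}"
    unfolding J_def[symmetric] fzero_eq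
  proof (intro equalityI subsetI)
    fix c :: "'a ta" assume c: "c \<in> {c \<in> TA ?n. (canon c :: ('a,'n) mform) = 0}"
    then obtain r where r: "r \<in> R" "(\<lambda>U m. c U m - r U m) \<in> J"
      using reducible_TA[of c] unfolding reducible_def by blast
    \<comment> \<open>An element of the kernel differs from its reduced form by an element of the
      ideal, so the reduced form lies in the kernel as well and is zero by injectivity.\<close>
    have "canon (\<lambda>U m. (c U m - r U m) + r U m) = (canon (\<lambda>U m. c U m - r U m) + canon r :: ('a,'n) mform)"
      by (rule canon_add)
    then have "canon r = (0 :: ('a,'n) mform)"
      using c canon_J_zero[OF r(2)[unfolded J_def]] by simp
    then have "r = (\<lambda>U m. 0)" using canon_reduced_injective[OF r(1)] by blast
    then show "c \<in> J" using r(2) by simp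
  next
    fix c :: "'a ta" assume c: "c \<in> J"
    then show "c \<in> {c \<in> TA ?n. (canon c :: ('a,'n) mform) = 0}"
      using J_subset_TA[OF c] canon_J_zero[of c, where 'n='n] unfolding J_def by simp
  qed
qed

end
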